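(* Let $\mathbb K$ be a field and let $A,A^*$ be a Leonard pair over $\mathbb K$. Then the map sending each parameter array $p$ of $A,A^*$ to the pair $p^L,p^U$ is a bijection from the set of parameter arrays for $A,A^*$ to the set of $LB$-$UB$ canonical forms for $A,A^*$. The inverse bijection sends each $LB$-$UB$ canonical form for $A,A^*$ to its designated parameter array.
   Context: $\mathrm{Mat}_{d+1}(\mathbb K)$ is the algebra of $(d+1)\times(d+1)$ matrices over $\mathbb K$, rows and columns indexed by $0,1,\dots,d$. A matrix is lower bidiagonal if every nonzero entry lies on the diagonal or the subdiagonal, and upper bidiagonal if its transpose is lower bidiagonal. Leonard pairs and systems. Let $\mathcal A$ be a $\mathbb K$-algebra isomorphic to $\mathrm{Mat}_{d+1}(\mathbb K)$, $d\ge0$. An element $A\in\mathcal A$ is multiplicity-free if it has $d+1$ distinct eigenvalues in $\mathbb K$; if these are $\theta_0,\dots,\theta_d$, the primitive idempotent of $A$ associated with $\theta_i$ is $E_i=\prod_{j\ne i}(A-\theta_jI)/(\theta_i-\theta_j)$. For multiplicity-free $A,A^*\in\mathcal A$ ($A^*$ is just a name, not an adjoint), an idempotent sequence for $A,A^*$ is an ordering $E_0,\dots,E_d$ of the primitive idempotents of $A$ such that $E_iA^*E_j=0$ if $|i-j|>1$ and $E_iA^*E_j\ne0$ if $|i-j|=1$ ($0\le i,j\le d$); a dual idempotent sequence for $A,A^*$ is an idempotent sequence for $A^*,A$. A Leonard pair in $\mathcal A$ (with ambient algebra $\mathcal A$, over $\mathbb K$, of diameter $d$) is an ordered pair $A,A^*$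 of multiplicity-free elements of $\mathcal A$ for which an idempotent sequence and a dual idempotent sequence exist. A Leonard system in $\mathcal A$ is a sequence $\Phi=(A,A^*;E_i,E^*_i,i=0..d)$ where $A,A^*\in\mathcal A$ are multiplicity-free, $E_0,\dots,E_d$ is an idempotent sequence for $A,A^*$ and $E^*_0,\dots,E^*_d$ is a dual idempotent sequence for $A,A^*$; then $A,A^*$ is a Leonard pair, said to be associated with $\Phi$. The eigenvalue sequence (resp. dual eigenvalue sequence) of $\Phi$ is $\theta_0,\dots,\theta_d$ (resp. $\theta^*_0,\dots,\theta^*_d$), where $\theta_i$ (resp. $\theta^*_i$) is the eigenvalue of $A$ (resp. $A^*$) associated with $E_i$ (resp. $E^*_i$). Leonard pairs $A,A^*$ and $B,B^*$ are isomorphic if there is a $\mathbb K$-algebra isomorphism between their ambient algebras sending $A$ to $B$ and $A^*$ to $B^*$. Split sequences. Let $V$ be an irreducible left $\mathcal A$-module (unique up to isomorphism, of dimension $d+1$) and set $U_i=(E^*_0V+\cdots+E^*_iV)\cap(E_iV+\cdots+E_dV)$. It is known that each $U_i$ has dimension 1, $V$ is the direct sum of $U_0,\dots,U_d$, $(A-\theta_iI)U_i=U_{i+1}$ ($0\le i\le d-1$), $(A-\theta_dI)U_d=0$, $(A^*-\theta^*_iI)U_i=U_{i-1}$ ($1\le i\le d$), $(A^*-\theta_0^*I)U_0=0$. For $1\le i\le d$, $\varphi_i$ is the (nonzero) eigenvalue of $(A-\theta_{i-1}I)(A^*-\theta^*_iI)$ on $U_i$. The sequence $\varphi_1,\dots,\varphi_d$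 is the first split sequence of $\Phi$. The second split sequence $\phi_1,\dots,\phi_d$ of $\Phi$ is the first split sequence of $\Phi^\Downarrow=(A,A^*;E_{d-i},E^*_i,i=0..d)$. The parameter array of $\Phi$ is $(\theta_i,\theta^*_i,i=0..d;\varphi_j,\phi_j,j=1..d)$, formed from its eigenvalue, dual eigenvalue, first split and second split sequences. It is known that two Leonard systems over $\mathbb K$ are isomorphic if and only if they have the same parameter array. A parameter array of a Leonard pair is the parameter array of an associated Leonard system; if $p=(\theta_i,\theta^*_i,i=0..d;\varphi_j,\phi_j,j=1..d)$ is one, then all of them are $p$, $(\theta_i,\theta^*_{d-i},i=0..d;\phi_{d-j+1},\varphi_{d-j+1},j=1..d)$, $(\theta_{d-i},\theta^*_i,i=0..d;\phi_j,\varphi_j,j=1..d)$, $(\theta_{d-i},\theta^*_{d-i},i=0..d;\varphi_{d-j+1},\phi_{d-j+1},j=1..d)$. The matrices $p^L,p^U$. For $p=(\theta_i,\theta^*_i,i=0..d;\varphi_j,\phi_j,j=1..d)$, $p^L\in\mathrm{Mat}_{d+1}(\mathbb K)$ is the lower bidiagonal matrix with $p^L_{ii}=\theta_i$ ($0\le i\le d$) and $p^L_{i,i-1}=1$ ($1\le i\le d$); $p^U$ is the upper bidiagonal matrix with $p^U_{ii}=\theta^*_i$ ($0\le i\le d$) and $p^U_{i-1,i}=\varphi_i$ ($1\le i\le d$). $LB$-$UB$ canonical form. A Leonard pair $A,A^*$ is in $LB$-$UB$ canonical form if its ambient algebra is $\mathrm{Mat}_{d+1}(\mathbb K)$, $A$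 is lower bidiagonal and $A^*$ is upper bidiagonal, and $A_{i,i-1}=1$ for $1\le i\le d$. For such a pair there is a unique associated Leonard system having eigenvalue sequence $A_{00},\dots,A_{dd}$ and dual eigenvalue sequence $A^*_{00},\dots,A^*_{dd}$ (the designated Leonard system); its parameter array is the designated parameter array of the pair. An $LB$-$UB$ canonical form for a Leonard pair $A,A^*$ is a Leonard pair over $\mathbb K$ which is isomorphic to $A,A^*$ and which is in $LB$-$UB$ canonical form. *)

theory Defs
  imports "Jordan_Normal_Form.VS_Connect" "Jordan_Normal_Form.Char_Poly" "HOL-Algebra.QuotRing"
begin

text \<open>
  A \<open>K\<close>-algebra over a field \<open>K\<close> (the type \<open>'a\<close>) is a HOL-Algebra \<open>module\<close> record: the type
  \<open>('a, 'b) module\<close> extends the ring record by a scalar multiplication. The library locale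
  \<open>algebra\<close> is not used since it requires commutativity.
\<close>

definition k_algebra :: "('a::field, 'b) module \<Rightarrow> bool" where
  "k_algebra \<A> \<longleftrightarrow> ring \<A> \<and> Module.module class_ring \<A> \<and>
     (\<forall>c. \<forall>x\<in>carrier \<A>. \<forall>y\<in>carrier \<A>.
        (c \<odot>\<^bsub>\<A>\<^esub> x) \<otimes>\<^bsub>\<A>\<^esub> y = c \<odot>\<^bsub>\<A>\<^esub> (x \<otimes>\<^bsub>\<A>\<^esub> y) \<and>
        x \<otimes>\<^bsub>\<A>\<^esub> (c \<odot>\<^bsub>\<A>\<^esub> y) = c \<odot>\<^bsub>\<A>\<^esub> (x \<otimes>\<^bsub>\<A>\<^esub> y))"

definition k_algebra_iso ::
  "('a::field, 'b) module \<Rightarrow> ('a, 'c) module \<Rightarrow> ('b \<Rightarrow> 'c) set" where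
  "k_algebra_iso \<A> \<B> =
     {f \<in> ring_iso \<A> \<B>. \<forall>c. \<forall>x\<in>carrier \<A>. f (c \<odot>\<^bsub>\<A>\<^esub> x) = c \<odot>\<^bsub>\<B>\<^esub> f x}"

abbreviation mat_algebra :: "nat \<Rightarrow> ('a::field, 'a mat) module" where
  "mat_algebra d \<equiv> module_mat TYPE('a) (d + 1) (d + 1)"

definition ambient_algebra :: "('a::field, 'b) module \<Rightarrow> nat \<Rightarrow> bool" where
  "ambient_algebra \<A> d \<longleftrightarrow> k_algebra \<A> \<and> k_algebra_iso \<A> (mat_algebra d) \<noteq> {}"

text \<open>
  Eigenvalues of an element of an algebra isomorphic to \<open>Mat\<^sub>d\<^sub>+\<^sub>1(K)\<close> are those of a corresponding
  matrix (the choice of isomorphism is immaterial).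
\<close>

definition eigenvalues :: "('a::field, 'b) module \<Rightarrow> nat \<Rightarrow> 'b \<Rightarrow> 'a set" where
  "eigenvalues \<A> d A = {t. \<exists>f\<in>k_algebra_iso \<A> (mat_algebra d). eigenvalue (f A) t}"

definition multiplicity_free :: "('a::field, 'b) module \<Rightarrow> nat \<Rightarrow> 'b \<Rightarrow> bool" where
  "multiplicity_free \<A> d A \<longleftrightarrow> A \<in> carrier \<A> \<and> card (eigenvalues \<A> d A) = d + 1"

text \<open>
  The factors of the product below commute pairwise, so the set-indexed product is well
  defined although \<open>\<A>\<close> is not commutative.
\<close>

definition primitive_idempotent :: "('a::field, 'b) module \<Rightarrow> nat \<Rightarrow> 'b \<Rightarrow> 'a \<Rightarrow> 'b" where
  "primitive_idempotent \<A> d A t =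
     (\<Otimes>\<^bsub>\<A>\<^esub>s\<in>eigenvalues \<A> d A - {t}. (1 / (t - s)) \<odot>\<^bsub>\<A>\<^esub> (A \<ominus>\<^bsub>\<A>\<^esub> s \<odot>\<^bsub>\<A>\<^esub> \<one>\<^bsub>\<A>\<^esub>))"

text \<open>
  Finite sequences indexed by \<open>0,\<dots>,d\<close> or \<open>1,\<dots>,d\<close> are functions on \<^typ>\<open>nat\<close> that are
  \<^const>\<open>extensional\<close> on the index set, so that equality of sequences is equality of functions.
\<close>

definition idempotent_sequence ::
  "('a::field, 'b) module \<Rightarrow> nat \<Rightarrow> 'b \<Rightarrow> 'b \<Rightarrow> (nat \<Rightarrow> 'b) \<Rightarrow> bool" where
  "idempotent_sequence \<A> d A As E \<longleftrightarrow>
     E \<in> extensional {0..d} \<and>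
     bij_betw E {0..d} (primitive_idempotent \<A> d A ` eigenvalues \<A> d A) \<and>
     (\<forall>i\<in>{0..d}. \<forall>j\<in>{0..d}.
        (\<bar>int i - int j\<bar> > 1 \<longrightarrow> E i \<otimes>\<^bsub>\<A>\<^esub> As \<otimes>\<^bsub>\<A>\<^esub> E j = \<zero>\<^bsub>\<A>\<^esub>) \<and>
        (\<bar>int i - int j\<bar> = 1 \<longrightarrow> E i \<otimes>\<^bsub>\<A>\<^esub> As \<otimes>\<^bsub>\<A>\<^esub> E j \<noteq> \<zero>\<^bsub>\<A>\<^esub>))"

definition leonard_pair :: "('a::field, 'b) module \<Rightarrow> nat \<Rightarrow> 'b \<Rightarrow> 'b \<Rightarrow> bool" where
  "leonard_pair \<A> d A As \<longleftrightarrow>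
     ambient_algebra \<A> d \<and> multiplicity_free \<A> d A \<and> multiplicity_free \<A> d As \<and>
     (\<exists>E. idempotent_sequence \<A> d A As E) \<and> (\<exists>Es. idempotent_sequence \<A> d As A Es)"

record 'b leonard_sys =
  elt :: 'b
  dual_elt :: 'b
  idem :: "nat \<Rightarrow> 'b"
  dual_idem :: "nat \<Rightarrow> 'b"

definition leonard_system :: "('a::field, 'b) module \<Rightarrow> nat \<Rightarrow> 'b leonard_sys \<Rightarrow> bool" where
  "leonard_system \<A> d \<Phi> \<longleftrightarrow>
     ambient_algebra \<A> d \<and>
     multiplicity_free \<A> d (elt \<Phi>) \<and> multiplicity_free \<A> d (dual_elt \<Phi>) \<and>
     idempotent_sequence \<A> d (elt \<Phi>) (dual_elt \<Phi>) (idem \<Phi>) \<and>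
     idempotent_sequence \<A> d (dual_elt \<Phi>) (elt \<Phi>) (dual_idem \<Phi>)"

definition associated :: "('a::field, 'b) module \<Rightarrow> nat \<Rightarrow> 'b \<Rightarrow> 'b \<Rightarrow> 'b leonard_sys \<Rightarrow> bool" where
  "associated \<A> d A As \<Phi> \<longleftrightarrow> leonard_system \<A> d \<Phi> \<and> elt \<Phi> = A \<and> dual_elt \<Phi> = As"

definition eigenvalue_of_idempotent :: "('a::field, 'b) module \<Rightarrow> nat \<Rightarrow> 'b \<Rightarrow> 'b \<Rightarrow> 'a" where
  "eigenvalue_of_idempotent \<A> d A E =
     (THE t. t \<in> eigenvalues \<A> d A \<and> primitive_idempotent \<A> d A t = E)"

definition eigenvalue_sequence ::
  "('a::field, 'b) module \<Rightarrow> nat \<Rightarrow> 'b leonard_sys \<Rightarrow> nat \<Rightarrow> 'a" where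
  "eigenvalue_sequence \<A> d \<Phi> = (\<lambda>i\<in>{0..d}. eigenvalue_of_idempotent \<A> d (elt \<Phi>) (idem \<Phi> i))"

definition dual_eigenvalue_sequence ::
  "('a::field, 'b) module \<Rightarrow> nat \<Rightarrow> 'b leonard_sys \<Rightarrow> nat \<Rightarrow> 'a" where
  "dual_eigenvalue_sequence \<A> d \<Phi> =
     (\<lambda>i\<in>{0..d}. eigenvalue_of_idempotent \<A> d (dual_elt \<Phi>) (dual_idem \<Phi> i))"

text \<open>
  A left \<open>\<A>\<close>-module \<open>V\<close> also uses the \<open>module\<close> record, with \<open>\<A>\<close> acting by \<open>\<odot>\<^bsub>V\<^esub>\<close>; the fields
  \<open>mult\<close> and \<open>one\<close> of \<open>V\<close> play no role. The library locale \<open>module\<close> requires a commutative base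
  ring, so only its axioms on the action are taken over.
\<close>

definition left_module :: "('a::field, 'b) module \<Rightarrow> ('b, 'v) module \<Rightarrow> bool" where
  "left_module \<A> V \<longleftrightarrow> ring \<A> \<and> abelian_group V \<and> module_axioms \<A> V"

definition irreducible_left_module :: "('a::field, 'b) module \<Rightarrow> ('b, 'v) module \<Rightarrow> bool" where
  "irreducible_left_module \<A> V \<longleftrightarrow> left_module \<A> V \<and> carrier V \<noteq> {\<zero>\<^bsub>V\<^esub>} \<and>
     (\<forall>H. Module.submodule H \<A> V \<longrightarrow> H = {\<zero>\<^bsub>V\<^esub>} \<or> H = carrier V)"

definition image_of :: "('b, 'v) module \<Rightarrow> 'b \<Rightarrow> 'v set" where
  "image_of V X = (\<lambda>v. X \<odot>\<^bsub>V\<^esub> v) ` carrier V"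

definition sum_of_subspaces :: "('b, 'v) module \<Rightarrow> (nat \<Rightarrow> 'v set) \<Rightarrow> nat set \<Rightarrow> 'v set" where
  "sum_of_subspaces V S I = {(\<Oplus>\<^bsub>V\<^esub>j\<in>I. x j) | x. \<forall>j\<in>I. x j \<in> S j}"

definition split_space :: "('b, 'v) module \<Rightarrow> nat \<Rightarrow> 'b leonard_sys \<Rightarrow> nat \<Rightarrow> 'v set" where
  "split_space V d \<Phi> i =
     sum_of_subspaces V (\<lambda>j. image_of V (dual_idem \<Phi> j)) {0..i} \<inter>
     sum_of_subspaces V (\<lambda>j. image_of V (idem \<Phi> j)) {i..d}"

text \<open>The scalar \<open>c\<close> of \<open>K\<close> acts on \<open>V\<close> as the element \<open>c \<odot>\<^bsub>\<A>\<^esub> \<one>\<^bsub>\<A>\<^esub>\<close> of \<open>\<A>\<close>.\<close>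

definition first_split_sequence ::
  "('a::field, 'b) module \<Rightarrow> ('b, 'v) module \<Rightarrow> nat \<Rightarrow> 'b leonard_sys \<Rightarrow> nat \<Rightarrow> 'a" where
  "first_split_sequence \<A> V d \<Phi> = (\<lambda>i\<in>{1..d}.
     THE c. \<exists>u\<in>split_space V d \<Phi> i. u \<noteq> \<zero>\<^bsub>V\<^esub> \<and>
       ((elt \<Phi> \<ominus>\<^bsub>\<A>\<^esub> eigenvalue_sequence \<A> d \<Phi> (i - 1) \<odot>\<^bsub>\<A>\<^esub> \<one>\<^bsub>\<A>\<^esub>) \<otimes>\<^bsub>\<A>\<^esub>
        (dual_elt \<Phi> \<ominus>\<^bsub>\<A>\<^esub> dual_eigenvalue_sequence \<A> d \<Phi> i \<odot>\<^bsub>\<A>\<^esub> \<one>\<^bsub>\<A>\<^esub>)) \<odot>\<^bsub>V\<^esub> u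
       = (c \<odot>\<^bsub>\<A>\<^esub> \<one>\<^bsub>\<A>\<^esub>) \<odot>\<^bsub>V\<^esub> u)"

definition second_inversion :: "nat \<Rightarrow> 'b leonard_sys \<Rightarrow> 'b leonard_sys" where
  "second_inversion d \<Phi> = \<Phi>\<lparr>idem := (\<lambda>i\<in>{0..d}. idem \<Phi> (d - i))\<rparr>"

definition second_split_sequence ::
  "('a::field, 'b) module \<Rightarrow> ('b, 'v) module \<Rightarrow> nat \<Rightarrow> 'b leonard_sys \<Rightarrow> nat \<Rightarrow> 'a" where
  "second_split_sequence \<A> V d \<Phi> = first_split_sequence \<A> V d (second_inversion d \<Phi>)"

record 'a param_array =
  th :: "nat \<Rightarrow> 'a"
  ths :: "nat \<Rightarrow> 'a"
  vphi :: "nat \<Rightarrow> 'a"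
  phi :: "nat \<Rightarrow> 'a"

text \<open>
  The module \<open>V\<close> through which the split sequences are defined is a parameter; it is meant to be
  irreducible, and different choices yield the same parameter array.
\<close>

definition parameter_array ::
  "('a::field, 'b) module \<Rightarrow> ('b, 'v) module \<Rightarrow> nat \<Rightarrow> 'b leonard_sys \<Rightarrow> 'a param_array" where
  "parameter_array \<A> V d \<Phi> =
     \<lparr>th = eigenvalue_sequence \<A> d \<Phi>, ths = dual_eigenvalue_sequence \<A> d \<Phi>,
      vphi = first_split_sequence \<A> V d \<Phi>, phi = second_split_sequence \<A> V d \<Phi>\<rparr>"

definition parameter_arrays ::
  "('a::field, 'b) module \<Rightarrow> ('b, 'v) module \<Rightarrow> nat \<Rightarrow> 'b \<Rightarrow> 'b \<Rightarrow> 'a param_array set" where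
  "parameter_arrays \<A> V d A As = parameter_array \<A> V d ` {\<Phi>. associated \<A> d A As \<Phi>}"

definition pL :: "nat \<Rightarrow> 'a::field param_array \<Rightarrow> 'a mat" where
  "pL d p = mat (d + 1) (d + 1)
     (\<lambda>(i, j). if i = j then th p i else if i = j + 1 then 1 else 0)"

definition pU :: "nat \<Rightarrow> 'a::field param_array \<Rightarrow> 'a mat" where
  "pU d p = mat (d + 1) (d + 1)
     (\<lambda>(i, j). if i = j then ths p i else if j = i + 1 then vphi p j else 0)"

definition lower_bidiagonal :: "'a::zero mat \<Rightarrow> bool" where
  "lower_bidiagonal M \<longleftrightarrow>
     (\<forall>i<dim_row M. \<forall>j<dim_col M. M $$ (i, j) \<noteq> 0 \<longrightarrow> i = j \<or> i = j + 1)"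

definition upper_bidiagonal :: "'a::zero mat \<Rightarrow> bool" where
  "upper_bidiagonal M \<longleftrightarrow> lower_bidiagonal (transpose_mat M)"

definition LB_UB_canonical :: "nat \<Rightarrow> 'a::field mat \<Rightarrow> 'a mat \<Rightarrow> bool" where
  "LB_UB_canonical d B Bs \<longleftrightarrow> leonard_pair (mat_algebra d) d B Bs \<and>
     lower_bidiagonal B \<and> upper_bidiagonal Bs \<and> (\<forall>i\<in>{1..d}. B $$ (i, i - 1) = 1)"

definition leonard_pair_iso ::
  "('a::field, 'b) module \<Rightarrow> 'b \<Rightarrow> 'b \<Rightarrow> ('a, 'c) module \<Rightarrow> 'c \<Rightarrow> 'c \<Rightarrow> bool" where
  "leonard_pair_iso \<A> A As \<B> B Bs \<longleftrightarrow> (\<exists>f\<in>k_algebra_iso \<A> \<B>. f A = B \<and> f As = Bs)"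

definition LB_UB_canonical_forms ::
  "('a::field, 'b) module \<Rightarrow> 'b \<Rightarrow> 'b \<Rightarrow> ('a mat \<times> 'a mat) set" where
  "LB_UB_canonical_forms \<A> A As =
     {(B, Bs). \<exists>n. LB_UB_canonical n B Bs \<and> leonard_pair_iso \<A> A As (mat_algebra n) B Bs}"

definition designated_system :: "nat \<Rightarrow> 'a::field mat \<Rightarrow> 'a mat \<Rightarrow> 'a mat leonard_sys" where
  "designated_system d B Bs = (THE \<Phi>. associated (mat_algebra d) d B Bs \<Phi> \<and>
     eigenvalue_sequence (mat_algebra d) d \<Phi> = (\<lambda>i\<in>{0..d}. B $$ (i, i)) \<and>
     dual_eigenvalue_sequence (mat_algebra d) d \<Phi> = (\<lambda>i\<in>{0..d}. Bs $$ (i, i)))"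

definition designated_parameter_array ::
  "('a::field mat, 'w) module \<Rightarrow> nat \<Rightarrow> 'a mat \<Rightarrow> 'a mat \<Rightarrow> 'a param_array" where
  "designated_parameter_array W d B Bs =
     parameter_array (mat_algebra d) W d (designated_system d B Bs)"

end

theory Submission
  imports Defs
begin

text \<open>
  Everything is computed in the column module of \<open>Mat\<^sub>d\<^sub>+\<^sub>1(K)\<close>: an irreducible module is isomorphic to
  it, and parameter arrays are invariant under isomorphism. For a Leonard system \<open>(A, A\<^sup>*)\<close>, a vector
  \<open>u\<^sub>0\<close> spanning \<open>E\<^sup>*\<^sub>0V\<close> yields a basis \<open>u\<^sub>i\<^sub>+\<^sub>1 = (A - \<theta>\<^sub>i) u\<^sub>i\<close> in which \<open>A\<close> is lower bidiagonal with
  subdiagonal 1. The change from it to the \<open>A\<^sup>*\<close>-eigenbasis is upper triangular and the change to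
  the \<open>A\<close>-eigenbasis is lower triangular, so tridiagonality makes \<open>A\<^sup>*\<close> upper bidiagonal, and its
  superdiagonal is the first split sequence.
  Conversely, for a Leonard pair in LB-UB form the diagonal orderings of the idempotents are idempotent
  sequences: some ordering makes the nonzero \<open>E\<^sub>i A\<^sup>* E\<^sub>j\<close> a path, triangularity kills one side, the path
  is symmetric, and a connected graph joining only consecutive indices contains all such edges.
\<close>

section \<open>Algebra isomorphisms\<close>

text \<open>The definition of \<open>eigenvalues\<close> refers to all isomorphisms onto the matrix
  algebra. That they all agree is obtained without describing these isomorphisms: t is an eigenvalue
  of M iff M - t has no left inverse, and every algebra isomorphism preserves this. The same
  argument compares matrix algebras of a priori different sizes, which settles the unknown size in
  \<open>LB_UB_canonical_forms\<close>.

  Triangularity is treated through flags of coordinate subspaces: triangular matrices preserve the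
  flag, Hessenberg matrices move it by at most one step, and both properties survive conjugation by
  P if P and its inverse preserve the flag. A rank function on the indices covers both directions of
  the flag with one proof.

  Injectivity rests on the diagonals alone. A system is determined by its pair and its two
  eigenvalue orderings, and these are the diagonals of \<open>pL\<close> and \<open>pU\<close>; both
  split sequences then agree because the systems are equal.\<close>

lemma k_algebra_iso_comp:
  assumes "f \<in> k_algebra_iso \<A> \<B>" "g \<in> k_algebra_iso \<B> \<C>"
  shows "g \<circ> f \<in> k_algebra_iso \<A> \<C>"
  using assms ring_iso_set_trans[of f \<A> \<B> g \<C>] ring_iso_memE(1)[of f \<A> \<B>]
  by (auto simp: k_algebra_iso_def)

locale k_algebra_isomorphism =
  fixes \<A> :: "('a::field, 'b) module" and \<B> :: "('a, 'c) module" and f :: "'b \<Rightarrow> 'c"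
  assumes dom: "k_algebra \<A>" and cod: "k_algebra \<B>" and iso: "f \<in> k_algebra_iso \<A> \<B>"
begin

sublocale A: ring \<A> using dom by (simp add: k_algebra_def)
sublocale B: ring \<B> using cod by (simp add: k_algebra_def)
sublocale AM: Module.module class_ring \<A> using dom by (simp add: k_algebra_def)
sublocale BM: Module.module class_ring \<B> using cod by (simp add: k_algebra_def)

lemma ring_iso: "f \<in> ring_iso \<A> \<B>"
  using iso by (simp add: k_algebra_iso_def)

sublocale ring_hom_ring \<A> \<B> f
  using ring_iso by (intro ring_hom_ringI2 A.ring_axioms B.ring_axioms) (simp add: ring_iso_def)

lemma bij: "bij_betw f (carrier \<A>) (carrier \<B>)"
  using ring_iso by (rule ring_iso_memE(5))

lemma inj: "x \<in> carrier \<A> \<Longrightarrow> y \<in> carrier \<A> \<Longrightarrow> f x = f y \<longleftrightarrow> x = y"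
  using bij by (auto simp: bij_betw_def inj_on_def)

lemma hom_smult: "x \<in> carrier \<A> \<Longrightarrow> f (c \<odot>\<^bsub>\<A>\<^esub> x) = c \<odot>\<^bsub>\<B>\<^esub> f x"
  using iso by (simp add: k_algebra_iso_def)

lemma smult_closed_A: "x \<in> carrier \<A> \<Longrightarrow> c \<odot>\<^bsub>\<A>\<^esub> x \<in> carrier \<A>"
  by (rule AM.smult_closed) auto

lemma hom_minus:
  "x \<in> carrier \<A> \<Longrightarrow> y \<in> carrier \<A> \<Longrightarrow> f (x \<ominus>\<^bsub>\<A>\<^esub> y) = f x \<ominus>\<^bsub>\<B>\<^esub> f y"
  by (simp add: a_minus_def)

lemma inverse: "k_algebra_isomorphism \<B> \<A> (inv_into (carrier \<A>) f)"
proof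
  let ?g = "inv_into (carrier \<A>) f"
  have g: "?g y \<in> carrier \<A>" "f (?g y) = y" if "y \<in> carrier \<B>" for y
    using that bij by (auto simp: bij_betw_def inv_into_into f_inv_into_f)
  have eq: "?g y = x" if "x \<in> carrier \<A>" "f x = y" for x y
    using that bij by (auto simp: bij_betw_def)
  have "?g \<in> ring_iso \<B> \<A>"
    by (intro ring_iso_memI bij_betw_inv_into bij eq) (simp_all add: g)
  moreover have "?g (c \<odot>\<^bsub>\<B>\<^esub> y) = c \<odot>\<^bsub>\<A>\<^esub> ?g y" if "y \<in> carrier \<B>" for c y
    using that by (intro eq) (simp_all add: g hom_smult smult_closed_A)
  ultimately show "?g \<in> k_algebra_iso \<B> \<A>"
    by (simp add: k_algebra_iso_def)
qed (fact cod dom)+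

lemma inv_into_simps:
  "y \<in> carrier \<B> \<Longrightarrow> f (inv_into (carrier \<A>) f y) = y"
  "x \<in> carrier \<A> \<Longrightarrow> inv_into (carrier \<A>) f (f x) = x"
  using bij by (auto simp: bij_betw_def f_inv_into_f)

text \<open>Composition with \<open>f\<close>, or with its inverse, carries a witnessing isomorphism
  of one side to one of the other, so two isomorphisms starting from the same algebra never have to
  be compared here.\<close>

lemma eigenvalues_map:
  assumes "x \<in> carrier \<A>"
  shows "eigenvalues \<B> d (f x) = eigenvalues \<A> d x"
proof -
  have "t \<in> eigenvalues \<A> d x" if "t \<in> eigenvalues \<B> d (f x)" for t
  proof -
    from that obtain g where "g \<in> k_algebra_iso \<B> (mat_algebra d)" "eigenvalue (g (f x)) t"
      by (auto simp: eigenvalues_def)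
    then show ?thesis using k_algebra_iso_comp[OF iso, of g]
      by (auto simp: eigenvalues_def intro!: bexI[of _ "g \<circ> f"])
  qed
  moreover have "t \<in> eigenvalues \<B> d (f x)" if "t \<in> eigenvalues \<A> d x" for t
  proof -
    interpret I: k_algebra_isomorphism \<B> \<A> "inv_into (carrier \<A>) f" by (rule inverse)
    from that obtain g where "g \<in> k_algebra_iso \<A> (mat_algebra d)" "eigenvalue (g x) t"
      by (auto simp: eigenvalues_def)
    then show ?thesis using k_algebra_iso_comp[OF I.iso, of g] assms
      by (auto simp: eigenvalues_def inv_into_simps intro!: bexI[of _ "g \<circ> inv_into (carrier \<A>) f"])
  qed
  ultimately show ?thesis by auto
qed

end

section \<open>Primitive idempotents as products of commuting factors\<close>

definition idem_factor :: "('a::field, 'b) module \<Rightarrow> 'b \<Rightarrow> 'a \<Rightarrow> 'a \<Rightarrow> 'b" where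
  "idem_factor \<A> A t s = (1 / (t - s)) \<odot>\<^bsub>\<A>\<^esub> (A \<ominus>\<^bsub>\<A>\<^esub> s \<odot>\<^bsub>\<A>\<^esub> \<one>\<^bsub>\<A>\<^esub>)"

lemma idem_factor_closed:
  assumes "k_algebra \<A>" "A \<in> carrier \<A>"
  shows "idem_factor \<A> A t s \<in> carrier \<A>"
proof -
  interpret ring \<A> using assms by (simp add: k_algebra_def)
  interpret M: Module.module class_ring \<A> using assms by (simp add: k_algebra_def)
  have [simp]: "c \<odot>\<^bsub>\<A>\<^esub> x \<in> carrier \<A>" if "x \<in> carrier \<A>" for c x
    using that by (intro M.smult_closed) auto
  show ?thesis using assms by (simp add: idem_factor_def)
qed

text \<open>The factors commute, so the product over a finite set can be expanded although the
  ambient monoid is not commutative.\<close>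

lemma finprod_idem_factor:
  assumes alg: "k_algebra \<A>" and A: "A \<in> carrier \<A>"
  shows finprod_idem_factor_empty: "finprod \<A> (idem_factor \<A> A t) {} = \<one>\<^bsub>\<A>\<^esub>"
    and finprod_idem_factor_insert: "finite S \<Longrightarrow> s \<notin> S \<Longrightarrow>
      finprod \<A> (idem_factor \<A> A t) (insert s S)
        = idem_factor \<A> A t s \<otimes>\<^bsub>\<A>\<^esub> finprod \<A> (idem_factor \<A> A t) S"
    and finprod_idem_factor_closed: "finprod \<A> (idem_factor \<A> A t) S \<in> carrier \<A>"
proof -
  interpret ring \<A> using alg by (simp add: k_algebra_def)
  interpret M: Module.module class_ring \<A> using alg by (simp add: k_algebra_def)
  have cl [simp]: "c \<odot>\<^bsub>\<A>\<^esub> x \<in> carrier \<A>" if "x \<in> carrier \<A>" for c x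
    using that by (intro M.smult_closed) auto
  have assoc: "(c \<odot>\<^bsub>\<A>\<^esub> x) \<otimes>\<^bsub>\<A>\<^esub> y = c \<odot>\<^bsub>\<A>\<^esub> (x \<otimes>\<^bsub>\<A>\<^esub> y)"
      "x \<otimes>\<^bsub>\<A>\<^esub> (c \<odot>\<^bsub>\<A>\<^esub> y) = c \<odot>\<^bsub>\<A>\<^esub> (x \<otimes>\<^bsub>\<A>\<^esub> y)"
    if "x \<in> carrier \<A>" "y \<in> carrier \<A>" for c x y
    using alg that by (auto simp: k_algebra_def)
  have scale: "c \<odot>\<^bsub>\<A>\<^esub> (c' \<odot>\<^bsub>\<A>\<^esub> x) = c' \<odot>\<^bsub>\<A>\<^esub> (c \<odot>\<^bsub>\<A>\<^esub> x)" if "x \<in> carrier \<A>" for c c' x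
    using M.smult_assoc1[of c c' x] M.smult_assoc1[of c' c x] that by (simp add: mult.commute)
  let ?k = "\<lambda>s. A \<ominus>\<^bsub>\<A>\<^esub> s \<odot>\<^bsub>\<A>\<^esub> \<one>\<^bsub>\<A>\<^esub>"
  have k: "?k s \<in> carrier \<A>" for s using A by simp
  have central: "(s \<odot>\<^bsub>\<A>\<^esub> \<one>\<^bsub>\<A>\<^esub>) \<otimes>\<^bsub>\<A>\<^esub> x = x \<otimes>\<^bsub>\<A>\<^esub> (s \<odot>\<^bsub>\<A>\<^esub> \<one>\<^bsub>\<A>\<^esub>)" if "x \<in> carrier \<A>" for s x
    using that assoc(1)[of "\<one>\<^bsub>\<A>\<^esub>" x s] assoc(2)[of x "\<one>\<^bsub>\<A>\<^esub>" s] by simp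
  have kA: "A \<otimes>\<^bsub>\<A>\<^esub> ?k s = ?k s \<otimes>\<^bsub>\<A>\<^esub> A" for s
    unfolding a_minus_def using A by (simp add: l_distr r_distr l_minus r_minus central)
  have kc: "?k s \<otimes>\<^bsub>\<A>\<^esub> ?k s' = ?k s' \<otimes>\<^bsub>\<A>\<^esub> ?k s" for s s'
  proof -
    have "?k s \<otimes>\<^bsub>\<A>\<^esub> ?k s' = A \<otimes>\<^bsub>\<A>\<^esub> ?k s' \<ominus>\<^bsub>\<A>\<^esub> (s \<odot>\<^bsub>\<A>\<^esub> \<one>\<^bsub>\<A>\<^esub>) \<otimes>\<^bsub>\<A>\<^esub> ?k s'"
      using A k[of s'] by (simp add: a_minus_def[of \<A> _ "s \<odot>\<^bsub>\<A>\<^esub> \<one>\<^bsub>\<A>\<^esub>"] a_minus_def[of \<A> _ "(s \<odot>\<^bsub>\<A>\<^esub> \<one>\<^bsub>\<A>\<^esub>) \<otimes>\<^bsub>\<A>\<^esub> _"] l_distr l_minus)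
    also have "\<dots> = ?k s' \<otimes>\<^bsub>\<A>\<^esub> A \<ominus>\<^bsub>\<A>\<^esub> ?k s' \<otimes>\<^bsub>\<A>\<^esub> (s \<odot>\<^bsub>\<A>\<^esub> \<one>\<^bsub>\<A>\<^esub>)"
      by (simp only: kA central[OF k])
    also have "\<dots> = ?k s' \<otimes>\<^bsub>\<A>\<^esub> ?k s"
      using A k[of s'] by (simp add: a_minus_def[of \<A> _ "s \<odot>\<^bsub>\<A>\<^esub> \<one>\<^bsub>\<A>\<^esub>"] a_minus_def[of \<A> _ "_ \<otimes>\<^bsub>\<A>\<^esub> (s \<odot>\<^bsub>\<A>\<^esub> \<one>\<^bsub>\<A>\<^esub>)"] r_distr r_minus)
    finally show ?thesis .
  qed
  have comm: "idem_factor \<A> A t s \<otimes>\<^bsub>\<A>\<^esub> idem_factor \<A> A t s'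
      = idem_factor \<A> A t s' \<otimes>\<^bsub>\<A>\<^esub> idem_factor \<A> A t s" for s s'
    using k by (simp add: idem_factor_def assoc kc[of s s'] scale)
  have fc: "idem_factor \<A> A t s \<in> carrier \<A>" for s using alg A by (rule idem_factor_closed)
  \<comment> \<open>\<open>finprod\<close> folds left multiplications, and a fold can be unrolled as
    soon as these commute with each other. For the factors at hand this is \<open>comm\<close>,
    which replaces commutativity of the ring.\<close>
  interpret LCD UNIV "carrier \<A>" "(\<otimes>\<^bsub>\<A>\<^esub>) \<circ> idem_factor \<A> A t"
    using fc comm by unfold_locales (simp_all add: m_assoc[symmetric])
  show "finprod \<A> (idem_factor \<A> A t) {} = \<one>\<^bsub>\<A>\<^esub>"
    by (simp add: finprod_def)
  show "finite S \<Longrightarrow> s \<notin> S \<Longrightarrow> finprod \<A> (idem_factor \<A> A t) (insert s S)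
        = idem_factor \<A> A t s \<otimes>\<^bsub>\<A>\<^esub> finprod \<A> (idem_factor \<A> A t) S"
    by (simp add: finprod_def foldD_insert)
  show "finprod \<A> (idem_factor \<A> A t) S \<in> carrier \<A>"
    by (auto simp add: finprod_def)
qed

lemma primitive_idempotent_eq:
  "primitive_idempotent \<A> d A t = finprod \<A> (idem_factor \<A> A t) (eigenvalues \<A> d A - {t})"
  by (simp add: primitive_idempotent_def idem_factor_def[abs_def])

lemma primitive_idempotent_closed:
  "k_algebra \<A> \<Longrightarrow> A \<in> carrier \<A> \<Longrightarrow> primitive_idempotent \<A> d A t \<in> carrier \<A>"
  by (simp add: primitive_idempotent_eq finprod_idem_factor_closed)

text \<open>The restriction to \<open>{0..d}\<close> keeps the transported sequences extensional, so
  that they are idempotent sequences in the sense of the definition and mapping back recovers the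
  original system as an equality.\<close>

definition map_sys :: "nat \<Rightarrow> ('b \<Rightarrow> 'c) \<Rightarrow> 'b leonard_sys \<Rightarrow> 'c leonard_sys" where
  "map_sys d f \<Phi> = \<lparr>elt = f (elt \<Phi>), dual_elt = f (dual_elt \<Phi>),
     idem = (\<lambda>i\<in>{0..d}. f (idem \<Phi> i)), dual_idem = (\<lambda>i\<in>{0..d}. f (dual_idem \<Phi> i))\<rparr>"

lemma map_sys_sel [simp]:
  "elt (map_sys d f \<Phi>) = f (elt \<Phi>)" "dual_elt (map_sys d f \<Phi>) = f (dual_elt \<Phi>)"
  "i \<le> d \<Longrightarrow> idem (map_sys d f \<Phi>) i = f (idem \<Phi> i)"
  "i \<le> d \<Longrightarrow> dual_idem (map_sys d f \<Phi>) i = f (dual_idem \<Phi> i)"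
  by (simp_all add: map_sys_def)

lemma second_inversion_map_sys:
  "second_inversion d (map_sys d f \<Phi>) = map_sys d f (second_inversion d \<Phi>)"
  by (auto simp: second_inversion_def map_sys_def fun_eq_iff)

text \<open>Membership in the carrier is all that transport of split sequences requires. It passes
  directly to \<open>second_inversion\<close>, so one transport lemma serves both the first and the
  second split sequence.\<close>

definition sys_in :: "('a::field, 'b) module \<Rightarrow> nat \<Rightarrow> 'b leonard_sys \<Rightarrow> bool" where
  "sys_in \<A> d \<Phi> \<longleftrightarrow> elt \<Phi> \<in> carrier \<A> \<and> dual_elt \<Phi> \<in> carrier \<A> \<and>
     (\<forall>i\<le>d. idem \<Phi> i \<in> carrier \<A> \<and> dual_idem \<Phi> i \<in> carrier \<A>)"

lemma sys_in_second_inversion: "sys_in \<A> d \<Phi> \<Longrightarrow> sys_in \<A> d (second_inversion d \<Phi>)"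
  by (auto simp: sys_in_def second_inversion_def)

lemma idempotent_sequence_closed:
  assumes "k_algebra \<A>" "A \<in> carrier \<A>" "idempotent_sequence \<A> d A As E" "i \<le> d"
  shows "E i \<in> carrier \<A>"
proof -
  have "E i \<in> primitive_idempotent \<A> d A ` eigenvalues \<A> d A"
    using assms(3,4) by (auto simp: idempotent_sequence_def bij_betw_def)
  then show ?thesis using assms primitive_idempotent_closed by auto
qed

lemma leonard_system_k_algebra: "leonard_system \<A> d \<Phi> \<Longrightarrow> k_algebra \<A>"
  by (simp add: leonard_system_def ambient_algebra_def)

lemma leonard_system_sys_in: "leonard_system \<A> d \<Phi> \<Longrightarrow> sys_in \<A> d \<Phi>"
  using leonard_system_k_algebra idempotent_sequence_closed[of \<A>]
  by (fastforce simp: sys_in_def leonard_system_def multiplicity_free_def)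

context k_algebra_isomorphism
begin

lemma idem_factor_map:
  "A \<in> carrier \<A> \<Longrightarrow> f (idem_factor \<A> A t s) = idem_factor \<B> (f A) t s"
  by (simp add: idem_factor_def hom_smult hom_minus smult_closed_A)

lemma primitive_idempotent_map:
  assumes "A \<in> carrier \<A>"
  shows "f (primitive_idempotent \<A> d A t) = primitive_idempotent \<B> d (f A) t"
proof -
  note A = finprod_idem_factor[OF dom assms] finprod_idem_factor[OF cod hom_closed[OF assms]]
  have "f (finprod \<A> (idem_factor \<A> A t) S) = finprod \<B> (idem_factor \<B> (f A) t) S" for S
  proof (induction S rule: infinite_finite_induct)
    case (infinite S)
    then show ?case by (simp add: finprod_def)
  next
    case (insert s S)
    then show ?case by (simp add: A idem_factor_map[OF assms] idem_factor_closed[OF dom assms])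
  qed (simp add: A)
  then show ?thesis by (simp add: primitive_idempotent_eq eigenvalues_map[OF assms])
qed

lemma multiplicity_free_map: "multiplicity_free \<A> d A \<Longrightarrow> multiplicity_free \<B> d (f A)"
  by (simp add: multiplicity_free_def eigenvalues_map)

lemma idempotent_sequence_map:
  assumes E: "idempotent_sequence \<A> d A As E" and A: "A \<in> carrier \<A>" and As: "As \<in> carrier \<A>"
  shows "idempotent_sequence \<B> d (f A) (f As) (\<lambda>i\<in>{0..d}. f (E i))"
proof -
  note cl = idempotent_sequence_closed[OF dom A E]
  let ?P = "primitive_idempotent \<A> d A ` eigenvalues \<A> d A"
  have P: "?P \<subseteq> carrier \<A>" using primitive_idempotent_closed[OF dom A] by auto
  have "bij_betw f ?P (f ` ?P)"
    using bij P by (meson bij_betw_subset)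
  moreover have "bij_betw E {0..d} ?P" using E by (simp add: idempotent_sequence_def)
  ultimately have "bij_betw (f \<circ> E) {0..d} (f ` ?P)" by (rule bij_betw_trans[rotated])
  then have "bij_betw (\<lambda>i\<in>{0..d}. f (E i)) {0..d} (f ` ?P)"
    by (subst bij_betw_cong[where g = "f \<circ> E"]) auto
  moreover have "f ` ?P = primitive_idempotent \<B> d (f A) ` eigenvalues \<B> d (f A)"
    using A by (simp add: image_image primitive_idempotent_map eigenvalues_map)
  moreover have "f (E i) \<otimes>\<^bsub>\<B>\<^esub> f As \<otimes>\<^bsub>\<B>\<^esub> f (E j) = \<zero>\<^bsub>\<B>\<^esub> \<longleftrightarrow>
      E i \<otimes>\<^bsub>\<A>\<^esub> As \<otimes>\<^bsub>\<A>\<^esub> E j = \<zero>\<^bsub>\<A>\<^esub>" if "i \<le> d" "j \<le> d" for i j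
    using inj[of "E i \<otimes>\<^bsub>\<A>\<^esub> As \<otimes>\<^bsub>\<A>\<^esub> E j" "\<zero>\<^bsub>\<A>\<^esub>"] cl[OF that(1)] cl[OF that(2)] As by simp
  ultimately show ?thesis using E by (simp add: idempotent_sequence_def)
qed

lemma leonard_system_map:
  assumes "leonard_system \<A> d \<Phi>" "ambient_algebra \<B> d"
  shows "leonard_system \<B> d (map_sys d f \<Phi>)"
  using assms idempotent_sequence_map multiplicity_free_map
  by (auto simp: leonard_system_def map_sys_def multiplicity_free_def)

lemma eigenvalue_of_idempotent_map:
  assumes "A \<in> carrier \<A>" "E \<in> carrier \<A>"
  shows "eigenvalue_of_idempotent \<B> d (f A) (f E) = eigenvalue_of_idempotent \<A> d A E"
  using assms
  by (simp add: eigenvalue_of_idempotent_def eigenvalues_map inj primitive_idempotent_closed[OF dom]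
      flip: primitive_idempotent_map)

lemma eigenvalue_sequence_map:
  assumes "sys_in \<A> d \<Phi>"
  shows "eigenvalue_sequence \<B> d (map_sys d f \<Phi>) = eigenvalue_sequence \<A> d \<Phi>"
    and "dual_eigenvalue_sequence \<B> d (map_sys d f \<Phi>) = dual_eigenvalue_sequence \<A> d \<Phi>"
  using assms by (auto simp: eigenvalue_sequence_def dual_eigenvalue_sequence_def sys_in_def
      eigenvalue_of_idempotent_map intro!: restrict_ext)

lemma map_sys_inverse:
  assumes "leonard_system \<A> d \<Phi>"
  shows "map_sys d (inv_into (carrier \<A>) f) (map_sys d f \<Phi>) = \<Phi>"
  using assms leonard_system_sys_in[OF assms]
  by (auto simp: map_sys_def sys_in_def inv_into_simps leonard_system_def idempotent_sequence_def
      fun_eq_iff extensional_def intro!: leonard_sys.equality)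

end

section \<open>Modules\<close>

lemma ring_mat_algebra: "ring (mat_algebra d :: ('a::field, 'a mat) module)"
  by (unfold_locales, insert add_inv_exists_mat, auto simp: module_mat_def algebra_simps Units_def)

lemma k_algebra_mat: "k_algebra (mat_algebra d :: ('a::field, 'a mat) module)"
proof -
  interpret vectorspace class_ring "mat_algebra d :: ('a, 'a mat) module" by (rule matrix_vs)
  show ?thesis using ring_mat_algebra[where 'a = 'a] module_axioms
    by (auto simp: k_algebra_def module_mat_simps)
qed

lemma id_k_algebra_iso: "id \<in> k_algebra_iso \<A> \<A>"
  by (auto simp: k_algebra_iso_def intro!: ring_iso_memI)

lemma ambient_algebra_mat: "ambient_algebra (mat_algebra d :: ('a::field, 'a mat) module) d"
  using k_algebra_mat id_k_algebra_iso unfolding ambient_algebra_def by blast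

lemma a_minus_mat:
  assumes "X \<in> carrier_mat (d + 1) (d + 1)" "Y \<in> carrier_mat (d + 1) (d + 1)"
  shows "X \<ominus>\<^bsub>mat_algebra d\<^esub> Y = X - (Y :: 'a::field mat)"
proof -
  interpret ring "mat_algebra d :: ('a, 'a mat) module" by (rule ring_mat_algebra)
  have Y: "\<ominus>\<^bsub>mat_algebra d\<^esub> Y = - Y"
    using assms by (intro minus_equality) (auto simp: module_mat_simps)
  show ?thesis unfolding a_minus_def Y using assms by (auto simp: module_mat_simps)
qed

definition col_module :: "nat \<Rightarrow> ('a::field mat, 'a vec) module" where
  "col_module d = \<lparr>carrier = carrier_vec (d + 1), monoid.mult = undefined, one = undefined,
     zero = 0\<^sub>v (d + 1), add = (+), module.smult = (*\<^sub>v)\<rparr>"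

lemma col_module_simps:
  "carrier (col_module d) = carrier_vec (d + 1)"
  "ring.zero (col_module d) = 0\<^sub>v (d + 1)"
  "ring.add (col_module d) = (+)"
  "module.smult (col_module d) = (*\<^sub>v)"
  by (simp_all add: col_module_def)

lemma left_module_col: "left_module (mat_algebra d) (col_module d :: ('a::field mat, 'a vec) module)"
proof -
  have "\<exists>y\<in>carrier_vec (Suc d). x + y = 0\<^sub>v (Suc d) \<and> y + x = 0\<^sub>v (Suc d)"
    if "x \<in> carrier_vec (Suc d)" for x :: "'a vec"
    using that by (intro bexI[of _ "- x"]) auto
  then have "abelian_group (col_module d :: ('a mat, 'a vec) module)"
    by unfold_locales (auto simp: col_module_simps Units_def)
  moreover have "module_axioms (mat_algebra d) (col_module d :: ('a mat, 'a vec) module)"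
    by unfold_locales (auto simp: col_module_simps module_mat_simps add_mult_distrib_mat_vec
        mult_add_distrib_mat_vec)
  ultimately show ?thesis using ring_mat_algebra unfolding left_module_def by blast
qed

text \<open>\<open>V\<close> and \<open>V'\<close> are modules over different algebras, and
  \<open>\<psi>\<close> is compatible with the actions along \<open>f\<close>. Algebra and module
  are thus replaced in a single step.\<close>

locale module_isomorphism = k_algebra_isomorphism \<A> \<B> f
  for \<A> :: "('a::field, 'b) module" and \<B> :: "('a, 'c) module" and f +
  fixes V :: "('b, 'v) module" and V' :: "('c, 'w) module" and \<psi> :: "'v \<Rightarrow> 'w"
  assumes left_V: "left_module \<A> V" and left_V': "left_module \<B> V'"
    and psi_bij: "bij_betw \<psi> (carrier V) (carrier V')"
    and psi_add: "u \<in> carrier V \<Longrightarrow> v \<in> carrier V \<Longrightarrow> \<psi> (u \<oplus>\<^bsub>V\<^esub> v) = \<psi> u \<oplus>\<^bsub>V'\<^esub> \<psi> v"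
    and psi_act: "x \<in> carrier \<A> \<Longrightarrow> v \<in> carrier V \<Longrightarrow> \<psi> (x \<odot>\<^bsub>V\<^esub> v) = f x \<odot>\<^bsub>V'\<^esub> \<psi> v"
begin

sublocale V: abelian_group V using left_V by (simp add: left_module_def)
sublocale V': abelian_group V' using left_V' by (simp add: left_module_def)

lemma act_closed: "x \<in> carrier \<A> \<Longrightarrow> v \<in> carrier V \<Longrightarrow> x \<odot>\<^bsub>V\<^esub> v \<in> carrier V"
  using left_V by (simp add: left_module_def module_axioms_def)

lemma psi_closed: "v \<in> carrier V \<Longrightarrow> \<psi> v \<in> carrier V'"
  using psi_bij by (auto simp: bij_betw_def)

lemma psi_inj: "u \<in> carrier V \<Longrightarrow> v \<in> carrier V \<Longrightarrow> \<psi> u = \<psi> v \<longleftrightarrow> u = v"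
  using psi_bij by (auto simp: bij_betw_def inj_on_def)

lemma psi_zero: "\<psi> \<zero>\<^bsub>V\<^esub> = \<zero>\<^bsub>V'\<^esub>"
  using psi_add[of "\<zero>\<^bsub>V\<^esub>" "\<zero>\<^bsub>V\<^esub>"] psi_closed[of "\<zero>\<^bsub>V\<^esub>"]
  by (metis V.add.l_one V.zero_closed V'.add.l_cancel_one')

lemma psi_finsum:
  "x \<in> I \<rightarrow> carrier V \<Longrightarrow> \<psi> (finsum V x I) = finsum V' (\<lambda>j. \<psi> (x j)) I"
proof (induction I rule: infinite_finite_induct)
  case (insert i I)
  then have x: "x i \<in> carrier V" "x \<in> I \<rightarrow> carrier V" by auto
  then have "(\<lambda>j. \<psi> (x j)) \<in> I \<rightarrow> carrier V'" using psi_closed by auto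
  with insert x show ?case by (simp add: psi_add psi_closed V.finsum_insert V'.finsum_insert)
qed (simp_all add: psi_zero)

lemma image_of_map: "X \<in> carrier \<A> \<Longrightarrow> image_of V' (f X) = \<psi> ` image_of V X"
  using psi_bij
  by (simp add: image_of_def image_image psi_act bij_betw_def flip: image_image[of "(\<odot>\<^bsub>V'\<^esub>) (f X)" \<psi>])

lemma sum_of_subspaces_map:
  assumes S: "\<And>j. j \<in> I \<Longrightarrow> S j \<subseteq> carrier V" and S': "\<And>j. j \<in> I \<Longrightarrow> S' j = \<psi> ` S j"
  shows "sum_of_subspaces V' S' I = \<psi> ` sum_of_subspaces V S I"
proof (intro equalityI subsetI)
  fix y assume "y \<in> sum_of_subspaces V' S' I"
  then obtain z where z: "y = finsum V' z I" "\<forall>j\<in>I. z j \<in> S' j"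
    by (auto simp: sum_of_subspaces_def)
  then have "\<forall>j\<in>I. \<exists>x. x \<in> S j \<and> z j = \<psi> x" using S' by auto
  then obtain x where x: "\<And>j. j \<in> I \<Longrightarrow> x j \<in> S j" "\<And>j. j \<in> I \<Longrightarrow> z j = \<psi> (x j)"
    by metis
  have "y = finsum V' (\<lambda>j. \<psi> (x j)) I"
    unfolding z(1) using x S psi_closed by (intro V'.finsum_cong') (auto simp: subset_iff)
  also have "\<dots> = \<psi> (finsum V x I)"
    using x S by (subst psi_finsum) auto
  finally show "y \<in> \<psi> ` sum_of_subspaces V S I"
    using x by (auto simp: sum_of_subspaces_def)
next
  fix y assume "y \<in> \<psi> ` sum_of_subspaces V S I"
  then obtain x where x: "y = \<psi> (finsum V x I)" "\<forall>j\<in>I. x j \<in> S j"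
    by (auto simp: sum_of_subspaces_def)
  then have "y = finsum V' (\<lambda>j. \<psi> (x j)) I"
    using S by (subst psi_finsum[symmetric]) auto
  then show "y \<in> sum_of_subspaces V' S' I"
    using x S' by (auto simp: sum_of_subspaces_def)
qed

lemma sum_of_subspaces_closed:
  assumes "\<And>j. j \<in> I \<Longrightarrow> S j \<subseteq> carrier V"
  shows "sum_of_subspaces V S I \<subseteq> carrier V"
  using assms by (auto simp: sum_of_subspaces_def intro!: V.finsum_closed)

lemma image_of_closed: "X \<in> carrier \<A> \<Longrightarrow> image_of V X \<subseteq> carrier V"
  by (auto simp: image_of_def act_closed)

lemma split_space_closed: "sys_in \<A> d \<Phi> \<Longrightarrow> i \<le> d \<Longrightarrow> split_space V d \<Phi> i \<subseteq> carrier V"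
  unfolding split_space_def
  by (intro le_infI1 sum_of_subspaces_closed image_of_closed) (auto simp: sys_in_def)

lemma split_space_map:
  assumes "sys_in \<A> d \<Phi>" "i \<le> d"
  shows "split_space V' d (map_sys d f \<Phi>) i = \<psi> ` split_space V d \<Phi> i"
proof -
  let ?X = "sum_of_subspaces V (\<lambda>j. image_of V (dual_idem \<Phi> j)) {0..i}"
  let ?Y = "sum_of_subspaces V (\<lambda>j. image_of V (idem \<Phi> j)) {i..d}"
  have c: "?X \<subseteq> carrier V" "?Y \<subseteq> carrier V"
    using assms by (auto simp: sys_in_def intro!: sum_of_subspaces_closed image_of_closed)
  have "sum_of_subspaces V' (\<lambda>j. image_of V' (dual_idem (map_sys d f \<Phi>) j)) {0..i} = \<psi> ` ?X"
    using assms by (intro sum_of_subspaces_map)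
      (auto simp: sys_in_def image_of_map dest!: subsetD[OF image_of_closed, rotated])
  moreover have "sum_of_subspaces V' (\<lambda>j. image_of V' (idem (map_sys d f \<Phi>) j)) {i..d} = \<psi> ` ?Y"
    using assms by (intro sum_of_subspaces_map)
      (auto simp: sys_in_def image_of_map dest!: subsetD[OF image_of_closed, rotated])
  moreover have "\<psi> ` (?X \<inter> ?Y) = \<psi> ` ?X \<inter> \<psi> ` ?Y"
    using psi_bij c by (intro inj_on_image_Int[where C = "carrier V"]) (auto simp: bij_betw_def)
  ultimately show ?thesis by (simp add: split_space_def)
qed

text \<open>The predicates under \<open>THE\<close> on the two sides are equivalent for every scalar
  \<open>c\<close>, hence so are the described values. Existence and uniqueness of the eigenvalue do
  not enter.\<close>

lemma first_split_sequence_map: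
  assumes \<Phi>: "sys_in \<A> d \<Phi>"
  shows "first_split_sequence \<B> V' d (map_sys d f \<Phi>) = first_split_sequence \<A> V d \<Phi>"
proof -
  have "(\<exists>w\<in>split_space V' d (map_sys d f \<Phi>) i. w \<noteq> \<zero>\<^bsub>V'\<^esub> \<and>
       ((f (elt \<Phi>) \<ominus>\<^bsub>\<B>\<^esub> a \<odot>\<^bsub>\<B>\<^esub> \<one>\<^bsub>\<B>\<^esub>) \<otimes>\<^bsub>\<B>\<^esub> (f (dual_elt \<Phi>) \<ominus>\<^bsub>\<B>\<^esub> b \<odot>\<^bsub>\<B>\<^esub> \<one>\<^bsub>\<B>\<^esub>)) \<odot>\<^bsub>V'\<^esub> w
         = (c \<odot>\<^bsub>\<B>\<^esub> \<one>\<^bsub>\<B>\<^esub>) \<odot>\<^bsub>V'\<^esub> w) \<longleftrightarrow>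
     (\<exists>u\<in>split_space V d \<Phi> i. u \<noteq> \<zero>\<^bsub>V\<^esub> \<and>
       ((elt \<Phi> \<ominus>\<^bsub>\<A>\<^esub> a \<odot>\<^bsub>\<A>\<^esub> \<one>\<^bsub>\<A>\<^esub>) \<otimes>\<^bsub>\<A>\<^esub> (dual_elt \<Phi> \<ominus>\<^bsub>\<A>\<^esub> b \<odot>\<^bsub>\<A>\<^esub> \<one>\<^bsub>\<A>\<^esub>)) \<odot>\<^bsub>V\<^esub> u
         = (c \<odot>\<^bsub>\<A>\<^esub> \<one>\<^bsub>\<A>\<^esub>) \<odot>\<^bsub>V\<^esub> u)" if "i \<le> d" for i a b c
  proof -
    let ?X = "(elt \<Phi> \<ominus>\<^bsub>\<A>\<^esub> a \<odot>\<^bsub>\<A>\<^esub> \<one>\<^bsub>\<A>\<^esub>) \<otimes>\<^bsub>\<A>\<^esub> (dual_elt \<Phi> \<ominus>\<^bsub>\<A>\<^esub> b \<odot>\<^bsub>\<A>\<^esub> \<one>\<^bsub>\<A>\<^esub>)"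
    let ?C = "c \<odot>\<^bsub>\<A>\<^esub> \<one>\<^bsub>\<A>\<^esub>"
    have X: "?X \<in> carrier \<A>" "?C \<in> carrier \<A>"
      using \<Phi> by (simp_all add: sys_in_def smult_closed_A)
    have fX: "f ?X = (f (elt \<Phi>) \<ominus>\<^bsub>\<B>\<^esub> a \<odot>\<^bsub>\<B>\<^esub> \<one>\<^bsub>\<B>\<^esub>) \<otimes>\<^bsub>\<B>\<^esub> (f (dual_elt \<Phi>) \<ominus>\<^bsub>\<B>\<^esub> b \<odot>\<^bsub>\<B>\<^esub> \<one>\<^bsub>\<B>\<^esub>)"
      "f ?C = c \<odot>\<^bsub>\<B>\<^esub> \<one>\<^bsub>\<B>\<^esub>"
      using \<Phi> by (simp_all add: sys_in_def smult_closed_A hom_minus hom_smult)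
    have "\<psi> u \<noteq> \<zero>\<^bsub>V'\<^esub> \<longleftrightarrow> u \<noteq> \<zero>\<^bsub>V\<^esub>" "f ?X \<odot>\<^bsub>V'\<^esub> \<psi> u = f ?C \<odot>\<^bsub>V'\<^esub> \<psi> u \<longleftrightarrow> ?X \<odot>\<^bsub>V\<^esub> u = ?C \<odot>\<^bsub>V\<^esub> u"
      if "u \<in> carrier V" for u
      using that X by (simp_all add: psi_inj act_closed flip: psi_zero psi_act)
    then show ?thesis
      using split_space_closed[OF \<Phi> that] unfolding split_space_map[OF \<Phi> that] fX
      by (auto simp: subset_iff)
  qed
  then show ?thesis
    by (auto simp: first_split_sequence_def eigenvalue_sequence_map[OF \<Phi>] intro!: restrict_ext)
qed

lemma parameter_array_map:
  assumes "leonard_system \<A> d \<Phi>"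
  shows "parameter_array \<B> V' d (map_sys d f \<Phi>) = parameter_array \<A> V d \<Phi>"
  using leonard_system_sys_in[OF assms] sys_in_second_inversion[OF leonard_system_sys_in[OF assms]]
  by (simp add: parameter_array_def eigenvalue_sequence_map first_split_sequence_map
      second_split_sequence_def second_inversion_map_sys)

end

text \<open>For j < n this identifies the column module with the minimal left ideal of matrices that
  vanish outside column j.\<close>

definition col_mat :: "nat \<Rightarrow> nat \<Rightarrow> 'a::field vec \<Rightarrow> 'a mat" where
  "col_mat n j w = mat n n (\<lambda>(i, k). if k = j then w $ i else 0)"

lemma col_mat_simps:
  shows col_mat_closed [simp]: "col_mat n j w \<in> carrier_mat n n"
    and col_mat_add: "v \<in> carrier_vec n \<Longrightarrow> w \<in> carrier_vec n \<Longrightarrow>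
      col_mat n j (v + w) = col_mat n j v + col_mat n j w"
    and col_mat_mult: "M \<in> carrier_mat n n \<Longrightarrow> w \<in> carrier_vec n \<Longrightarrow>
      M * col_mat n j w = col_mat n j (M *\<^sub>v w)"
  by (auto simp: col_mat_def scalar_prod_def intro!: eq_matI)

text \<open>The diagonal matrix units sum to the identity, so one of them, in position (j, j), does
  not annihilate \<open>V\<close>; choose v on which it acts nontrivially. Letting a column w act on
  v as the matrix with w in column j gives a module map from columns to \<open>V\<close>. Its kernel
  is zero because any nonzero column can be moved to the j-th unit vector, and its image is a
  nonzero submodule, hence everything by irreducibility.\<close>

lemma exists_module_isomorphism:
  fixes h :: "'a::field mat \<Rightarrow> 'b"
  assumes h: "k_algebra_isomorphism (mat_algebra d) \<A> h" and V: "irreducible_left_module \<A> V"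
  shows "\<exists>\<psi>. module_isomorphism (mat_algebra d) \<A> h (col_module d) V \<psi>"
proof -
  interpret k_algebra_isomorphism "mat_algebra d" \<A> h by (rule h)
  let ?n = "d + 1"
  have lm: "left_module \<A> V" using V by (simp add: irreducible_left_module_def)
  interpret V: abelian_group V using lm by (simp add: left_module_def)
  have act: "\<And>x v. x \<in> carrier \<A> \<Longrightarrow> v \<in> carrier V \<Longrightarrow> x \<odot>\<^bsub>V\<^esub> v \<in> carrier V"
    "\<And>x y v. x \<in> carrier \<A> \<Longrightarrow> y \<in> carrier \<A> \<Longrightarrow> v \<in> carrier V \<Longrightarrow>
       (x \<oplus>\<^bsub>\<A>\<^esub> y) \<odot>\<^bsub>V\<^esub> v = x \<odot>\<^bsub>V\<^esub> v \<oplus>\<^bsub>V\<^esub> y \<odot>\<^bsub>V\<^esub> v"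
    "\<And>x v w. x \<in> carrier \<A> \<Longrightarrow> v \<in> carrier V \<Longrightarrow> w \<in> carrier V \<Longrightarrow>
       x \<odot>\<^bsub>V\<^esub> (v \<oplus>\<^bsub>V\<^esub> w) = x \<odot>\<^bsub>V\<^esub> v \<oplus>\<^bsub>V\<^esub> x \<odot>\<^bsub>V\<^esub> w"
    "\<And>x y v. x \<in> carrier \<A> \<Longrightarrow> y \<in> carrier \<A> \<Longrightarrow> v \<in> carrier V \<Longrightarrow>
       (x \<otimes>\<^bsub>\<A>\<^esub> y) \<odot>\<^bsub>V\<^esub> v = x \<odot>\<^bsub>V\<^esub> (y \<odot>\<^bsub>V\<^esub> v)"
    "\<And>v. v \<in> carrier V \<Longrightarrow> \<one>\<^bsub>\<A>\<^esub> \<odot>\<^bsub>V\<^esub> v = v"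
    using lm by (simp_all add: left_module_def module_axioms_def)
  have act0: "x \<odot>\<^bsub>V\<^esub> \<zero>\<^bsub>V\<^esub> = \<zero>\<^bsub>V\<^esub>" if "x \<in> carrier \<A>" for x
    using act(3)[of x "\<zero>\<^bsub>V\<^esub>" "\<zero>\<^bsub>V\<^esub>"] act(1)[of x "\<zero>\<^bsub>V\<^esub>"] that
    by (metis V.add.l_one V.zero_closed V.add.l_cancel_one')
  have hc: "h M \<in> carrier \<A>" if "M \<in> carrier_mat ?n ?n" for M
    using hom_closed[of M] that by (simp add: module_mat_simps)
  have hadd: "h (M + N) = h M \<oplus>\<^bsub>\<A>\<^esub> h N" if "M \<in> carrier_mat ?n ?n" "N \<in> carrier_mat ?n ?n" for M N
    using hom_add[of M N] that by (simp add: module_mat_simps)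
  have hmult: "h (M * N) = h M \<otimes>\<^bsub>\<A>\<^esub> h N" if "M \<in> carrier_mat ?n ?n" "N \<in> carrier_mat ?n ?n" for M N
    using hom_mult[of M N] that by (simp add: module_mat_simps)
  have "\<exists>j<?n. \<exists>v\<in>carrier V. h (col_mat ?n j (unit_vec ?n j)) \<odot>\<^bsub>V\<^esub> v \<noteq> \<zero>\<^bsub>V\<^esub>"
  proof (rule ccontr)
    assume neg: "\<not> ?thesis"
    \<comment> \<open>Partial sums of the diagonal matrix units, running from the zero matrix to the
      identity. If every unit annihilates \<open>V\<close>, then by induction so does the
      identity.\<close>
    let ?D = "\<lambda>k. mat ?n ?n (\<lambda>(i, j). if i = j \<and> i < k then 1 else 0) :: 'a mat"
    have kill: "h (?D k) \<odot>\<^bsub>V\<^esub> v = \<zero>\<^bsub>V\<^esub>" if v: "v \<in> carrier V" and "k \<le> ?n" for v k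
      using \<open>k \<le> ?n\<close>
    proof (induction k)
      case 0
      have "?D 0 = \<zero>\<^bsub>mat_algebra d\<^esub>" by (auto simp: module_mat_simps)
      then have "h (?D 0) = \<zero>\<^bsub>\<A>\<^esub>" by (simp only: hom_zero)
      moreover have "\<zero>\<^bsub>\<A>\<^esub> \<odot>\<^bsub>V\<^esub> v = \<zero>\<^bsub>\<A>\<^esub> \<odot>\<^bsub>V\<^esub> v \<oplus>\<^bsub>V\<^esub> \<zero>\<^bsub>\<A>\<^esub> \<odot>\<^bsub>V\<^esub> v"
        using act(2)[of "\<zero>\<^bsub>\<A>\<^esub>" "\<zero>\<^bsub>\<A>\<^esub>" v] v by simp
      then have "\<zero>\<^bsub>\<A>\<^esub> \<odot>\<^bsub>V\<^esub> v = \<zero>\<^bsub>V\<^esub>"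
        using V.add.l_cancel_one'[of "\<zero>\<^bsub>\<A>\<^esub> \<odot>\<^bsub>V\<^esub> v" "\<zero>\<^bsub>\<A>\<^esub> \<odot>\<^bsub>V\<^esub> v"] act(1)[of "\<zero>\<^bsub>\<A>\<^esub>" v] v by auto
      ultimately show ?case by (simp only:)
    next
      case (Suc k)
      have "?D (Suc k) = ?D k + col_mat ?n k (unit_vec ?n k)"
        using Suc.prems by (auto simp: col_mat_def intro!: eq_matI)
      then show ?case using Suc v neg by (simp add: hadd hc act)
    qed
    have "h (?D ?n) = \<one>\<^bsub>\<A>\<^esub>"
    proof -
      have "?D ?n = \<one>\<^bsub>mat_algebra d\<^esub>" by (auto simp: module_mat_simps)
      then show ?thesis by (simp only: hom_one)
    qed
    then have "v = \<zero>\<^bsub>V\<^esub>" if "v \<in> carrier V" for v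
      using act(5)[OF that] kill[OF that order_refl] by (simp only:)
    then have "carrier V = {\<zero>\<^bsub>V\<^esub>}" using V.zero_closed by blast
    then show False using V by (simp add: irreducible_left_module_def)
  qed
  then obtain j v where j: "j < ?n" and v: "v \<in> carrier V"
    and nz: "h (col_mat ?n j (unit_vec ?n j)) \<odot>\<^bsub>V\<^esub> v \<noteq> \<zero>\<^bsub>V\<^esub>" by blast
  define \<psi> where "\<psi> w = h (col_mat ?n j w) \<odot>\<^bsub>V\<^esub> v" for w
  have cl: "\<psi> w \<in> carrier V" for w by (simp add: \<psi>_def act hc v)
  have add: "\<psi> (u + w) = \<psi> u \<oplus>\<^bsub>V\<^esub> \<psi> w" if "u \<in> carrier_vec ?n" "w \<in> carrier_vec ?n" for u w
    using that by (simp add: \<psi>_def col_mat_add hadd hc act v)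
  have equiv: "\<psi> (M *\<^sub>v w) = h M \<odot>\<^bsub>V\<^esub> \<psi> w" if "M \<in> carrier_mat ?n ?n" "w \<in> carrier_vec ?n" for M w
    using that by (simp add: \<psi>_def hmult hc act v flip: col_mat_mult)
  have zero: "\<psi> (0\<^sub>v ?n) = \<zero>\<^bsub>V\<^esub>"
    using add[of "0\<^sub>v ?n" "0\<^sub>v ?n"] cl[of "0\<^sub>v ?n"] by simp
  have kernel: "w = 0\<^sub>v ?n" if w: "w \<in> carrier_vec ?n" "\<psi> w = \<zero>\<^bsub>V\<^esub>" for w
  proof (rule ccontr)
    assume "w \<noteq> 0\<^sub>v ?n"
    then obtain k where k: "k < ?n" "w $ k \<noteq> 0"
      using w by (metis carrier_vecD eq_vecI index_zero_vec)
    \<comment> \<open>The multiple of a matrix unit that sends w to the j-th unit vector. So a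
      nonzero w in the kernel would put this unit vector there too, against
      \<open>nz\<close>.\<close>
    let ?M = "mat ?n ?n (\<lambda>(a, b). if a = j \<and> b = k then 1 / w $ k else 0)"
    have "?M *\<^sub>v w = unit_vec ?n j"
      using w k j by (intro eq_vecI)
        (auto simp: scalar_prod_def unit_vec_def if_distrib[of "\<lambda>x. x * _"] sum.delta cong: if_cong)
    then have "\<psi> (unit_vec ?n j) = \<zero>\<^bsub>V\<^esub>"
      using equiv[of ?M w] w act0[OF hc, of ?M] by simp
    then show False using nz by (simp add: \<psi>_def)
  qed
  have inj: "inj_on \<psi> (carrier_vec ?n)"
  proof (rule inj_onI)
    fix u w assume uw: "u \<in> carrier_vec ?n" "w \<in> carrier_vec ?n" "\<psi> u = \<psi> w"
    have "\<psi> (u - w) \<oplus>\<^bsub>V\<^esub> \<psi> w = \<psi> w"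
      using add[of "u - w" w] uw
        eq_vecI[of "u - w + w" u] by simp
    then have "\<psi> (u - w) = \<zero>\<^bsub>V\<^esub>" using cl by (metis V.add.r_cancel_one')
    then have "u - w = 0\<^sub>v ?n" using uw by (intro kernel) auto
    then have "\<forall>i<?n. (u - w) $ i = 0" by simp
    then show "u = w" using uw by (intro eq_vecI) auto
  qed
  have sub: "Module.submodule (\<psi> ` carrier_vec ?n) \<A> V"
  proof (intro Module.submodule.intro Module.submodule_axioms.intro subgroup.intro)
    fix x y assume "x \<in> \<psi> ` carrier_vec ?n" "y \<in> \<psi> ` carrier_vec ?n"
    then show "x \<otimes>\<^bsub>add_monoid V\<^esub> y \<in> \<psi> ` carrier_vec ?n" by (auto simp flip: add)
  next
    fix x assume "x \<in> \<psi> ` carrier_vec ?n"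
    then obtain w where w: "w \<in> carrier_vec ?n" "x = \<psi> w" by auto
    have "\<psi> (- w) \<oplus>\<^bsub>V\<^esub> \<psi> w = \<zero>\<^bsub>V\<^esub>"
      using add[of "- w" w] w zero by simp
    then have "\<ominus>\<^bsub>V\<^esub> x = \<psi> (- w)" using w cl by (metis V.minus_equality)
    then show "inv\<^bsub>add_monoid V\<^esub> x \<in> \<psi> ` carrier_vec ?n" using w by (simp add: a_inv_def)
  next
    fix a x assume a: "a \<in> carrier \<A>" "x \<in> \<psi> ` carrier_vec ?n"
    have "carrier \<A> = h ` carrier_mat ?n ?n"
      using bij by (simp add: bij_betw_def module_mat_simps)
    with a obtain M w where "M \<in> carrier_mat ?n ?n" "a = h M" "w \<in> carrier_vec ?n" "x = \<psi> w"
      by blast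
    then show "a \<odot>\<^bsub>V\<^esub> x \<in> \<psi> ` carrier_vec ?n" by (auto simp flip: equiv)
  qed (auto simp: cl simp flip: zero)
  have "\<psi> ` carrier_vec ?n \<noteq> {\<zero>\<^bsub>V\<^esub>}"
    using nz unfolding \<psi>_def[symmetric] by auto
  then have "\<psi> ` carrier_vec ?n = carrier V"
    using V sub by (auto simp: irreducible_left_module_def)
  then have "module_isomorphism (mat_algebra d) \<A> h (col_module d) V \<psi>"
    using inj add equiv left_module_col[of d]
    by unfold_locales (simp_all add: lm bij_betw_def col_module_simps module_mat_simps)
  then show ?thesis by (rule exI[of _ \<psi>])
qed

section \<open>Diagonalizable matrices\<close>

text \<open>The right-hand side mentions only the algebra structure, not the vectors, and is
  therefore visible to abstract isomorphisms.\<close>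

lemma eigenvalue_iff_not_left_invertible:
  assumes M: "(M :: 'a::field mat) \<in> carrier_mat n n"
  shows "eigenvalue M t \<longleftrightarrow> \<not> (\<exists>N\<in>carrier_mat n n. N * char_matrix M t = 1\<^sub>m n)"
proof
  assume "eigenvalue M t"
  then obtain v where v: "v \<in> carrier_vec n" "v \<noteq> 0\<^sub>v n" "char_matrix M t *\<^sub>v v = 0\<^sub>v n"
    using eigenvector_char_matrix[OF M] by (auto simp: eigenvalue_def)
  show "\<not> (\<exists>N\<in>carrier_mat n n. N * char_matrix M t = 1\<^sub>m n)"
  proof
    assume "\<exists>N\<in>carrier_mat n n. N * char_matrix M t = 1\<^sub>m n"
    then obtain N where N: "N \<in> carrier_mat n n" "N * char_matrix M t = 1\<^sub>m n" by auto
    have "v = (N * char_matrix M t) *\<^sub>v v" using v N by simp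
    also have "\<dots> = N *\<^sub>v (char_matrix M t *\<^sub>v v)"
      using v N char_matrix_closed[OF M] by (intro assoc_mult_mat_vec) auto
    also have "\<dots> = 0\<^sub>v n" using v N by auto
    finally show False using v by simp
  qed
next
  assume "\<not> (\<exists>N\<in>carrier_mat n n. N * char_matrix M t = 1\<^sub>m n)"
  then have "det (char_matrix M t) = 0"
    using det_non_zero_imp_unit[OF char_matrix_closed[OF M], of t "()"]
    by (auto simp: Units_def ring_mat_simps)
  then show "eigenvalue M t" using eigenvalue_det[OF M] by simp
qed

text \<open>An isomorphism commutes with forming M - t and preserves left inverses. The sizes
  \<open>m\<close> and \<open>n\<close> are left independent for the sake of
  \<open>canonical_form_diameter\<close>, where their equality is the goal.\<close>

lemma eigenvalue_mat_algebra_iso: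
  fixes h :: "'a::field mat \<Rightarrow> 'a mat"
  assumes h: "h \<in> k_algebra_iso (mat_algebra m) (mat_algebra n)"
    and M: "M \<in> carrier_mat (m + 1) (m + 1)"
  shows "eigenvalue (h M) t \<longleftrightarrow> eigenvalue M t"
proof -
  interpret k_algebra_isomorphism "mat_algebra m" "mat_algebra n" h
    using h k_algebra_mat by unfold_locales blast+
  have c: "h X \<in> carrier_mat (n + 1) (n + 1)" if "X \<in> carrier_mat (m + 1) (m + 1)" for X
    using hom_closed[of X] that by (simp add: module_mat_simps)
  have add: "h (X + Y) = h X + h Y"
    if "X \<in> carrier_mat (m + 1) (m + 1)" "Y \<in> carrier_mat (m + 1) (m + 1)" for X Y
    using hom_add[of X Y] that by (simp add: module_mat_simps)
  have mult: "h (X * Y) = h X * h Y"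
    if "X \<in> carrier_mat (m + 1) (m + 1)" "Y \<in> carrier_mat (m + 1) (m + 1)" for X Y
    using hom_mult[of X Y] that by (simp add: module_mat_simps)
  have one: "h (1\<^sub>m (m + 1)) = 1\<^sub>m (n + 1)"
    using hom_one by (simp add: module_mat_simps)
  have sm: "h (c \<cdot>\<^sub>m X) = c \<cdot>\<^sub>m h X" if "X \<in> carrier_mat (m + 1) (m + 1)" for c X
    using hom_smult[of X c] that by (simp add: module_mat_simps)
  have cm: "h (char_matrix M t) = char_matrix (h M) t"
    using M c[OF M] one by (simp add: char_matrix_def add sm)
  have "(\<exists>N\<in>carrier_mat (m + 1) (m + 1). N * char_matrix M t = 1\<^sub>m (m + 1)) \<longleftrightarrow>
      (\<exists>N\<in>carrier_mat (m + 1) (m + 1). h N * char_matrix (h M) t = 1\<^sub>m (n + 1))"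
  proof (intro bex_cong refl)
    fix N :: "'a mat" assume N: "N \<in> carrier_mat (m + 1) (m + 1)"
    have "h N * char_matrix (h M) t = h (N * char_matrix M t)"
      using N M by (simp add: mult cm)
    then show "N * char_matrix M t = 1\<^sub>m (m + 1) \<longleftrightarrow> h N * char_matrix (h M) t = 1\<^sub>m (n + 1)"
      using N M inj[of "N * char_matrix M t" "1\<^sub>m (m + 1)"] one by (simp add: module_mat_simps)
  qed
  also have "\<dots> \<longleftrightarrow> (\<exists>N\<in>carrier_mat (n + 1) (n + 1). N * char_matrix (h M) t = 1\<^sub>m (n + 1))"
  proof -
    have "h ` carrier_mat (m + 1) (m + 1) = carrier_mat (n + 1) (n + 1)"
      using bij by (simp add: bij_betw_def module_mat_simps)
    then show ?thesis by (metis (no_types, lifting) imageE imageI)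
  qed
  finally show ?thesis
    using eigenvalue_iff_not_left_invertible[OF M] eigenvalue_iff_not_left_invertible[OF c[OF M]]
    by blast
qed

lemma eigenvalues_mat:
  assumes "(M :: 'a::field mat) \<in> carrier_mat (d + 1) (d + 1)"
  shows "eigenvalues (mat_algebra d) d M = {t. eigenvalue M t}"
  unfolding eigenvalues_def using eigenvalue_mat_algebra_iso[OF _ assms] id_k_algebra_iso by blast

section \<open>Change of basis, eigenbases and idempotents\<close>

definition inv_pair :: "nat \<Rightarrow> 'a::field mat \<Rightarrow> 'a mat \<Rightarrow> bool" where
  "inv_pair n P P' \<longleftrightarrow> P \<in> carrier_mat n n \<and> P' \<in> carrier_mat n n \<and> P * P' = 1\<^sub>m n \<and> P' * P = 1\<^sub>m n"

lemma inv_pair_sym: "inv_pair n P P' \<Longrightarrow> inv_pair n P' P"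
  by (auto simp: inv_pair_def)

lemma inv_pair_mult:
  assumes "inv_pair n P P'" "inv_pair n Q Q'"
  shows "inv_pair n (P * Q) (Q' * P')"
proof -
  have c: "P \<in> carrier_mat n n" "P' \<in> carrier_mat n n" "Q \<in> carrier_mat n n" "Q' \<in> carrier_mat n n"
    using assms by (auto simp: inv_pair_def)
  have "P * Q * (Q' * P') = P * (Q * Q') * P'" "Q' * P' * (P * Q) = Q' * (P' * P) * Q"
    using c by (simp_all add: assoc_mult_mat[of _ n n _ n _ n])
  then show ?thesis using assms c by (auto simp: inv_pair_def)
qed

lemma inv_pair_cancel:
  assumes "inv_pair n P P'"
  shows "X \<in> carrier_mat n m \<Longrightarrow> P' * (P * X) = X" "X \<in> carrier_mat n m \<Longrightarrow> P * (P' * X) = X"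
    "v \<in> carrier_vec n \<Longrightarrow> P' *\<^sub>v (P *\<^sub>v v) = v" "v \<in> carrier_vec n \<Longrightarrow> P *\<^sub>v (P' *\<^sub>v v) = v"
  using assms
  by (auto simp: inv_pair_def assoc_mult_mat[of _ n n _ n _ m, symmetric]
      assoc_mult_mat_vec[of _ n n _ n, symmetric])

lemma inv_pair_carrier:
  assumes "inv_pair n P P'"
  shows "P \<in> carrier_mat n n" "P' \<in> carrier_mat n n"
  using assms by (auto simp: inv_pair_def)

lemma exists_inv_pair:
  assumes P: "(P :: 'a::field mat) \<in> carrier_mat n n"
    and ker: "\<And>v. v \<in> carrier_vec n \<Longrightarrow> P *\<^sub>v v = 0\<^sub>v n \<Longrightarrow> v = 0\<^sub>v n"
  obtains P' where "inv_pair n P P'"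
proof -
  have "det P \<noteq> 0" using det_0_iff_vec_prod_zero_field[OF P] ker by auto
  then show thesis
    using det_non_zero_imp_unit[OF P, of "()"] that P
    by (auto simp: Units_def ring_mat_simps inv_pair_def)
qed

lemma conj_iso:
  assumes P: "inv_pair (d + 1) P P'"
  shows "k_algebra_isomorphism (mat_algebra d) (mat_algebra d) (\<lambda>X. P' * X * P)"
proof
  let ?n = "d + 1"
  note c = inv_pair_carrier[OF P]
  have mult: "P' * (X * Y) * P = P' * X * P * (P' * Y * P)"
    if XY: "X \<in> carrier_mat ?n ?n" "Y \<in> carrier_mat ?n ?n" for X Y
  proof -
    have "P' * X * P * (P' * Y * P) = P' * X * (P * (P' * (Y * P)))"
      using c XY by (simp add: assoc_mult_mat[of _ ?n ?n _ ?n _ ?n])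
    also have "\<dots> = P' * X * (Y * P)" using c XY by (subst inv_pair_cancel[OF P]) auto
    finally show ?thesis using c XY by (simp add: assoc_mult_mat[of _ ?n ?n _ ?n _ ?n])
  qed
  have "bij_betw (\<lambda>X. P' * X * P) (carrier_mat ?n ?n) (carrier_mat ?n ?n)"
  proof (rule bij_betw_byWitness[where f' = "\<lambda>X. P * X * P'"])
    have "P * (P' * X * P) * P' = X" "P' * (P * X * P') * P = X"
      if X: "X \<in> carrier_mat ?n ?n" for X
    proof -
      have "P * (P' * X * P) * P' = P * (P' * (X * (P * P')))"
        "P' * (P * X * P') * P = P' * (P * (X * (P' * P)))"
        using c X by (simp_all add: assoc_mult_mat[of _ ?n ?n _ ?n _ ?n])
      then show "P * (P' * X * P) * P' = X" "P' * (P * X * P') * P = X"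
        using P c X inv_pair_cancel(1,2)[OF P, of X ?n] by (auto simp: inv_pair_def)
    qed
    then show "\<forall>X\<in>carrier_mat ?n ?n. P * (P' * X * P) * P' = X"
      "\<forall>X\<in>carrier_mat ?n ?n. P' * (P * X * P') * P = X" by auto
  qed (use c in auto)
  moreover have "P' * (X + Y) * P = P' * X * P + P' * Y * P"
    if "X \<in> carrier_mat ?n ?n" "Y \<in> carrier_mat ?n ?n" for X Y
    using c that by (simp add: mult_add_distrib_mat[of _ ?n ?n _ ?n] add_mult_distrib_mat[of _ ?n ?n _ _ ?n])
  moreover have "P' * 1\<^sub>m ?n * P = 1\<^sub>m ?n"
    using P by (auto simp: inv_pair_def)
  moreover have "P' * (a \<cdot>\<^sub>m X) * P = a \<cdot>\<^sub>m (P' * X * P)" if "X \<in> carrier_mat ?n ?n" for a X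
    using c that by (simp add: mult_smult_distrib[of _ ?n ?n _ ?n] mult_smult_assoc_mat[of _ ?n ?n _ ?n])
  ultimately show "(\<lambda>X. P' * X * P) \<in> k_algebra_iso (mat_algebra d) (mat_algebra d)"
    using c mult unfolding k_algebra_iso_def
    by (auto simp: module_mat_simps intro!: ring_iso_memI)
qed (rule k_algebra_mat)+

definition dmat :: "nat \<Rightarrow> (nat \<Rightarrow> 'a::zero) \<Rightarrow> 'a mat" where
  "dmat n \<theta> = mat n n (\<lambda>(i, j). if i = j then \<theta> i else 0)"

lemma dmat_simps:
  shows dmat_closed [simp]: "dmat n \<theta> \<in> carrier_mat n n"
    and dmat_dim [simp]: "dim_row (dmat n \<theta>) = n" "dim_col (dmat n \<theta>) = n"
    and dmat_index [simp]: "i < n \<Longrightarrow> j < n \<Longrightarrow> dmat n \<theta> $$ (i, j) = (if i = j then \<theta> i else 0)"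
  by (simp_all add: dmat_def)

lemma index_mult_mat_sum:
  assumes "A \<in> carrier_mat n m" "B \<in> carrier_mat m k" "i < n" "j < k"
  shows "(A * B) $$ (i, j) = (\<Sum>l<m. A $$ (i, l) * B $$ (l, j))"
  using assms by (auto simp: scalar_prod_def lessThan_atLeast0)

lemma index_mult_mat_vec_sum:
  assumes "A \<in> carrier_mat n m" "v \<in> carrier_vec m" "i < n"
  shows "(A *\<^sub>v v) $ i = (\<Sum>l<m. A $$ (i, l) * v $ l)"
  using assms by (auto simp: scalar_prod_def lessThan_atLeast0)

lemma index_mult_dmat [simp]:
  fixes \<theta> :: "nat \<Rightarrow> 'a::field"
  assumes "A \<in> carrier_mat n n" "i < n" "j < n"
  shows "(A * dmat n \<theta>) $$ (i, j) = A $$ (i, j) * \<theta> j" "(dmat n \<theta> * A) $$ (i, j) = \<theta> i * A $$ (i, j)"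
  using assms
  by (simp_all add: index_mult_mat_sum[of _ n n _ n] if_distrib[of "\<lambda>x. _ * x"]
      if_distrib[of "\<lambda>x. x * _"] sum.delta cong: if_cong del: index_mult_mat)

lemma index_dmat_mult_vec [simp]:
  fixes \<theta> :: "nat \<Rightarrow> 'a::field"
  assumes "v \<in> carrier_vec n" "i < n"
  shows "(dmat n \<theta> *\<^sub>v v) $ i = \<theta> i * v $ i"
  using assms
  by (simp add: index_mult_mat_vec_sum[of _ n n] if_distrib[of "\<lambda>x. x * _"] sum.delta
      cong: if_cong del: index_mult_mat_vec)

lemma eigenvalue_dmat:
  "eigenvalue (dmat n \<theta>) t \<longleftrightarrow> t \<in> \<theta> ` {..<n}" for \<theta> :: "nat \<Rightarrow> 'a::field"
proof
  assume "eigenvalue (dmat n \<theta>) t"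
  then obtain v where v: "v \<in> carrier_vec n" "v \<noteq> 0\<^sub>v n" "dmat n \<theta> *\<^sub>v v = t \<cdot>\<^sub>v v"
    by (auto simp: eigenvalue_def eigenvector_def)
  then obtain k where k: "k < n" "v $ k \<noteq> 0"
    by (metis carrier_vecD eq_vecI index_zero_vec)
  have "(dmat n \<theta> *\<^sub>v v) $ k = (t \<cdot>\<^sub>v v) $ k" using v by simp
  then have "\<theta> k * v $ k = t * v $ k"
    using k v(1) index_dmat_mult_vec[OF v(1) k(1), of \<theta>] by (simp del: index_mult_mat_vec)
  then have "\<theta> k = t" using k by simp
  with k show "t \<in> \<theta> ` {..<n}" by auto
next
  assume "t \<in> \<theta> ` {..<n}"
  then obtain k where k: "k < n" "t = \<theta> k" by auto
  have "dmat n \<theta> *\<^sub>v unit_vec n k = t \<cdot>\<^sub>v unit_vec n k"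
    using k by (intro eq_vecI) (auto simp del: index_mult_mat_vec simp: unit_vec_def)
  moreover have "unit_vec n k \<noteq> (0\<^sub>v n :: 'a vec)" using k by simp
  ultimately show "eigenvalue (dmat n \<theta>) t"
    unfolding eigenvalue_def eigenvector_def dmat_dim by (intro exI[of _ "unit_vec n k"]) simp
qed

text \<open>The defining product is the Lagrange basis polynomial of the node
  \<open>\<theta> i\<close> evaluated at the matrix. On a diagonal matrix it acts entrywise, and at
  the nodes it is the Kronecker delta.\<close>

lemma primitive_idempotent_dmat:
  fixes \<theta> :: "nat \<Rightarrow> 'a::field"
  assumes inj: "inj_on \<theta> {..d}" and i: "i \<le> d"
  shows "primitive_idempotent (mat_algebra d) d (dmat (d + 1) \<theta>) (\<theta> i)
    = dmat (d + 1) (\<lambda>k. if k = i then 1 else 0)"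
proof -
  let ?n = "d + 1" and ?A = "mat_algebra d :: ('a, 'a mat) module"
  have D: "dmat ?n \<theta> \<in> carrier ?A" by (simp add: module_mat_simps)
  have fac: "idem_factor ?A (dmat ?n \<theta>) t s = dmat ?n (\<lambda>k. (\<theta> k - s) / (t - s))" for t s
    unfolding idem_factor_def
    by (subst a_minus_mat) (auto simp: module_mat_simps intro!: eq_matI)
  have dd: "dmat ?n \<alpha> * dmat ?n \<beta> = dmat ?n (\<lambda>k. \<alpha> k * \<beta> k)" for \<alpha> \<beta> :: "nat \<Rightarrow> 'a"
    by (rule eq_matI) (auto simp del: index_mult_mat(1))
  note fp = finprod_idem_factor[OF k_algebra_mat D]
  have prod: "finprod ?A (idem_factor ?A (dmat ?n \<theta>) t) S = dmat ?n (\<lambda>k. \<Prod>s\<in>S. (\<theta> k - s) / (t - s))"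
    if "finite S" for S t
    using that
  proof (induction S)
    case empty
    show ?case unfolding fp by (auto simp: module_mat_simps intro!: eq_matI)
  next
    case (insert s S)
    show ?case
      by (subst fp(2)[OF insert.hyps], subst insert.IH, subst fac)
        (simp add: module_mat_simps dd[simplified] insert.hyps)
  qed
  have ev: "eigenvalues ?A d (dmat ?n \<theta>) = \<theta> ` {..d}"
    by (subst eigenvalues_mat) (auto simp: eigenvalue_dmat lessThan_Suc_atMost)
  have "(\<Prod>s\<in>\<theta> ` {..d} - {\<theta> i}. (\<theta> k - s) / (\<theta> i - s)) = (if k = i then 1 else 0)" if k: "k \<le> d" for k
  proof (cases "k = i")
    case False
    then have "\<theta> k \<in> \<theta> ` {..d} - {\<theta> i}" using k i inj by (auto simp: inj_on_def)
    then have "(\<Prod>s\<in>\<theta> ` {..d} - {\<theta> i}. (\<theta> k - s) / (\<theta> i - s)) = 0"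
      by (intro prod_zero) auto
    then show ?thesis using False by simp
  qed (auto intro!: prod.neutral)
  then have "dmat ?n (\<lambda>k. \<Prod>s\<in>\<theta> ` {..d} - {\<theta> i}. (\<theta> k - s) / (\<theta> i - s))
      = dmat ?n (\<lambda>k. if k = i then 1 else 0)"
    by (intro eq_matI) auto
  then show ?thesis unfolding primitive_idempotent_eq ev by (subst prod) auto
qed

text \<open>These are the irreducible tridiagonal matrices: an idempotent sequence for
  \<open>A, A\<^sup>*\<close> orders an eigenbasis of \<open>A\<close> so that
  \<open>A\<^sup>*\<close> takes this form.\<close>

definition tridiag :: "nat \<Rightarrow> 'a::zero mat \<Rightarrow> bool" where
  "tridiag d S \<longleftrightarrow> (\<forall>i\<le>d. \<forall>j\<le>d. (\<bar>int i - int j\<bar> > 1 \<longrightarrow> S $$ (i, j) = 0) \<and>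
     (\<bar>int i - int j\<bar> = 1 \<longrightarrow> S $$ (i, j) \<noteq> 0))"

lemma conj_diag:
  assumes P: "inv_pair n P P'" and M: "M \<in> carrier_mat n n" and MP: "M * P = P * dmat n \<theta>"
  shows "P' * M * P = dmat n \<theta>" "P' * M = dmat n \<theta> * P'"
proof -
  note c = inv_pair_carrier[OF P]
  have "P' * M * P = P' * (M * P)" using c M by simp
  then show *: "P' * M * P = dmat n \<theta>" unfolding MP using inv_pair_cancel(1)[OF P, of "dmat n \<theta>" n] by simp
  have "dmat n \<theta> * P' = P' * M * (P * P')"
    unfolding *[symmetric] using c M by (simp add: assoc_mult_mat[of _ n n _ n _ n])
  then show "P' * M = dmat n \<theta> * P'" using P c M by (auto simp: inv_pair_def)
qed

lemma primitive_idempotent_diagonalizable: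
  fixes \<theta> :: "nat \<Rightarrow> 'a::field"
  assumes P: "inv_pair (d + 1) P P'" and M: "M \<in> carrier_mat (d + 1) (d + 1)"
    and MP: "M * P = P * dmat (d + 1) \<theta>" and inj: "inj_on \<theta> {..d}" and i: "i \<le> d"
  shows "primitive_idempotent (mat_algebra d) d M (\<theta> i)
    = P * dmat (d + 1) (\<lambda>k. if k = i then 1 else 0) * P'"
proof -
  note pd = primitive_idempotent_dmat[OF inj i]
  interpret k_algebra_isomorphism "mat_algebra d" "mat_algebra d" "\<lambda>X. P * X * P'"
    by (rule conj_iso[OF inv_pair_sym[OF P]])
  note c = inv_pair_carrier[OF P]
  have "P * dmat (d + 1) \<theta> * P' = M * (P * P')"
    using c M by (simp add: MP[symmetric, simplified] assoc_mult_mat[of _ "d + 1" "d + 1" _ "d + 1" _ "d + 1", simplified])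
  then have "P * dmat (d + 1) \<theta> * P' = M"
    using P M by (auto simp: inv_pair_def)
  then show ?thesis
    using primitive_idempotent_map[of "dmat (d + 1) \<theta>" d "\<theta> i"] dmat_closed[of "d + 1" \<theta>]
    unfolding pd module_mat_simps by simp
qed

text \<open>In an eigenbasis of \<open>M\<close> the products \<open>E\<^sub>i X E\<^sub>j\<close> are the entries of \<open>X\<close>.\<close>

lemma primitive_idempotent_product_eq_0_iff:
  fixes \<theta> :: "nat \<Rightarrow> 'a::field"
  assumes P: "inv_pair (d + 1) P P'" and M: "M \<in> carrier_mat (d + 1) (d + 1)"
    and MP: "M * P = P * dmat (d + 1) \<theta>" and inj: "inj_on \<theta> {..d}" and i: "i \<le> d" and j: "j \<le> d"
    and X: "X \<in> carrier_mat (d + 1) (d + 1)"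
  shows "primitive_idempotent (mat_algebra d) d M (\<theta> i) * X * primitive_idempotent (mat_algebra d) d M (\<theta> j)
      = 0\<^sub>m (d + 1) (d + 1) \<longleftrightarrow> (P' * X * P) $$ (i, j) = 0"
proof -
  let ?n = "d + 1"
  let ?e = "\<lambda>i. dmat ?n (\<lambda>k. if k = i then 1 else 0) :: 'a mat"
  note c = inv_pair_carrier[OF P]
  define S where "S = P' * X * P"
  have S: "S \<in> carrier_mat ?n ?n" using c X by (simp add: S_def)
  have *: "(?e i * S * ?e j) $$ (k, l) = (if k = i \<and> l = j then S $$ (i, j) else 0)"
    if "k < ?n" "l < ?n" for k l
    using S that by (subst index_mult_dmat) (auto simp del: index_mult_mat(1))
  have assoc: "(A * E * B) * Y * (A * F * B) = A * (E * (B * Y * A) * F) * B"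
    if "A \<in> carrier_mat n n" "B \<in> carrier_mat n n" "E \<in> carrier_mat n n" "F \<in> carrier_mat n n"
      "Y \<in> carrier_mat n n" for A B E F Y :: "'a mat" and n
    using that by (simp add: assoc_mult_mat[of _ n n _ n _ n])
  have eq: "(P * ?e i * P') * X * (P * ?e j * P') = P * (?e i * S * ?e j) * P'"
    unfolding S_def using c X by (intro assoc) auto
  have "P * (?e i * S * ?e j) * P' = 0\<^sub>m ?n ?n \<longleftrightarrow> ?e i * S * ?e j = 0\<^sub>m ?n ?n"
  proof -
    interpret k_algebra_isomorphism "mat_algebra d" "mat_algebra d" "\<lambda>X. P * X * P'"
      by (rule conj_iso[OF inv_pair_sym[OF P]])
    have "?e i * S * ?e j \<in> carrier_mat ?n ?n" using S by (intro mult_carrier_mat) auto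
    then show ?thesis using inj[of "?e i * S * ?e j" "0\<^sub>m ?n ?n"] hom_zero
      unfolding module_mat_simps by simp
  qed
  also have "\<dots> \<longleftrightarrow> S $$ (i, j) = 0"
  proof
    assume "?e i * S * ?e j = 0\<^sub>m ?n ?n"
    then have "(?e i * S * ?e j) $$ (i, j) = 0" using i j by simp
    then show "S $$ (i, j) = 0" using *[of i j] i j by simp
  next
    assume "S $$ (i, j) = 0"
    then show "?e i * S * ?e j = 0\<^sub>m ?n ?n"
      using * by (intro eq_matI) (auto simp del: index_mult_mat(1) simp: index_mult_mat(2,3))
  qed
  finally show ?thesis
    unfolding primitive_idempotent_diagonalizable[OF P M MP inj i]
      primitive_idempotent_diagonalizable[OF P M MP inj j] eq S_def .
qed

text \<open>Eigenvectors for distinct eigenvalues are independent, so the matrix having them as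
  columns has trivial kernel and is invertible.\<close>

lemma exists_diagonalization:
  fixes \<theta> :: "nat \<Rightarrow> 'a::field"
  assumes M: "M \<in> carrier_mat n n" and inj: "inj_on \<theta> {..<n}"
    and ev: "\<And>i. i < n \<Longrightarrow> eigenvalue M (\<theta> i)"
  obtains P P' where "inv_pair n P P'" "M * P = P * dmat n \<theta>"
proof -
  have "\<forall>i. \<exists>v. i < n \<longrightarrow> v \<in> carrier_vec n \<and> v \<noteq> 0\<^sub>v n \<and> M *\<^sub>v v = \<theta> i \<cdot>\<^sub>v v"
    using ev M by (auto simp: eigenvalue_def eigenvector_def)
  then obtain v where v: "\<And>i. i < n \<Longrightarrow> v i \<in> carrier_vec n" "\<And>i. i < n \<Longrightarrow> v i \<noteq> 0\<^sub>v n"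
    "\<And>i. i < n \<Longrightarrow> M *\<^sub>v v i = \<theta> i \<cdot>\<^sub>v v i" by metis
  have Mv: "(\<Sum>l<n. M $$ (b, l) * v i $ l) = \<theta> i * v i $ b" if "i < n" "b < n" for i b
    using arg_cong[OF v(3)[OF that(1)], of "\<lambda>w. w $ b"] v(1)[OF that(1)] that M
    by (simp add: index_mult_mat_vec_sum[OF M v(1)[OF that(1)] that(2)] del: index_mult_mat_vec)
  have indep: "\<forall>i\<in>I. x i = 0"
    if "finite I" "I \<subseteq> {..<n}" "\<And>b. b < n \<Longrightarrow> (\<Sum>i\<in>I. x i * v i $ b) = 0" for I and x :: "nat \<Rightarrow> 'a"
    using that
  proof (induction I arbitrary: x)
    case (insert s I)
    have s: "s < n" and I: "I \<subseteq> {..<n}" using insert.prems by auto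
    \<comment> \<open>Apply M to the relation and subtract \<open>\<theta> s\<close> times the
      relation: the term of s cancels, and a relation over the smaller set remains.\<close>
    have "(\<Sum>i\<in>I. (x i * (\<theta> i - \<theta> s)) * v i $ b) = 0" if b: "b < n" for b
    proof -
      have "(\<Sum>i\<in>insert s I. x i * (\<theta> i * v i $ b)) = (\<Sum>i\<in>insert s I. x i * (\<Sum>l<n. M $$ (b, l) * v i $ l))"
        using Mv b insert.prems(1) by (intro sum.cong) auto
      also have "\<dots> = (\<Sum>l<n. M $$ (b, l) * (\<Sum>i\<in>insert s I. x i * v i $ l))"
        unfolding sum_distrib_left by (subst sum.swap) (simp add: mult.left_commute)
      also have "\<dots> = 0" using insert.prems(2) by simp
      finally have 1: "(\<Sum>i\<in>insert s I. x i * (\<theta> i * v i $ b)) = 0" .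
      have 2: "(\<Sum>i\<in>insert s I. x i * v i $ b) * \<theta> s = 0" using insert.prems(2)[OF b] by simp
      have "(\<Sum>i\<in>insert s I. (x i * (\<theta> i - \<theta> s)) * v i $ b)
          = (\<Sum>i\<in>insert s I. x i * (\<theta> i * v i $ b)) - (\<Sum>i\<in>insert s I. x i * v i $ b) * \<theta> s"
        unfolding sum_distrib_right sum_subtractf[symmetric] by (intro sum.cong) (auto simp: algebra_simps)
      then show ?thesis using 1 2 insert.hyps by simp
    qed
    then have "\<forall>i\<in>I. x i * (\<theta> i - \<theta> s) = 0" by (intro insert.IH I)
    moreover have "\<theta> i \<noteq> \<theta> s" if "i \<in> I" for i
      using inj that insert.hyps I s by (auto simp: inj_on_def)
    ultimately have xI: "\<forall>i\<in>I. x i = 0" by auto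
    obtain b where b: "b < n" "v s $ b \<noteq> 0"
      using v(1,2)[OF s] by (metis carrier_vecD eq_vecI index_zero_vec)
    have "x s * v s $ b = 0" using insert.prems(2)[OF b(1)] insert.hyps xI by simp
    then show ?case using xI b by simp
  qed simp
  define P where "P = mat n n (\<lambda>(i, j). v j $ i)"
  have P: "P \<in> carrier_mat n n" by (simp add: P_def)
  have "w = 0\<^sub>v n" if w: "w \<in> carrier_vec n" "P *\<^sub>v w = 0\<^sub>v n" for w
  proof -
    have "(\<Sum>i<n. w $ i * v i $ b) = 0" if "b < n" for b
    proof -
      have "(P *\<^sub>v w) $ b = (\<Sum>i<n. P $$ (b, i) * w $ i)" using P w that by (rule_tac index_mult_mat_vec_sum)
      then show ?thesis using w that by (simp add: P_def mult.commute del: index_mult_mat_vec)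
    qed
    then have "\<forall>i\<in>{..<n}. w $ i = 0" by (intro indep) auto
    then show ?thesis using w by (intro eq_vecI) auto
  qed
  then obtain P' where "inv_pair n P P'" using exists_inv_pair[OF P] by auto
  moreover have "M * P = P * dmat n \<theta>"
  proof (rule eq_matI)
    fix i j assume "i < dim_row (P * dmat n \<theta>)" "j < dim_col (P * dmat n \<theta>)"
    then have ij: "i < n" "j < n" using P by auto
    have "(M * P) $$ (i, j) = (\<Sum>l<n. M $$ (i, l) * P $$ (l, j))"
      using M P ij by (rule index_mult_mat_sum)
    also have "\<dots> = \<theta> j * v j $ i" using ij by (simp add: P_def Mv)
    finally show "(M * P) $$ (i, j) = (P * dmat n \<theta>) $$ (i, j)"
      using P ij by (simp add: P_def del: index_mult_mat(1))
  qed (use M P in auto)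
  ultimately show thesis by (rule that)
qed

section \<open>Triangular matrices\<close>

lemma vec_nonzero_index:
  assumes "v \<in> carrier_vec n" "v \<noteq> 0\<^sub>v n"
  obtains k where "k < n" "v $ k \<noteq> 0"
  using assms by (metis carrier_vecD eq_vecI index_zero_vec)

lemma sum_nonzero_term:
  assumes "(\<Sum>l<n. f l * g l) \<noteq> (0 :: 'a::field)"
  obtains l where "l < n" "f l \<noteq> 0" "g l \<noteq> 0"
proof -
  obtain l where "l \<in> {..<n}" "f l * g l \<noteq> 0"
    using assms by (rule sum.not_neutral_contains_not_neutral)
  then show thesis using that by auto
qed

text \<open>Triangularity with respect to a rank \<open>r\<close> of the indices: \<open>r = id\<close> is lower triangular and
  \<open>r i = d - i\<close> is upper triangular.\<close>

definition tri :: "nat \<Rightarrow> (nat \<Rightarrow> nat) \<Rightarrow> 'a::field mat \<Rightarrow> bool" where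
  "tri n r B \<longleftrightarrow> B \<in> carrier_mat n n \<and> (\<forall>i<n. \<forall>j<n. B $$ (i, j) \<noteq> 0 \<longrightarrow> r j \<le> r i)"

text \<open>The members of the flag attached to \<open>r\<close>: the span of the unit vectors of
  rank at least \<open>c\<close>, decreasing in \<open>c\<close>.\<close>

definition supp_ge :: "nat \<Rightarrow> (nat \<Rightarrow> nat) \<Rightarrow> nat \<Rightarrow> 'a::field vec set" where
  "supp_ge n r c = {v \<in> carrier_vec n. \<forall>k<n. v $ k \<noteq> 0 \<longrightarrow> c \<le> r k}"

text \<open>The form of \<open>tri\<close> that refers to the flag instead of entries. Closure under
  products becomes immediate, and inverses can be handled vector by vector.\<close>

definition filt :: "nat \<Rightarrow> (nat \<Rightarrow> nat) \<Rightarrow> 'a::field mat \<Rightarrow> bool" where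
  "filt n r B \<longleftrightarrow> B \<in> carrier_mat n n \<and> (\<forall>c. \<forall>v\<in>supp_ge n r c. B *\<^sub>v v \<in> supp_ge n r c)"

text \<open>Hessenberg matrices relative to \<open>r\<close>: for \<open>id\<close> nothing stands
  above the superdiagonal, and for the reversed rank nothing stands below the subdiagonal. A
  bidiagonal matrix is \<open>tri\<close> for one of these ranks and \<open>hess\<close> for the
  other.\<close>

definition hess :: "nat \<Rightarrow> (nat \<Rightarrow> nat) \<Rightarrow> 'a::field mat \<Rightarrow> bool" where
  "hess n r X \<longleftrightarrow> X \<in> carrier_mat n n \<and> (\<forall>i<n. \<forall>j<n. X $$ (i, j) \<noteq> 0 \<longrightarrow> r j \<le> r i + 1)"

text \<open>Take k of least rank in the support of v. In row k of the product a nonzero term l has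
  rank at most that of k by triangularity and at least that of k by minimality, so only the diagonal
  term is left.\<close>

lemma tri_leading:
  assumes B: "tri n r B" and r: "inj_on r {..<n}" and v: "v \<in> carrier_vec n" "v \<noteq> 0\<^sub>v n"
  obtains k where "k < n" "v $ k \<noteq> 0" "v \<in> supp_ge n r (r k)"
    "(B *\<^sub>v v) $ k = B $$ (k, k) * v $ k"
proof -
  let ?K = "{k. k < n \<and> v $ k \<noteq> 0}"
  have "?K \<noteq> {}" using vec_nonzero_index[OF v] by blast
  then have "Min (r ` ?K) \<in> r ` ?K" by (intro Min_in) auto
  then obtain k where k: "k < n" "v $ k \<noteq> 0" "r k = Min (r ` ?K)" by auto
  have le: "r k \<le> r j" if "j < n" "v $ j \<noteq> 0" for j
    unfolding k(3) using that by (intro Min_le) auto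
  have "(B *\<^sub>v v) $ k = (\<Sum>l<n. B $$ (k, l) * v $ l)"
    using B v k by (intro index_mult_mat_vec_sum) (auto simp: tri_def)
  also have "\<dots> = (\<Sum>l<n. if l = k then B $$ (k, k) * v $ k else 0)"
  proof (intro sum.cong refl)
    fix l assume l: "l \<in> {..<n}"
    show "B $$ (k, l) * v $ l = (if l = k then B $$ (k, k) * v $ k else 0)"
    proof (rule ccontr)
      assume neg: "\<not> ?thesis"
      then have "l \<noteq> k" "B $$ (k, l) \<noteq> 0" "v $ l \<noteq> 0" by (auto split: if_splits)
      then have "r l = r k" using B l k(1) le[of l] by (auto simp: tri_def intro: le_antisym)
      then show False using r l k \<open>l \<noteq> k\<close> by (auto simp: inj_on_def)
    qed
  qed
  also have "\<dots> = B $$ (k, k) * v $ k" using k by simp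
  finally show thesis using that[of k] k le v by (auto simp: supp_ge_def)
qed

lemma tri_eigenvalue:
  assumes B: "tri n r B" and r: "inj_on r {..<n}" and t: "eigenvalue B t"
  shows "t \<in> (\<lambda>i. B $$ (i, i)) ` {..<n}"
proof -
  from t B obtain v where v: "v \<in> carrier_vec n" "v \<noteq> 0\<^sub>v n" "B *\<^sub>v v = t \<cdot>\<^sub>v v"
    by (auto simp: eigenvalue_def eigenvector_def tri_def)
  from tri_leading[OF B r v(1,2)] obtain k where k: "k < n" "v $ k \<noteq> 0"
    "(B *\<^sub>v v) $ k = B $$ (k, k) * v $ k" .
  then have "B $$ (k, k) = t" using v by simp
  with k show ?thesis by auto
qed

lemma tri_kernel:
  assumes B: "tri n r B" and r: "inj_on r {..<n}" and nz: "\<And>k. k < n \<Longrightarrow> B $$ (k, k) \<noteq> 0"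
    and v: "v \<in> carrier_vec n" "B *\<^sub>v v = 0\<^sub>v n"
  shows "v = 0\<^sub>v n"
proof (rule ccontr)
  assume "v \<noteq> 0\<^sub>v n"
  from tri_leading[OF B r v(1) this] obtain k where "k < n" "v $ k \<noteq> 0"
    "(B *\<^sub>v v) $ k = B $$ (k, k) * v $ k" .
  then show False using nz v by simp
qed

lemma unit_vec_supp_ge: "j < n \<Longrightarrow> c \<le> r j \<Longrightarrow> unit_vec n j \<in> supp_ge n r c"
  by (auto simp: supp_ge_def unit_vec_def)

lemma mult_unit_vec_index:
  "B \<in> carrier_mat n n \<Longrightarrow> i < n \<Longrightarrow> j < n \<Longrightarrow> (B *\<^sub>v unit_vec n j) $ i = B $$ (i, j)" for B :: "'a::field mat"
  by simp

lemma filt_iff_tri: "filt n r B \<longleftrightarrow> tri n r B"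
proof
  assume B: "filt n r B"
  have "r j \<le> r i" if "i < n" "j < n" "B $$ (i, j) \<noteq> 0" for i j
  proof -
    have "B *\<^sub>v unit_vec n j \<in> supp_ge n r (r j)"
      using B unit_vec_supp_ge[OF that(2), of "r j" r] by (auto simp: filt_def)
    then show ?thesis using that B mult_unit_vec_index[of B n i j] by (auto simp: supp_ge_def filt_def)
  qed
  then show "tri n r B" using B by (auto simp: tri_def filt_def)
next
  assume B: "tri n r B"
  have "B *\<^sub>v v \<in> supp_ge n r c" if v: "v \<in> supp_ge n r c" for v c
  proof -
    have "c \<le> r i" if i: "i < n" "(B *\<^sub>v v) $ i \<noteq> 0" for i
    proof -
      have "(\<Sum>l<n. B $$ (i, l) * v $ l) \<noteq> 0"
        using i B v index_mult_mat_vec_sum[of B n n v i] by (auto simp: tri_def supp_ge_def)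
      then obtain l where "l < n" "B $$ (i, l) \<noteq> 0" "v $ l \<noteq> 0" by (rule sum_nonzero_term)
      then have "c \<le> r l" "r l \<le> r i" using B v i by (auto simp: tri_def supp_ge_def)
      then show ?thesis by simp
    qed
    then show ?thesis using B v by (auto simp: supp_ge_def tri_def)
  qed
  then show "filt n r B" using B by (auto simp: filt_def tri_def)
qed

lemma filt_mult:
  assumes "filt n r A" "filt n r B"
  shows "filt n r (A * B)"
proof -
  have c: "A \<in> carrier_mat n n" "B \<in> carrier_mat n n" using assms by (simp_all add: filt_def)
  have "A * B *\<^sub>v v = A *\<^sub>v (B *\<^sub>v v)" if "v \<in> supp_ge n r c" for v c
    using c that by (intro assoc_mult_mat_vec) (auto simp: supp_ge_def)
  then show ?thesis using assms by (auto simp: filt_def)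
qed

text \<open>With a nonzero diagonal, P keeps the leading entry of each vector nonzero. Hence the
  leading index of P'x lies in the support of x, and P'x starts no lower in rank than x
  does.\<close>

lemma filt_inverse:
  assumes P: "inv_pair n P P'" and t: "tri n r P" and r: "inj_on r {..<n}"
    and nz: "\<And>k. k < n \<Longrightarrow> P $$ (k, k) \<noteq> 0"
  shows "filt n r P'"
proof -
  have "P' *\<^sub>v x \<in> supp_ge n r c" if x: "x \<in> supp_ge n r c" for x c
  proof (cases "P' *\<^sub>v x = 0\<^sub>v n")
    case False
    have xc: "x \<in> carrier_vec n" using x by (simp add: supp_ge_def)
    have y: "P' *\<^sub>v x \<in> carrier_vec n" using inv_pair_carrier[OF P] xc by simp
    from tri_leading[OF t r y False] obtain k where k: "k < n" "(P' *\<^sub>v x) $ k \<noteq> 0"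
      "P' *\<^sub>v x \<in> supp_ge n r (r k)" "(P *\<^sub>v (P' *\<^sub>v x)) $ k = P $$ (k, k) * (P' *\<^sub>v x) $ k" .
    then have "x $ k \<noteq> 0" using nz inv_pair_cancel(4)[OF P xc] by simp
    then have "c \<le> r k" using x k by (simp add: supp_ge_def)
    then show ?thesis using k(3) by (auto simp: supp_ge_def)
  qed (simp add: supp_ge_def)
  then show ?thesis using inv_pair_carrier[OF P] by (auto simp: filt_def)
qed

text \<open>Column j of P is an eigenvector of B for the j-th diagonal entry. Comparing both sides
  at its leading index k shows that the eigenvalue is the k-th diagonal entry, and distinctness of
  the diagonal forces k = j.\<close>

lemma tri_diagonalizer:
  assumes B: "tri n r B" and r: "inj_on r {..<n}" and inj: "inj_on (\<lambda>i. B $$ (i, i)) {..<n}"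
    and P: "inv_pair n P P'" and BP: "B * P = P * dmat n (\<lambda>i. B $$ (i, i))"
  shows "tri n r P" "\<And>k. k < n \<Longrightarrow> P $$ (k, k) \<noteq> 0" "filt n r P" "filt n r P'"
proof -
  note c = inv_pair_carrier[OF P]
  have Bc: "B \<in> carrier_mat n n" using B by (simp add: tri_def)
  have col: "P $$ (j, j) \<noteq> 0 \<and> P *\<^sub>v unit_vec n j \<in> supp_ge n r (r j)" if j: "j < n" for j
  proof -
    let ?v = "P *\<^sub>v unit_vec n j"
    have v: "?v \<in> carrier_vec n" using c by simp
    have "?v \<noteq> 0\<^sub>v n"
    proof
      assume "?v = 0\<^sub>v n"
      then have "P' *\<^sub>v ?v = 0\<^sub>v n" using c by auto
      then show False using inv_pair_cancel(3)[OF P, of "unit_vec n j"] j by simp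
    qed
    from tri_leading[OF B r v this] obtain k where k: "k < n" "?v $ k \<noteq> 0"
      "?v \<in> supp_ge n r (r k)" "(B *\<^sub>v ?v) $ k = B $$ (k, k) * ?v $ k" .
    have "B *\<^sub>v ?v = B * P *\<^sub>v unit_vec n j"
      using Bc c by (intro assoc_mult_mat_vec[symmetric]) auto
    then have "(B *\<^sub>v ?v) $ k = ((P * dmat n (\<lambda>i. B $$ (i, i))) *\<^sub>v unit_vec n j) $ k"
      by (simp only: BP)
    also have "\<dots> = (P * dmat n (\<lambda>i. B $$ (i, i))) $$ (k, j)"
      using c k j by (intro mult_unit_vec_index) auto
    also have "\<dots> = P $$ (k, j) * B $$ (j, j)" using c k j by (intro index_mult_dmat)
    also have "P $$ (k, j) = ?v $ k" using mult_unit_vec_index[OF c(1) k(1) j] by simp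
    finally have "B $$ (k, k) = B $$ (j, j)" using k by simp
    then have "k = j" using inj k j by (auto simp: inj_on_def)
    then show ?thesis using k mult_unit_vec_index[OF c(1) j j] by simp
  qed
  show tri: "tri n r P"
    unfolding tri_def
  proof (intro conjI c allI impI)
    fix i j assume ij: "i < n" "j < n" "P $$ (i, j) \<noteq> 0"
    then show "r j \<le> r i" using col[OF ij(2)] mult_unit_vec_index[OF c(1) ij(1,2)]
      by (auto simp: supp_ge_def)
  qed
  show nz: "\<And>k. k < n \<Longrightarrow> P $$ (k, k) \<noteq> 0" using col by blast
  show "filt n r P" using tri by (simp add: filt_iff_tri)
  show "filt n r P'" using P tri r nz by (rule filt_inverse)
qed

text \<open>In this form conjugation by flag-preserving matrices is a mere composition of maps.
  Passing from \<open>c + 1\<close> to \<open>c\<close> avoids truncated subtraction; columns of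
  rank 0 satisfy the entrywise bound trivially.\<close>

lemma hess_iff:
  "hess n r X \<longleftrightarrow> X \<in> carrier_mat n n \<and> (\<forall>c. \<forall>v\<in>supp_ge n r (c + 1). X *\<^sub>v v \<in> supp_ge n r c)"
  (is "_ \<longleftrightarrow> _ \<and> ?Q") for X :: "'a::field mat"
proof (cases "X \<in> carrier_mat n n")
  case X: True
  have ?Q if h: "hess n r X"
  proof (intro allI ballI)
    fix c and v :: "'a vec" assume v: "v \<in> supp_ge n r (c + 1)"
    have "c \<le> r i" if i: "i < n" "(X *\<^sub>v v) $ i \<noteq> 0" for i
    proof -
      have "(\<Sum>l<n. X $$ (i, l) * v $ l) \<noteq> 0"
        using i X v index_mult_mat_vec_sum[of X n n v i] by (auto simp: supp_ge_def)
      then obtain l where "l < n" "X $$ (i, l) \<noteq> 0" "v $ l \<noteq> 0" by (rule sum_nonzero_term)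
      then have "c + 1 \<le> r l" "r l \<le> r i + 1" using h v i by (auto simp: hess_def supp_ge_def)
      then show ?thesis by simp
    qed
    then show "X *\<^sub>v v \<in> supp_ge n r c" using X v by (auto simp: supp_ge_def)
  qed
  moreover have "hess n r X" if q: ?Q
    unfolding hess_def
  proof (intro conjI X allI impI)
    fix i j assume ij: "i < n" "j < n" "X $$ (i, j) \<noteq> 0"
    show "r j \<le> r i + 1"
    proof (cases "r j")
      case (Suc c)
      then have "X *\<^sub>v unit_vec n j \<in> supp_ge n r c"
        using q unit_vec_supp_ge[OF ij(2), of "c + 1" r] by auto
      then show ?thesis using Suc ij mult_unit_vec_index[OF X ij(1,2)] by (auto simp: supp_ge_def)
    qed simp
  qed
  ultimately show ?thesis using X by blast
qed (simp add: hess_def)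

lemma hess_conj:
  assumes "filt n r P" "filt n r P'" "hess n r X"
  shows "hess n r (P * X * P')"
proof -
  have c: "P \<in> carrier_mat n n" "P' \<in> carrier_mat n n" "X \<in> carrier_mat n n"
    using assms by (simp_all add: filt_def hess_def)
  have "P * X * P' *\<^sub>v v = P *\<^sub>v (X *\<^sub>v (P' *\<^sub>v v))" if "v \<in> carrier_vec n" for v
    using c that by (simp add: assoc_mult_mat_vec[of _ n n _ n] assoc_mult_mat[of _ n n _ n _ n])
  moreover have "v \<in> carrier_vec n" if "v \<in> supp_ge n r c" for v :: "'a vec" and c
    using that by (simp add: supp_ge_def)
  moreover have "P * X * P' \<in> carrier_mat n n" using c by simp
  ultimately show ?thesis using assms by (simp add: hess_iff filt_def)
qed

text \<open>A counting argument: the sequence enumerates d + 1 different idempotents, and there are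
  just d + 1 eigenvalues to produce them, so no two eigenvalues share an idempotent. This makes the
  \<open>THE\<close> in \<open>eigenvalue_of_idempotent\<close> well defined.\<close>

lemma idempotent_sequence_eigenvalues:
  assumes mf: "multiplicity_free \<A> d A" and E: "idempotent_sequence \<A> d A As E"
  shows inj_on_primitive_idempotent: "inj_on (primitive_idempotent \<A> d A) (eigenvalues \<A> d A)"
    and eigenvalue_of_primitive_idempotent: "\<And>t. t \<in> eigenvalues \<A> d A \<Longrightarrow>
      eigenvalue_of_idempotent \<A> d A (primitive_idempotent \<A> d A t) = t"
    and primitive_idempotent_eigenvalue_of: "\<And>i. i \<le> d \<Longrightarrow>
      primitive_idempotent \<A> d A (eigenvalue_of_idempotent \<A> d A (E i)) = E i"
    and bij_betw_eigenvalue_of: "bij_betw (\<lambda>i. eigenvalue_of_idempotent \<A> d A (E i)) {..d} (eigenvalues \<A> d A)"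
proof -
  let ?p = "primitive_idempotent \<A> d A" and ?ev = "eigenvalues \<A> d A"
  have b: "bij_betw E {..d} (?p ` ?ev)" using E by (simp add: idempotent_sequence_def atMost_atLeast0)
  then have "card (?p ` ?ev) = card ?ev"
    using mf bij_betw_same_card[OF b] by (simp add: multiplicity_free_def)
  moreover have "finite ?ev" using mf by (intro card_ge_0_finite) (simp add: multiplicity_free_def)
  ultimately show inj: "inj_on ?p ?ev" by (simp add: eq_card_imp_inj_on)
  show ev: "eigenvalue_of_idempotent \<A> d A (?p t) = t" if "t \<in> ?ev" for t
    unfolding eigenvalue_of_idempotent_def using that inj by (intro the_equality) (auto simp: inj_on_def)
  have "E i \<in> ?p ` ?ev" if "i \<le> d" for i using b that by (auto simp: bij_betw_def)
  then show "?p (eigenvalue_of_idempotent \<A> d A (E i)) = E i" if "i \<le> d" for i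
    using ev that by fastforce
  have "bij_betw (eigenvalue_of_idempotent \<A> d A) (?p ` ?ev) ?ev"
    using ev by (intro bij_betw_byWitness[where f' = ?p]) auto
  from bij_betw_trans[OF b this] show "bij_betw (\<lambda>i. eigenvalue_of_idempotent \<A> d A (E i)) {..d} ?ev"
    by (simp add: comp_def)
qed

text \<open>A path on \<open>{0..d}\<close> all of whose edges join consecutive numbers visits them in order,
  because dropping the edge between \<open>i\<close> and \<open>i + 1\<close> would disconnect it.\<close>

lemma path_consecutive:
  fixes \<sigma> :: "nat \<Rightarrow> nat" and E :: "nat \<Rightarrow> nat \<Rightarrow> bool"
  assumes \<sigma>: "bij_betw \<sigma> {..d} {..d}"
    and edge: "\<And>a b. a \<le> d \<Longrightarrow> b \<le> d \<Longrightarrow> \<bar>int a - int b\<bar> = 1 \<Longrightarrow> E (\<sigma> a) (\<sigma> b)"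
    and nonedge: "\<And>a b. a \<le> d \<Longrightarrow> b \<le> d \<Longrightarrow> \<bar>int a - int b\<bar> > 1 \<Longrightarrow> \<not> E (\<sigma> a) (\<sigma> b)"
    and r: "\<And>i j. i \<le> d \<Longrightarrow> j \<le> d \<Longrightarrow> \<bar>int (r i) - int (r j)\<bar> = \<bar>int i - int j\<bar>"
    and one_sided: "\<And>i j. i \<le> d \<Longrightarrow> j \<le> d \<Longrightarrow> E i j \<Longrightarrow> r j \<le> r i + 1"
    and ij: "i \<le> d" "j \<le> d"
  shows "\<bar>int i - int j\<bar> > 1 \<Longrightarrow> \<not> E i j" "\<bar>int i - int j\<bar> = 1 \<Longrightarrow> E i j"
proof -
  have pre: "\<exists>a\<le>d. \<sigma> a = i" if "i \<le> d" for i
    using \<sigma> that by (auto simp: bij_betw_def image_iff set_eq_iff) (metis atMost_iff)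
  have \<sigma>d: "\<sigma> a \<le> d" if "a \<le> d" for a using \<sigma> that by (auto simp: bij_betw_def)
  have sym: "E j i" if e: "E i j" "i \<noteq> j" "i \<le> d" "j \<le> d" for i j
  proof -
    obtain a where a: "a \<le> d" "\<sigma> a = i" using pre[OF e(3)] by blast
    obtain b where b: "b \<le> d" "\<sigma> b = j" using pre[OF e(4)] by blast
    note ab = a b
    then have "\<not> \<bar>int a - int b\<bar> > 1" "a \<noteq> b" using nonedge e by auto
    then have "\<bar>int b - int a\<bar> = 1" by auto
    then show ?thesis using edge ab by blast
  qed
  \<comment> \<open>\<open>one_sided\<close> bounds the rank difference in one direction only, but
    \<open>sym\<close> gives it for (j, i) as well. As \<open>r\<close> preserves distances, the two
    bounds together restrict the distance of i and j.\<close>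
  have near: "\<bar>int i - int j\<bar> \<le> 1" if "E i j" "i \<le> d" "j \<le> d" for i j
  proof (cases "i = j")
    case False
    then show ?thesis using r[of i j] one_sided[of i j] one_sided[of j i] sym[of i j] that by auto
  qed simp
  then show "\<bar>int i - int j\<bar> > 1 \<Longrightarrow> \<not> E i j" using ij by force
  have step: "E k (Suc k)" if k: "Suc k \<le> d" for k
  proof (rule ccontr)
    assume neg: "\<not> E k (Suc k)"
    \<comment> \<open>Every edge joins neighbouring numbers, so crossing the cut between k and k + 1
      would use the missing edge; the walk \<open>\<sigma>\<close> stays on the side where it
      starts.\<close>
    have "\<sigma> a \<le> k \<longleftrightarrow> \<sigma> 0 \<le> k" if "a \<le> d" for a
      using that
    proof (induction a)
      case (Suc a)
      then have e: "E (\<sigma> a) (\<sigma> (Suc a))" by (intro edge) auto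
      have "\<sigma> a \<noteq> \<sigma> (Suc a)"
        using \<sigma> Suc.prems inj_onD[of \<sigma> "{..d}" a "Suc a"] by (auto simp: bij_betw_def)
      then have "\<sigma> a \<le> k \<longleftrightarrow> \<sigma> (Suc a) \<le> k"
        using near[OF e] e neg sym[OF e] \<sigma>d[of a] \<sigma>d[of "Suc a"] Suc.prems
        by (cases "\<sigma> a = k \<and> \<sigma> (Suc a) = Suc k"; cases "\<sigma> a = Suc k \<and> \<sigma> (Suc a) = k") auto
      then show ?case using Suc by simp
    qed simp
    moreover obtain a b where "a \<le> d" "\<sigma> a = k" "b \<le> d" "\<sigma> b = Suc k"
      using pre k by (metis Suc_leD)
    ultimately show False by (metis Suc_n_not_le_n order_refl)
  qed
  assume "\<bar>int i - int j\<bar> = 1"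
  then have "j = Suc i \<or> i = Suc j" by auto
  then show "E i j" using step[of i] step[of j] sym[of j i] ij by auto
qed

lemma rank_inj:
  assumes "\<And>i j. i \<le> d \<Longrightarrow> j \<le> d \<Longrightarrow> \<bar>int (r i) - int (r j)\<bar> = \<bar>int i - int j\<bar>"
  shows "inj_on r {..<d + 1}"
proof (rule inj_onI)
  fix i j assume "i \<in> {..<d + 1}" "j \<in> {..<d + 1}" "r i = r j"
  then show "i = j" using assms[of i j] by simp
qed

text \<open>Each eigenvalue occurs on the diagonal. Since there are d + 1 eigenvalues and only d + 1
  diagonal positions, every diagonal entry is an eigenvalue and no two coincide.\<close>

lemma tri_eigenvalues:
  assumes mf: "multiplicity_free (mat_algebra d) d B" and B: "tri (d + 1) r B" and r: "inj_on r {..<d + 1}"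
  shows "eigenvalues (mat_algebra d) d B = (\<lambda>i. B $$ (i, i)) ` {..d}"
    and "inj_on (\<lambda>i. B $$ (i, i)) {..<d + 1}"
proof -
  let ?\<theta> = "\<lambda>i. B $$ (i, i)" and ?ev = "eigenvalues (mat_algebra d) d B"
  have Bc: "B \<in> carrier_mat (d + 1) (d + 1)" using B by (simp add: tri_def)
  have "?ev \<subseteq> ?\<theta> ` {..<d + 1}"
    using tri_eigenvalue[OF B r] unfolding eigenvalues_mat[OF Bc] by blast
  moreover have card: "card ?ev = d + 1" using mf by (simp add: multiplicity_free_def)
  moreover have "card (?\<theta> ` {..<d + 1}) \<le> d + 1" using card_image_le[of "{..<d + 1}" ?\<theta>] by simp
  ultimately have eq: "?ev = ?\<theta> ` {..<d + 1}" by (intro card_seteq) auto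
  then show "?ev = ?\<theta> ` {..d}" by (simp add: lessThan_Suc_atMost)
  show "inj_on ?\<theta> {..<d + 1}" using eq card by (intro eq_card_imp_inj_on) auto
qed

lemma tri_exists_diagonalizer:
  assumes mf: "multiplicity_free (mat_algebra d) d B" and B: "tri (d + 1) r B" and r: "inj_on r {..<d + 1}"
  obtains P P' where "inv_pair (d + 1) P P'" "B * P = P * dmat (d + 1) (\<lambda>i. B $$ (i, i))"
proof -
  have Bc: "B \<in> carrier_mat (d + 1) (d + 1)" using B by (simp add: tri_def)
  have "eigenvalue B (B $$ (i, i))" if "i < d + 1" for i
  proof -
    have "B $$ (i, i) \<in> eigenvalues (mat_algebra d) d B" using tri_eigenvalues(1)[OF mf B r] that by auto
    then show ?thesis by (simp only: eigenvalues_mat[OF Bc] mem_Collect_eq)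
  qed
  then obtain P P' where "inv_pair (d + 1) P P'" "B * P = P * dmat (d + 1) (\<lambda>i. B $$ (i, i))"
    by (rule exists_diagonalization[OF Bc tri_eigenvalues(2)[OF mf B r]])
  then show thesis by (rule that)
qed

text \<open>The order of the given \<open>F\<close> is a priori unrelated to the diagonal of
  \<open>B\<close>. In an eigenbasis ordered by the diagonal, \<open>Bs\<close> is an irreducible
  tridiagonal matrix up to relabelling, and it is also Hessenberg for \<open>r\<close>. By
  \<open>path_consecutive\<close> it is then irreducible tridiagonal in the diagonal order
  itself.\<close>

lemma idempotent_sequence_diagonal:
  fixes B Bs :: "'a::field mat"
  assumes mf: "multiplicity_free (mat_algebra d) d B" and B: "tri (d + 1) r B" and Bs: "hess (d + 1) r Bs"
    and r: "\<And>i j. i \<le> d \<Longrightarrow> j \<le> d \<Longrightarrow> \<bar>int (r i) - int (r j)\<bar> = \<bar>int i - int j\<bar>"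
    and F: "idempotent_sequence (mat_algebra d) d B Bs F"
  shows "idempotent_sequence (mat_algebra d) d B Bs
    (\<lambda>i\<in>{0..d}. primitive_idempotent (mat_algebra d) d B (B $$ (i, i)))"
proof -
  let ?A = "mat_algebra d :: ('a, 'a mat) module" and ?\<theta> = "\<lambda>i. B $$ (i, i)" and ?n = "d + 1"
  let ?p = "primitive_idempotent ?A d B"
  have rinj: "inj_on r {..<?n}" using r by (rule rank_inj)
  note ev = tri_eigenvalues[OF mf B rinj]
  have inj: "inj_on ?\<theta> {..d}" using ev(2) by (simp add: lessThan_Suc_atMost)
  have Bc: "B \<in> carrier_mat ?n ?n" and Bsc: "Bs \<in> carrier_mat ?n ?n"
    using B Bs by (simp_all add: tri_def hess_def)
  obtain P P' where P: "inv_pair ?n P P'" and BP: "B * P = P * dmat ?n ?\<theta>"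
    by (rule tri_exists_diagonalizer[OF mf B rinj])
  define S where "S = P' * Bs * P"
  \<comment> \<open>The eigenbasis of the triangular \<open>B\<close> respects the flag of
    \<open>r\<close>, so the change of basis does not destroy the Hessenberg shape of
    \<open>Bs\<close>.\<close>
  have "hess ?n r S"
    unfolding S_def using tri_diagonalizer[OF B rinj ev(2) P BP] Bs by (intro hess_conj)
  then have S_hess: "r j \<le> r i + 1" if "i \<le> d" "j \<le> d" "S $$ (i, j) \<noteq> 0" for i j
    using that by (auto simp: hess_def)
  have zero: "?p (?\<theta> i) \<otimes>\<^bsub>?A\<^esub> Bs \<otimes>\<^bsub>?A\<^esub> ?p (?\<theta> j) = \<zero>\<^bsub>?A\<^esub> \<longleftrightarrow> S $$ (i, j) = 0"
    if "i \<le> d" "j \<le> d" for i j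
    using primitive_idempotent_product_eq_0_iff[OF P Bc BP inj that Bsc]
    unfolding S_def module_mat_simps .
  \<comment> \<open>The diagonal position of the eigenvalue that belongs to the i-th idempotent of
    \<open>F\<close>.\<close>
  define \<sigma> where "\<sigma> i = the_inv_into {..d} ?\<theta> (eigenvalue_of_idempotent ?A d B (F i))" for i
  note F_ev = idempotent_sequence_eigenvalues[OF mf F]
  have "bij_betw ?\<theta> {..d} (eigenvalues ?A d B)" using inj ev(1) by (simp only: bij_betw_def)
  from bij_betw_trans[OF F_ev(4) bij_betw_the_inv_into[OF this]]
  have \<sigma>: "bij_betw \<sigma> {..d} {..d}" by (simp add: \<sigma>_def[abs_def] comp_def)
  have F\<sigma>: "F i = ?p (?\<theta> (\<sigma> i))" if "i \<le> d" for i
  proof -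
    have "eigenvalue_of_idempotent ?A d B (F i) \<in> ?\<theta> ` {..d}"
      using F_ev(4) that unfolding ev(1)[symmetric] by (auto simp: bij_betw_def)
    then have "?\<theta> (\<sigma> i) = eigenvalue_of_idempotent ?A d B (F i)"
      unfolding \<sigma>_def by (rule f_the_inv_into_f[OF inj])
    then show ?thesis using F_ev(3)[OF that] by simp
  qed
  have \<sigma>d: "\<sigma> i \<le> d" if "i \<le> d" for i using \<sigma> that by (auto simp: bij_betw_def)
  have path: "\<bar>int i - int j\<bar> > 1 \<Longrightarrow> S $$ (i, j) = 0" "\<bar>int i - int j\<bar> = 1 \<Longrightarrow> S $$ (i, j) \<noteq> 0"
    if "i \<le> d" "j \<le> d" for i j
  proof -
    have e: "S $$ (\<sigma> a, \<sigma> b) \<noteq> 0" if "a \<le> d" "b \<le> d" "\<bar>int a - int b\<bar> = 1" for a b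
      using F that zero[OF \<sigma>d[OF that(1)] \<sigma>d[OF that(2)]] F\<sigma>
      by (simp add: idempotent_sequence_def)
    have ne: "\<not> S $$ (\<sigma> a, \<sigma> b) \<noteq> 0" if "a \<le> d" "b \<le> d" "\<bar>int a - int b\<bar> > 1" for a b
      using F that zero[OF \<sigma>d[OF that(1)] \<sigma>d[OF that(2)]] F\<sigma>
      by (simp add: idempotent_sequence_def)
    note pc = path_consecutive[where E = "\<lambda>i j. S $$ (i, j) \<noteq> 0", OF \<sigma> e ne r S_hess that]
    show "\<bar>int i - int j\<bar> > 1 \<Longrightarrow> S $$ (i, j) = 0" "\<bar>int i - int j\<bar> = 1 \<Longrightarrow> S $$ (i, j) \<noteq> 0"
      using pc by blast+
  qed
  have "bij_betw (?p \<circ> ?\<theta>) {0..d} (?p ` eigenvalues ?A d B)"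
    using F_ev(1) inj ev(1) unfolding atMost_atLeast0
    by (intro bij_betw_trans[of ?\<theta> _ "eigenvalues ?A d B"]) (simp_all add: bij_betw_def)
  then have "bij_betw (\<lambda>i\<in>{0..d}. ?p (?\<theta> i)) {0..d} (?p ` eigenvalues ?A d B)"
    by (subst bij_betw_cong[where g = "?p \<circ> ?\<theta>"]) auto
  then show ?thesis using zero path by (simp add: idempotent_sequence_def)
qed

section \<open>The split sequence of a bidiagonal system\<close>

text \<open>The columns of P diagonalize B, so the sum of the eigenspaces of rank at least
  \<open>c\<close> is the image under P of the corresponding flag member. P and its inverse preserve
  the flag, so this image is the flag member itself.\<close>

lemma sum_of_images_eq_supp_ge:
  fixes B :: "'a::field mat"
  assumes mf: "multiplicity_free (mat_algebra d) d B" and B: "tri (d + 1) r B" and r: "inj_on r {..<d + 1}"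
  shows "sum_of_subspaces (col_module d)
      (\<lambda>j. image_of (col_module d) (primitive_idempotent (mat_algebra d) d B (B $$ (j, j)))) {j. j \<le> d \<and> c \<le> r j}
    = supp_ge (d + 1) r c"
    (is "sum_of_subspaces ?V ?S ?I = _")
proof -
  let ?n = "d + 1" and ?p = "\<lambda>j. primitive_idempotent (mat_algebra d) d B (B $$ (j, j))"
  interpret V: abelian_group "col_module d :: ('a mat, 'a vec) module"
    using left_module_col[of d, where 'a = 'a] unfolding left_module_def by blast
  note ev = tri_eigenvalues[OF mf B r]
  have inj: "inj_on (\<lambda>i. B $$ (i, i)) {..d}" using ev(2) by (simp add: lessThan_Suc_atMost)
  have Bc: "B \<in> carrier_mat ?n ?n" using B by (simp add: tri_def)
  obtain P P' where P: "inv_pair ?n P P'" and BP: "B * P = P * dmat ?n (\<lambda>i. B $$ (i, i))"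
    by (rule tri_exists_diagonalizer[OF mf B r])
  note c = inv_pair_carrier[OF P]
  note fP = tri_diagonalizer(3,4)[OF B r ev(2) P BP]
  \<comment> \<open>The coordinate projection onto J. For a single index it is the idempotent in the
    eigenbasis; for \<open>?I\<close> it fixes every vector of
    \<open>supp_ge ?n r c\<close>.\<close>
  let ?D = "\<lambda>J. dmat ?n (\<lambda>k. if k \<in> J then 1 else 0) :: 'a mat"
  have p: "?p j = P * ?D {j} * P'" if "j \<le> d" for j
    using primitive_idempotent_diagonalizable[OF P Bc BP inj that] by simp
  have pv: "?p j *\<^sub>v x = P *\<^sub>v (?D {j} *\<^sub>v (P' *\<^sub>v x))" if "j \<le> d" "x \<in> carrier_vec ?n" for j x
  proof -
    have "A * D * A' *\<^sub>v x = A *\<^sub>v (D *\<^sub>v (A' *\<^sub>v x))"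
      if "A \<in> carrier_mat n n" "D \<in> carrier_mat n n" "A' \<in> carrier_mat n n" "x \<in> carrier_vec n"
      for A D A' :: "'a mat" and n
      using that by (simp add: assoc_mult_mat_vec[of _ n n _ n] assoc_mult_mat[of _ n n _ n _ n])
    then show ?thesis unfolding p[OF \<open>j \<le> d\<close>] using c that(2) by (meson dmat_closed)
  qed
  have add: "u + v \<in> supp_ge ?n r c" if "u \<in> supp_ge ?n r c" "v \<in> supp_ge ?n r c" for u v :: "'a vec"
    using that by (fastforce simp: supp_ge_def)
  have sub: "?S j \<subseteq> supp_ge ?n r c" if j: "j \<in> ?I" for j
  proof -
    have D: "?D {j} *\<^sub>v y \<in> supp_ge ?n r c" if "y \<in> carrier_vec ?n" for y
      using j that mult_mat_vec_carrier[OF dmat_closed that] by (auto simp: supp_ge_def index_dmat_mult_vec[of _ ?n, simplified] simp del: index_mult_mat_vec split: if_splits)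
    then have "P *\<^sub>v (?D {j} *\<^sub>v (P' *\<^sub>v x)) \<in> supp_ge ?n r c" if "x \<in> carrier_vec ?n" for x
      using fP(1) D[OF mult_mat_vec_carrier[OF c(2) that]] by (simp add: filt_def)
    then show ?thesis using j by (auto simp: image_of_def col_module_simps pv[simplified])
  qed
  have fs: "finsum ?V x J \<in> supp_ge ?n r c"
    if "finite J" "J \<subseteq> ?I" "\<And>j. j \<in> J \<Longrightarrow> x j \<in> ?S j" for x J
    using that
  proof (induction J)
    case empty
    then show ?case by (simp add: col_module_simps supp_ge_def)
  next
    case (insert j J)
    have x: "x i \<in> supp_ge ?n r c" if "i \<in> insert j J" for i
      using insert.prems sub that by blast
    then have "x j \<in> carrier ?V" "x \<in> J \<rightarrow> carrier ?V"
      by (auto simp: col_module_simps supp_ge_def)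
    then show ?case using insert x[of j] add
      by (simp add: V.finsum_insert) (simp add: col_module_simps)
  qed
  have "finsum ?V x ?I \<in> supp_ge ?n r c" if "\<forall>j\<in>?I. x j \<in> ?S j" for x
    using that by (intro fs) auto
  then have 1: "sum_of_subspaces ?V ?S ?I \<subseteq> supp_ge ?n r c"
    unfolding sum_of_subspaces_def by blast
  have 2: "x \<in> sum_of_subspaces ?V ?S ?I" if x: "x \<in> supp_ge ?n r c" for x
  proof -
    have xc: "x \<in> carrier_vec ?n" using x by (simp add: supp_ge_def)
    define y where "y = P' *\<^sub>v x"
    have y: "y \<in> supp_ge ?n r c" using fP x by (simp add: filt_def y_def)
    have yc: "y \<in> carrier_vec ?n" using y by (simp add: supp_ge_def)
    have xj: "?p j *\<^sub>v x \<in> carrier_vec ?n" if "j \<le> d" for j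
      unfolding pv[OF that xc] using c xc by (intro mult_mat_vec_carrier) auto
    have "finsum ?V (\<lambda>j. ?p j *\<^sub>v x) J = P *\<^sub>v (?D J *\<^sub>v y)" if "finite J" "J \<subseteq> ?I" for J
      using that
    proof (induction J)
      case empty
      have "?D {} *\<^sub>v y = 0\<^sub>v ?n"
        using yc by (intro eq_vecI) (simp_all del: index_mult_mat_vec add: index_dmat_mult_vec[of _ ?n, simplified])
      then show ?case using c by (auto simp: col_module_simps)
    next
      case (insert j J)
      have "finsum ?V (\<lambda>j. ?p j *\<^sub>v x) (insert j J) = ?p j *\<^sub>v x + finsum ?V (\<lambda>j. ?p j *\<^sub>v x) J"
        using insert xj
        by (subst V.finsum_insert) (auto simp: col_module_simps subset_iff)
      also have "\<dots> = P *\<^sub>v (?D {j} *\<^sub>v y) + P *\<^sub>v (?D J *\<^sub>v y)"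
        using insert pv[OF _ xc] by (simp add: y_def)
      also have "\<dots> = P *\<^sub>v (?D {j} *\<^sub>v y + ?D J *\<^sub>v y)"
        using c yc by (intro mult_add_distrib_mat_vec[symmetric]) (auto intro!: mult_mat_vec_carrier)
      also have "?D {j} *\<^sub>v y + ?D J *\<^sub>v y = ?D (insert j J) *\<^sub>v y"
        using yc insert.hyps
        by (intro eq_vecI) (auto simp del: index_mult_mat_vec simp: index_dmat_mult_vec[of _ ?n, simplified])
      finally show ?case .
    qed
    then have "finsum ?V (\<lambda>j. ?p j *\<^sub>v x) ?I = P *\<^sub>v (?D ?I *\<^sub>v y)" by simp
    also have "?D ?I *\<^sub>v y = y"
      using y yc by (intro eq_vecI)
        (auto simp del: index_mult_mat_vec simp: index_dmat_mult_vec[of _ ?n, simplified] supp_ge_def)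
    also have "P *\<^sub>v y = x" unfolding y_def by (rule inv_pair_cancel(4)[OF P xc])
    finally have "x = finsum ?V (\<lambda>j. ?p j *\<^sub>v x) ?I" by simp
    moreover have "\<forall>j\<in>?I. ?p j *\<^sub>v x \<in> ?S j"
      using xc by (auto simp: image_of_def col_module_simps)
    ultimately show ?thesis unfolding sum_of_subspaces_def by blast
  qed
  from 1 2 show ?thesis by blast
qed

text \<open>The link between systems and canonical forms: the pair is in canonical form and the
  system is its designated one.\<close>

definition LB_UB_system :: "nat \<Rightarrow> 'a::field mat leonard_sys \<Rightarrow> bool" where
  "LB_UB_system d \<Psi> \<longleftrightarrow> leonard_system (mat_algebra d) d \<Psi> \<and>
     lower_bidiagonal (elt \<Psi>) \<and> upper_bidiagonal (dual_elt \<Psi>) \<and> (\<forall>i\<in>{1..d}. elt \<Psi> $$ (i, i - 1) = 1) \<and>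
     (\<forall>i\<le>d. eigenvalue_sequence (mat_algebra d) d \<Psi> i = elt \<Psi> $$ (i, i)) \<and>
     (\<forall>i\<le>d. dual_eigenvalue_sequence (mat_algebra d) d \<Psi> i = dual_elt \<Psi> $$ (i, i))"

lemma leonard_system_mat:
  assumes "leonard_system (mat_algebra d) d \<Psi>"
  shows "elt \<Psi> \<in> carrier_mat (d + 1) (d + 1)" "dual_elt \<Psi> \<in> carrier_mat (d + 1) (d + 1)"
  using leonard_system_sys_in[OF assms] by (simp_all add: sys_in_def module_mat_simps)

lemma idem_eq_primitive_idempotent:
  assumes "leonard_system \<A> d \<Psi>" "i \<le> d"
  shows "idem \<Psi> i = primitive_idempotent \<A> d (elt \<Psi>) (eigenvalue_sequence \<A> d \<Psi> i)"
    and "dual_idem \<Psi> i = primitive_idempotent \<A> d (dual_elt \<Psi>) (dual_eigenvalue_sequence \<A> d \<Psi> i)"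
  using assms primitive_idempotent_eigenvalue_of
  by (fastforce simp: leonard_system_def eigenvalue_sequence_def dual_eigenvalue_sequence_def)+

lemma bidiagonal_tri_hess:
  assumes M: "M \<in> carrier_mat (d + 1) (d + 1)"
  shows "lower_bidiagonal M \<Longrightarrow> tri (d + 1) id M"
    and "lower_bidiagonal M \<Longrightarrow> hess (d + 1) (\<lambda>i. d - i) M"
    and "upper_bidiagonal M \<Longrightarrow> tri (d + 1) (\<lambda>i. d - i) M"
    and "upper_bidiagonal M \<Longrightarrow> hess (d + 1) id M"
  using M by (fastforce simp: tri_def hess_def lower_bidiagonal_def upper_bidiagonal_def)+

lemma rank_id: "i \<le> d \<Longrightarrow> j \<le> d \<Longrightarrow> \<bar>int (id i) - int (id j)\<bar> = \<bar>int i - int j\<bar>"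
  and rank_rev: "i \<le> d \<Longrightarrow> j \<le> d \<Longrightarrow> \<bar>int (d - i) - int (d - j)\<bar> = \<bar>int i - int j\<bar>"
  by auto

text \<open>The two sums are members of opposite flags: one is spanned by the unit vectors up to i,
  the other by those from i on. They meet in the line of the i-th unit vector.\<close>

lemma split_space_LB_UB:
  fixes \<Psi> :: "'a::field mat leonard_sys"
  assumes \<Psi>: "LB_UB_system d \<Psi>" and i: "i \<le> d"
  shows "split_space (col_module d) d \<Psi> i = {v \<in> carrier_vec (d + 1). \<forall>k\<le>d. k \<noteq> i \<longrightarrow> v $ k = 0}"
proof -
  have L: "leonard_system (mat_algebra d) d \<Psi>" using \<Psi> by (simp only: LB_UB_system_def)
  note c = leonard_system_mat[OF L]
  have mf: "multiplicity_free (mat_algebra d) d (elt \<Psi>)" "multiplicity_free (mat_algebra d) d (dual_elt \<Psi>)"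
    using L by (simp_all only: leonard_system_def)
  have t: "tri (d + 1) id (elt \<Psi>)" "tri (d + 1) (\<lambda>i. d - i) (dual_elt \<Psi>)"
    using bidiagonal_tri_hess c \<Psi> by (auto simp only: LB_UB_system_def)
  have E: "idem \<Psi> j = primitive_idempotent (mat_algebra d) d (elt \<Psi>) (elt \<Psi> $$ (j, j))"
    "dual_idem \<Psi> j = primitive_idempotent (mat_algebra d) d (dual_elt \<Psi>) (dual_elt \<Psi> $$ (j, j))" if "j \<le> d" for j
    using idem_eq_primitive_idempotent[OF L that] \<Psi> that by (simp_all only: LB_UB_system_def)
  have sets: "{0..i} = {j. j \<le> d \<and> d - i \<le> d - j}" "{i..d} = {j. j \<le> d \<and> i \<le> id j}" using i by auto
  have cong: "sum_of_subspaces V S J = sum_of_subspaces V T J" if "\<And>j. j \<in> J \<Longrightarrow> S j = T j"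
    for S T J and V :: "('a mat, 'a vec) module"
    using that by (simp add: sum_of_subspaces_def)
  have "sum_of_subspaces (col_module d) (\<lambda>j. image_of (col_module d) (dual_idem \<Psi> j)) {0..i}
      = supp_ge (d + 1) (\<lambda>i. d - i) (d - i)"
    unfolding sets
    by (rule trans[OF cong sum_of_images_eq_supp_ge[OF mf(2) t(2) rank_inj[OF rank_rev]]])
      (simp only: E mem_Collect_eq)+
  moreover have "sum_of_subspaces (col_module d) (\<lambda>j. image_of (col_module d) (idem \<Psi> j)) {i..d}
      = supp_ge (d + 1) id i"
    unfolding sets
    by (rule trans[OF cong sum_of_images_eq_supp_ge[OF mf(1) t(1) rank_inj[OF rank_id]]])
      (simp only: E mem_Collect_eq)+
  moreover have "supp_ge (d + 1) (\<lambda>i. d - i) (d - i) \<inter> supp_ge (d + 1) id i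
      = {v \<in> carrier_vec (d + 1). \<forall>k\<le>d. k \<noteq> i \<longrightarrow> (v :: 'a vec) $ k = 0}"
  proof -
    have "d - i \<le> d - k \<and> i \<le> k \<longleftrightarrow> k = i" if "k \<le> d" for k using i that by auto
    then show ?thesis by (auto simp: supp_ge_def less_Suc_eq_le)
  qed
  ultimately show ?thesis unfolding split_space_def by (simp only:)
qed

lemma mult_single_entry:
  fixes M :: "'a::field mat"
  assumes "M \<in> carrier_mat n n" "u \<in> carrier_vec n" "\<And>l. l < n \<Longrightarrow> l \<noteq> i \<Longrightarrow> u $ l = 0" "i < n" "k < n"
  shows "(M *\<^sub>v u) $ k = M $$ (k, i) * u $ i"
proof -
  have "(M *\<^sub>v u) $ k = (\<Sum>l<n. M $$ (k, l) * u $ l)" using assms by (intro index_mult_mat_vec_sum)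
  also have "\<dots> = (\<Sum>l<n. if l = i then M $$ (k, i) * u $ i else 0)"
    using assms by (intro sum.cong) auto
  finally show ?thesis using assms by simp
qed

text \<open>On the i-th unit vector, subtracting the dual eigenvalue removes the diagonal term of
  \<open>A\<^sup>*\<close>, leaving the superdiagonal entry times the previous unit vector. The
  shifted \<open>A\<close> then leads from that vector back to the i-th one with coefficient 1, the
  normalized subdiagonal entry.\<close>

lemma first_split_sequence_LB_UB:
  fixes \<Psi> :: "'a::field mat leonard_sys"
  assumes \<Psi>: "LB_UB_system d \<Psi>" and i: "1 \<le> i" "i \<le> d"
  shows "first_split_sequence (mat_algebra d) (col_module d) d \<Psi> i = dual_elt \<Psi> $$ (i - 1, i)"
proof -
  let ?n = "d + 1" and ?A = "mat_algebra d :: ('a, 'a mat) module" and ?V = "col_module d :: ('a mat, 'a vec) module"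
  define B Bs where "B = elt \<Psi>" and "Bs = dual_elt \<Psi>"
  have L: "leonard_system ?A d \<Psi>" using \<Psi> by (simp only: LB_UB_system_def)
  have c: "B \<in> carrier_mat ?n ?n" "Bs \<in> carrier_mat ?n ?n"
    using leonard_system_mat[OF L] by (simp_all add: B_def Bs_def)
  have LB: "B $$ (k, l) = 0" if "k < ?n" "l < ?n" "k \<noteq> l" "k \<noteq> l + 1" for k l
  proof -
    have "lower_bidiagonal B" using \<Psi> by (simp only: LB_UB_system_def B_def)
    then show ?thesis using c that by (auto simp: lower_bidiagonal_def)
  qed
  have UB: "Bs $$ (k, l) = 0" if "k < ?n" "l < ?n" "k \<noteq> l" "l \<noteq> k + 1" for k l
  proof -
    have "upper_bidiagonal Bs" using \<Psi> by (simp only: LB_UB_system_def Bs_def)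
    then show ?thesis using c that by (auto simp: upper_bidiagonal_def lower_bidiagonal_def)
  qed
  have sub1: "B $$ (i, i - 1) = 1" using \<Psi> i by (auto simp: LB_UB_system_def B_def)
  have ev: "eigenvalue_sequence ?A d \<Psi> (i - 1) = B $$ (i - 1, i - 1)"
    "dual_eigenvalue_sequence ?A d \<Psi> i = Bs $$ (i, i)"
    using \<Psi> i by (simp_all only: LB_UB_system_def B_def Bs_def)
  define M N where "M = B - B $$ (i - 1, i - 1) \<cdot>\<^sub>m 1\<^sub>m ?n" and "N = Bs - Bs $$ (i, i) \<cdot>\<^sub>m 1\<^sub>m ?n"
  have MN: "M \<in> carrier_mat ?n ?n" "N \<in> carrier_mat ?n ?n" unfolding M_def N_def by (intro minus_carrier_mat smult_carrier_mat one_carrier_mat)+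
  have elt_eq: "elt \<Psi> \<ominus>\<^bsub>?A\<^esub> eigenvalue_sequence ?A d \<Psi> (i - 1) \<odot>\<^bsub>?A\<^esub> \<one>\<^bsub>?A\<^esub> = M"
    "dual_elt \<Psi> \<ominus>\<^bsub>?A\<^esub> dual_eigenvalue_sequence ?A d \<Psi> i \<odot>\<^bsub>?A\<^esub> \<one>\<^bsub>?A\<^esub> = N"
    unfolding ev B_def[symmetric] Bs_def[symmetric] M_def N_def module_mat_simps
    using c by (intro a_minus_mat; simp)+
  define \<phi> where "\<phi> = Bs $$ (i - 1, i)"
  have act: "(M * N) *\<^sub>v u = \<phi> \<cdot>\<^sub>v u" if u: "u \<in> split_space ?V d \<Psi> i" for u
  proof -
    have uc: "u \<in> carrier_vec ?n" and u0: "\<And>k. k < ?n \<Longrightarrow> k \<noteq> i \<Longrightarrow> u $ k = 0"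
      using u i unfolding split_space_LB_UB[OF \<Psi> i(2)] by auto
    have Nu: "(N *\<^sub>v u) $ k = (if k = i - 1 then \<phi> * u $ i else 0)" if "k < ?n" for k
    proof -
      have "(N *\<^sub>v u) $ k = N $$ (k, i) * u $ i" using MN uc u0 i that by (intro mult_single_entry) auto
      moreover have "N $$ (k, i) = (if k = i - 1 then \<phi> else 0)"
        using c i that UB[of k i] by (auto simp: N_def \<phi>_def)
      ultimately show ?thesis by simp
    qed
    have Nuc: "N *\<^sub>v u \<in> carrier_vec ?n" using MN uc by simp
    have "(M *\<^sub>v (N *\<^sub>v u)) $ k = (\<phi> \<cdot>\<^sub>v u) $ k" if k: "k < ?n" for k
    proof -
      have "(M *\<^sub>v (N *\<^sub>v u)) $ k = M $$ (k, i - 1) * (N *\<^sub>v u) $ (i - 1)"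
        using MN Nuc Nu i k by (intro mult_single_entry) auto
      moreover have "M $$ (k, i - 1) = (if k = i then 1 else 0)"
        using c i k LB[of k "i - 1"] sub1 by (auto simp: M_def)
      ultimately show ?thesis using Nu[of "i - 1"] i k u0[OF k] uc by auto
    qed
    then have "M *\<^sub>v (N *\<^sub>v u) = \<phi> \<cdot>\<^sub>v u" using MN uc by (intro eq_vecI) auto
    then show ?thesis using MN uc by (subst assoc_mult_mat_vec) auto
  qed
  have scal: "(c \<odot>\<^bsub>?A\<^esub> \<one>\<^bsub>?A\<^esub>) \<odot>\<^bsub>?V\<^esub> u = c \<cdot>\<^sub>v u" if "u \<in> carrier_vec ?n" for c and u :: "'a vec"
  proof -
    have "c \<cdot>\<^sub>m 1\<^sub>m ?n = dmat ?n (\<lambda>_. c)" by (intro eq_matI) auto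
    then have "(c \<cdot>\<^sub>m 1\<^sub>m ?n) *\<^sub>v u = c \<cdot>\<^sub>v u"
      using that index_dmat_mult_vec[OF that] by (intro eq_vecI) (simp_all del: index_mult_mat_vec)
    then show ?thesis by (simp only: module_mat_simps col_module_simps)
  qed
  have "(THE c. \<exists>u\<in>split_space ?V d \<Psi> i. u \<noteq> \<zero>\<^bsub>?V\<^esub> \<and> (M \<otimes>\<^bsub>?A\<^esub> N) \<odot>\<^bsub>?V\<^esub> u = (c \<odot>\<^bsub>?A\<^esub> \<one>\<^bsub>?A\<^esub>) \<odot>\<^bsub>?V\<^esub> u) = \<phi>"
  proof (rule the_equality)
    have "unit_vec ?n i \<in> split_space ?V d \<Psi> i" "unit_vec ?n i \<noteq> \<zero>\<^bsub>?V\<^esub>"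
      using i unfolding split_space_LB_UB[OF \<Psi> i(2)] by (auto simp: col_module_simps)
    moreover have "(M \<otimes>\<^bsub>?A\<^esub> N) \<odot>\<^bsub>?V\<^esub> unit_vec ?n i = (\<phi> \<odot>\<^bsub>?A\<^esub> \<one>\<^bsub>?A\<^esub>) \<odot>\<^bsub>?V\<^esub> unit_vec ?n i"
      using act[OF calculation(1)] scal[of "unit_vec ?n i" \<phi>] by (simp add: module_mat_simps col_module_simps)
    ultimately show "\<exists>u\<in>split_space ?V d \<Psi> i. u \<noteq> \<zero>\<^bsub>?V\<^esub> \<and>
        (M \<otimes>\<^bsub>?A\<^esub> N) \<odot>\<^bsub>?V\<^esub> u = (\<phi> \<odot>\<^bsub>?A\<^esub> \<one>\<^bsub>?A\<^esub>) \<odot>\<^bsub>?V\<^esub> u" by blast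
  next
    fix a assume "\<exists>u\<in>split_space ?V d \<Psi> i. u \<noteq> \<zero>\<^bsub>?V\<^esub> \<and>
        (M \<otimes>\<^bsub>?A\<^esub> N) \<odot>\<^bsub>?V\<^esub> u = (a \<odot>\<^bsub>?A\<^esub> \<one>\<^bsub>?A\<^esub>) \<odot>\<^bsub>?V\<^esub> u"
    then obtain u where u: "u \<in> split_space ?V d \<Psi> i" "u \<noteq> \<zero>\<^bsub>?V\<^esub>"
      "(M \<otimes>\<^bsub>?A\<^esub> N) \<odot>\<^bsub>?V\<^esub> u = (a \<odot>\<^bsub>?A\<^esub> \<one>\<^bsub>?A\<^esub>) \<odot>\<^bsub>?V\<^esub> u" by blast
    have uc: "u \<in> carrier_vec ?n" using u(1) unfolding split_space_LB_UB[OF \<Psi> i(2)] by simp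
    have "(M * N) *\<^sub>v u = a \<cdot>\<^sub>v u" using u(3) unfolding scal[OF uc] by (simp only: module_mat_simps col_module_simps)
    then have "\<phi> \<cdot>\<^sub>v u = a \<cdot>\<^sub>v u" using act[OF u(1)] by simp
    then have eq: "(\<phi> \<cdot>\<^sub>v u) $ k = (a \<cdot>\<^sub>v u) $ k" for k by simp
    obtain k where "k < ?n" "u $ k \<noteq> 0"
      using u(2) uc vec_nonzero_index[of u ?n] by (auto simp: col_module_simps)
    then show "a = \<phi>" using eq[of k] uc by simp
  qed
  then show ?thesis
    using i by (simp add: first_split_sequence_def elt_eq[simplified] \<phi>_def Bs_def)
qed

section \<open>The split basis\<close>

text \<open>Each idempotent is recovered from its element and eigenvalue, and extensionality fixes
  the sequences outside \<open>{0..d}\<close>. This is behind both the uniqueness of the designated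
  system and the injectivity of the main map.\<close>

lemma leonard_system_eqI:
  assumes "leonard_system \<A> d \<Phi>" "leonard_system \<A> d \<Phi>'" "elt \<Phi> = elt \<Phi>'" "dual_elt \<Phi> = dual_elt \<Phi>'"
    and "\<And>i. i \<le> d \<Longrightarrow> eigenvalue_sequence \<A> d \<Phi> i = eigenvalue_sequence \<A> d \<Phi>' i"
    and "\<And>i. i \<le> d \<Longrightarrow> dual_eigenvalue_sequence \<A> d \<Phi> i = dual_eigenvalue_sequence \<A> d \<Phi>' i"
  shows "\<Phi> = \<Phi>'"
proof -
  have "idem \<Phi> i = idem \<Phi>' i" "dual_idem \<Phi> i = dual_idem \<Phi>' i" if "i \<le> d" for i
    using idem_eq_primitive_idempotent[OF assms(1) that] idem_eq_primitive_idempotent[OF assms(2) that]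
      assms(3-6) that by simp_all
  then have "idem \<Phi> = idem \<Phi>'" "dual_idem \<Phi> = dual_idem \<Phi>'"
    using assms(1,2) by (auto simp: leonard_system_def idempotent_sequence_def intro!: extensionalityI[of _ "{0..d}"])
  then show ?thesis using assms(3,4) by (intro leonard_sys.equality) simp_all
qed

lemma idempotent_sequence_tridiag:
  fixes M X :: "'a::field mat"
  assumes mf: "multiplicity_free (mat_algebra d) d M" and X: "X \<in> carrier_mat (d + 1) (d + 1)"
    and E: "idempotent_sequence (mat_algebra d) d M X E"
    and \<theta>: "\<And>i. i \<le> d \<Longrightarrow> \<theta> i = eigenvalue_of_idempotent (mat_algebra d) d M (E i)"
  obtains P P' where "inv_pair (d + 1) P P'" "M * P = P * dmat (d + 1) \<theta>" "tridiag d (P' * X * P)"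
    "inj_on \<theta> {..d}"
proof -
  let ?A = "mat_algebra d :: ('a, 'a mat) module"
  have M: "M \<in> carrier_mat (d + 1) (d + 1)" using mf by (simp add: multiplicity_free_def module_mat_simps)
  note ev = idempotent_sequence_eigenvalues[OF mf E]
  have bij: "bij_betw \<theta> {..d} (eigenvalues ?A d M)"
    using ev(4) by (rule bij_betw_cong[THEN iffD1, rotated]) (use \<theta> in auto)
  then have inj: "inj_on \<theta> {..d}" by (simp add: bij_betw_def)
  have "eigenvalue M (\<theta> i)" if "i < d + 1" for i
  proof -
    have "\<theta> i \<in> eigenvalues ?A d M" using bij that by (auto simp: bij_betw_def)
    then show ?thesis unfolding eigenvalues_mat[OF M] by simp
  qed
  then obtain P P' where P: "inv_pair (d + 1) P P'" "M * P = P * dmat (d + 1) \<theta>"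
    using exists_diagonalization[OF M, of \<theta>] inj by (auto simp: lessThan_Suc_atMost)
  have "E i = primitive_idempotent ?A d M (\<theta> i)" if "i \<le> d" for i
    using ev(3)[OF that] \<theta>[OF that] by simp
  then have "E i * X * E j = 0\<^sub>m (d + 1) (d + 1) \<longleftrightarrow> (P' * X * P) $$ (i, j) = 0" if "i \<le> d" "j \<le> d" for i j
    using primitive_idempotent_product_eq_0_iff[OF P(1) M P(2) inj that X] that by simp
  then have "tridiag d (P' * X * P)"
    using E by (simp add: idempotent_sequence_def tridiag_def module_mat_simps)
  then show thesis using P inj by (intro that)
qed

text \<open>With \<open>A\<^sup>*\<close> diagonal and \<open>A = T\<close> irreducible tridiagonal, these are the vectors
  \<open>(A - \<theta>\<^sub>i\<^sub>-\<^sub>1) \<cdots> (A - \<theta>\<^sub>0) e\<^sub>0\<close>, which span the spaces of the split decomposition.\<close>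

fun split_vec :: "nat \<Rightarrow> 'a::field mat \<Rightarrow> (nat \<Rightarrow> 'a) \<Rightarrow> nat \<Rightarrow> 'a vec" where
  "split_vec n T \<theta> 0 = unit_vec n 0"
| "split_vec n T \<theta> (Suc i) = T *\<^sub>v split_vec n T \<theta> i - \<theta> i \<cdot>\<^sub>v split_vec n T \<theta> i"

lemma split_vec_closed: "T \<in> carrier_mat n n \<Longrightarrow> split_vec n T \<theta> i \<in> carrier_vec n"
  by (induction i) auto

lemma split_vec_Suc_index:
  "T \<in> carrier_mat n n \<Longrightarrow> k < n \<Longrightarrow>
    split_vec n T \<theta> (Suc i) $ k = (T *\<^sub>v split_vec n T \<theta> i) $ k - \<theta> i * split_vec n T \<theta> i $ k"
  using split_vec_closed[of T n \<theta> i] by (simp del: index_mult_mat_vec)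

text \<open>Subdiagonal entries of \<open>T\<close> are nonzero and nothing stands below them, so
  each application of \<open>T\<close> moves the last nonzero position by exactly one; subtracting a
  multiple of the old vector does not affect the new position.\<close>

lemma split_vec_leading:
  fixes T :: "'a::field mat"
  assumes T: "T \<in> carrier_mat (d + 1) (d + 1)" and tri: "tridiag d T"
  shows "i \<le> d \<Longrightarrow> split_vec (d + 1) T \<theta> i $ i \<noteq> 0 \<and> (\<forall>k\<le>d. i < k \<longrightarrow> split_vec (d + 1) T \<theta> i $ k = 0)"
proof (induction i)
  case (Suc i)
  let ?u = "split_vec (d + 1) T \<theta>"
  have IH: "?u i $ i \<noteq> 0" "\<And>k. k \<le> d \<Longrightarrow> i < k \<Longrightarrow> ?u i $ k = 0" using Suc by auto
  have Tu: "(T *\<^sub>v ?u i) $ k = (if k = Suc i then T $$ (k, i) * ?u i $ i else 0)" if k: "k \<le> d" "i < k" for k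
  proof -
    have "(T *\<^sub>v ?u i) $ k = (\<Sum>l<d + 1. T $$ (k, l) * ?u i $ l)"
      using T split_vec_closed[OF T] k by (intro index_mult_mat_vec_sum) auto
    also have "\<dots> = (\<Sum>l<d + 1. if l = i then (if k = Suc i then T $$ (k, i) * ?u i $ i else 0) else 0)"
    proof (intro sum.cong refl)
      fix l assume l: "l \<in> {..<d + 1}"
      have "T $$ (k, l) = 0" if "l < i \<or> l = i \<and> k \<noteq> Suc i"
        using tri k l that by (auto simp: tridiag_def)
      then show "T $$ (k, l) * ?u i $ l = (if l = i then (if k = Suc i then T $$ (k, i) * ?u i $ i else 0) else 0)"
        using IH(2)[of l] l by (cases "l < i"; cases "l = i") auto
    qed
    finally show ?thesis using Suc.prems by simp
  qed
  have "T $$ (Suc i, i) \<noteq> 0" using tri Suc.prems by (auto simp: tridiag_def)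
  then have "?u (Suc i) $ Suc i \<noteq> 0"
    using Tu[of "Suc i"] IH Suc.prems split_vec_Suc_index[OF T, of "Suc i" \<theta> i] by simp
  moreover have "?u (Suc i) $ k = 0" if "k \<le> d" "Suc i < k" for k
    using Tu[of k] IH(2)[of k] that split_vec_Suc_index[OF T, of k \<theta> i] by simp
  ultimately show ?case by blast
qed simp

text \<open>The vector is the product of all T - \<open>\<theta> k\<close> applied to the first unit
  vector. In the coordinates given by the left eigenvectors, the rows of W, entry j picks up the
  factors \<open>\<theta> j - \<theta> k\<close>, one of which is zero.\<close>

lemma split_vec_end:
  fixes T :: "'a::field mat"
  assumes T: "T \<in> carrier_mat n n" and W: "inv_pair n W' W" and WT: "W * T = dmat n \<theta> * W"
  shows "split_vec n T \<theta> n = 0\<^sub>v n"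
proof -
  let ?u = "split_vec n T \<theta>"
  note c = inv_pair_carrier[OF W]
  note u = split_vec_closed[OF T, of \<theta>]
  have "(W *\<^sub>v ?u i) $ j = (W *\<^sub>v ?u 0) $ j * (\<Prod>k<i. \<theta> j - \<theta> k)" if j: "j < n" for i j
  proof (induction i)
    case (Suc i)
    have "W *\<^sub>v ?u (Suc i) = W *\<^sub>v (T *\<^sub>v ?u i) - W *\<^sub>v (\<theta> i \<cdot>\<^sub>v ?u i)"
      using c T u[of i] by (simp add: mult_minus_distrib_mat_vec[of _ n n])
    also have "W *\<^sub>v (\<theta> i \<cdot>\<^sub>v ?u i) = \<theta> i \<cdot>\<^sub>v (W *\<^sub>v ?u i)"
      using c u[of i] by (intro mult_mat_vec) auto
    also have "W *\<^sub>v (T *\<^sub>v ?u i) = dmat n \<theta> *\<^sub>v (W *\<^sub>v ?u i)"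
    proof -
      have "W *\<^sub>v (T *\<^sub>v ?u i) = (W * T) *\<^sub>v ?u i"
        using c T u[of i] by (intro assoc_mult_mat_vec[symmetric])
      also have "\<dots> = dmat n \<theta> *\<^sub>v (W *\<^sub>v ?u i)"
        unfolding WT using c u[of i] by (intro assoc_mult_mat_vec) auto
      finally show ?thesis .
    qed
    finally have eq: "W *\<^sub>v ?u (Suc i) = dmat n \<theta> *\<^sub>v (W *\<^sub>v ?u i) - \<theta> i \<cdot>\<^sub>v (W *\<^sub>v ?u i)" .
    have y: "W *\<^sub>v ?u i \<in> carrier_vec n" using c u[of i] by simp
    have "(W *\<^sub>v ?u (Suc i)) $ j = \<theta> j * (W *\<^sub>v ?u i) $ j - \<theta> i * (W *\<^sub>v ?u i) $ j"
      unfolding eq using c j index_dmat_mult_vec[OF y j, of \<theta>] by (simp del: index_mult_mat_vec)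
    then show ?case using Suc.IH by (simp add: algebra_simps del: split_vec.simps)
  qed simp
  moreover have "(\<Prod>k<n. \<theta> j - \<theta> k) = 0" if "j < n" for j using that by (intro prod_zero) auto
  ultimately have "W *\<^sub>v ?u n = 0\<^sub>v n"
    using c u[of n] by (intro eq_vecI) (auto simp del: index_mult_mat_vec)
  then have "W' *\<^sub>v (W *\<^sub>v ?u n) = 0\<^sub>v n" using c by auto
  then show ?thesis using inv_pair_cancel(4)[OF W u[of n]] by simp
qed

text \<open>P and Q are eigenbases of \<open>A\<close> and \<open>A\<^sup>*\<close>, and R expresses
  the split vectors in the basis Q, so G = QR is the split basis. \<open>A\<close> becomes L by
  construction. \<open>A\<^sup>*\<close> becomes upper triangular by comparison with Q and
  Hessenberg by comparison with P, that is, upper bidiagonal.\<close>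

lemma exists_LB_UB_conjugate:
  fixes \<Psi> :: "'a::field mat leonard_sys"
  assumes \<Psi>: "leonard_system (mat_algebra d) d \<Psi>"
  obtains f where "k_algebra_isomorphism (mat_algebra d) (mat_algebra d) f" "LB_UB_system d (map_sys d f \<Psi>)"
proof -
  let ?A = "mat_algebra d :: ('a, 'a mat) module" and ?n = "d + 1"
  define n where "n = d + 1"
  define A As where "A = elt \<Psi>" and "As = dual_elt \<Psi>"
  have c: "A \<in> carrier_mat n n" "As \<in> carrier_mat n n"
    using leonard_system_mat[OF \<Psi>] by (simp_all add: A_def As_def n_def)
  define \<theta> \<theta>s where "\<theta> = eigenvalue_sequence ?A d \<Psi>" and "\<theta>s = dual_eigenvalue_sequence ?A d \<Psi>"
  have mf: "multiplicity_free ?A d A" "multiplicity_free ?A d As"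
    and seq: "idempotent_sequence ?A d A As (idem \<Psi>)" "idempotent_sequence ?A d As A (dual_idem \<Psi>)"
    using \<Psi> unfolding leonard_system_def A_def As_def by blast+
  obtain P P' where P: "inv_pair n P P'" "A * P = P * dmat n \<theta>" "tridiag d (P' * As * P)" "inj_on \<theta> {..d}"
    unfolding n_def
    by (rule idempotent_sequence_tridiag[OF mf(1) c(2)[unfolded n_def] seq(1), of \<theta>])
      (auto simp: \<theta>_def A_def eigenvalue_sequence_def)
  obtain Q Q' where Q: "inv_pair n Q Q'" "As * Q = Q * dmat n \<theta>s" "tridiag d (Q' * A * Q)" "inj_on \<theta>s {..d}"
    unfolding n_def
    by (rule idempotent_sequence_tridiag[OF mf(2) c(1)[unfolded n_def] seq(2), of \<theta>s])
      (auto simp: \<theta>s_def As_def dual_eigenvalue_sequence_def)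
  note Pc = inv_pair_carrier[OF P(1)] and Qc = inv_pair_carrier[OF Q(1)]
  define T where "T = Q' * A * Q"
  have T: "T \<in> carrier_mat n n" using Qc c by (simp add: T_def)
  have assoc [simp]: "X * Y * Z = X * (Y * Z)"
    if "X \<in> carrier_mat n n" "Y \<in> carrier_mat n n" "Z \<in> carrier_mat n n" for X Y Z :: "'a mat"
    using that by (rule assoc_mult_mat)
  note cancelP = inv_pair_cancel(1,2)[OF P(1)] and cancelQ = inv_pair_cancel(1,2)[OF Q(1)]
  let ?u = "split_vec n T \<theta>"
  have u: "?u i \<in> carrier_vec n" for i by (rule split_vec_closed[OF T])
  \<comment> \<open>\<open>T\<close> is \<open>A\<close> written in the eigenbasis of
    \<open>A\<^sup>*\<close>; the rows of \<open>P' * Q\<close> are its left eigenvectors, as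
    \<open>split_vec_end\<close> requires.\<close>
  have W: "inv_pair n (Q' * P) (P' * Q)" using inv_pair_mult[OF inv_pair_sym[OF Q(1)] P(1)] .
  have P'A: "P' * A = dmat n \<theta> * P'" using conj_diag(2)[OF P(1) c(1) P(2)] .
  have "P' * Q * T = P' * A * Q"
    using Pc Qc c cancelQ(2)[of "A * Q" n] by (simp add: T_def)
  also have "\<dots> = dmat n \<theta> * (P' * Q)" unfolding P'A using Pc Qc by simp
  finally have u_end: "?u n = 0\<^sub>v n" by (rule split_vec_end[OF T W])
  have lead: "?u i $ i \<noteq> 0" "\<And>k. k < n \<Longrightarrow> i < k \<Longrightarrow> ?u i $ k = 0" if "i < n" for i
    using split_vec_leading[of T d i \<theta>] T Q(3) that by (auto simp: n_def T_def)
  define R where "R = mat n n (\<lambda>(i, j). ?u j $ i)"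
  have Rc: "R \<in> carrier_mat n n" by (simp add: R_def)
  let ?r = "\<lambda>i. d - i"
  have r: "inj_on ?r {..<n}" unfolding n_def by (rule rank_inj[OF rank_rev])
  have Rtri: "tri n ?r R"
    unfolding tri_def
  proof (intro conjI Rc allI impI)
    fix i j assume ij: "i < n" "j < n" "R $$ (i, j) \<noteq> 0"
    then have "\<not> j < i" using lead(2)[of j i] by (auto simp: R_def)
    then show "d - j \<le> d - i" by simp
  qed
  have Rnz: "R $$ (k, k) \<noteq> 0" if "k < n" for k using lead(1)[OF that] that by (simp add: R_def)
  obtain R' where R: "inv_pair n R R'"
    using exists_inv_pair[OF Rc] tri_kernel[OF Rtri r Rnz] by blast
  note R'c = inv_pair_carrier(2)[OF R] and cancelR = inv_pair_cancel(1,2)[OF R]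
  define L where "L = mat n n (\<lambda>(i, j). if i = j then \<theta> i else if i = j + 1 then 1 else 0)"
  have Lc: "L \<in> carrier_mat n n" by (simp add: L_def)
  have TR: "T * R = R * L"
  proof (rule eq_matI)
    fix i j assume "i < dim_row (R * L)" "j < dim_col (R * L)"
    then have ij: "i < n" "j < n" using Rc Lc by auto
    have "(T * R) $$ (i, j) = (\<Sum>l<n. T $$ (i, l) * R $$ (l, j))"
      using T Rc ij by (rule index_mult_mat_sum)
    also have "\<dots> = (T *\<^sub>v ?u j) $ i"
      using index_mult_mat_vec_sum[OF T u[of j] ij(1)] ij by (simp add: R_def)
    also have "\<dots> = ?u (Suc j) $ i + \<theta> j * ?u j $ i"
      using split_vec_Suc_index[OF T ij(1), of \<theta> j] by simp
    \<comment> \<open>In the last column the index \<open>Suc j\<close> falls outside the matrix;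
      the missing term is the vector that vanishes by \<open>u_end\<close>.\<close>
    also have "\<dots> = (\<Sum>l\<in>{j, Suc j} \<inter> {..<n}. R $$ (i, l) * L $$ (l, j))"
    proof (cases "Suc j < n")
      case True
      then have "{j, Suc j} \<inter> {..<n} = {j, Suc j}" by auto
      then show ?thesis using True ij by (simp add: R_def L_def algebra_simps del: split_vec.simps)
    next
      case False
      then have "{j, Suc j} \<inter> {..<n} = {j}" "Suc j = n" using ij by auto
      then show ?thesis using ij u_end by (simp add: R_def L_def algebra_simps del: split_vec.simps)
    qed
    also have "\<dots> = (\<Sum>l<n. R $$ (i, l) * L $$ (l, j))"
      using ij by (intro sum.mono_neutral_left) (auto simp: L_def)
    also have "\<dots> = (R * L) $$ (i, j)"
      using Rc Lc ij by (rule index_mult_mat_sum[symmetric])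
    finally show "(T * R) $$ (i, j) = (R * L) $$ (i, j)" .
  qed (use T Rc Lc in auto)
  define G G' where "G = Q * R" and "G' = R' * Q'"
  have G: "inv_pair n G G'" unfolding G_def G'_def by (rule inv_pair_mult[OF Q(1) R])
  note Gc = inv_pair_carrier[OF G] and cancelG = inv_pair_cancel(1,2)[OF G]
  define Bs where "Bs = G' * As * G"
  have Bsc: "Bs \<in> carrier_mat n n" using Gc c by (simp add: Bs_def)
  have GL: "G' * A * G = L"
  proof -
    have "G' * A * G = R' * (T * R)" using Rc R'c Qc c by (simp add: G_def G'_def T_def)
    then show ?thesis using cancelR(1)[OF Lc] by (simp add: TR)
  qed
  have Bs_eq: "Bs = R' * dmat n \<theta>s * R"
  proof -
    have "Bs = R' * (Q' * (As * Q) * R)" using Rc R'c Qc c by (simp add: Bs_def G_def G'_def)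
    then show ?thesis using Rc R'c Qc cancelQ(1)[OF mult_carrier_mat[OF dmat_closed Rc]] by (simp add: Q(2))
  qed
  have "filt n ?r R'" by (rule filt_inverse[OF R Rtri r Rnz])
  moreover have "filt n ?r (dmat n \<theta>s)" by (simp add: filt_iff_tri tri_def)
  ultimately have "filt n ?r Bs" unfolding Bs_eq using Rtri by (intro filt_mult) (simp_all add: filt_iff_tri)
  then have Bs_tri: "tri n ?r Bs" by (simp add: filt_iff_tri)
  \<comment> \<open>Compare diagonal entries in \<open>R * Bs = dmat n \<theta>s * R\<close>. Both
    factors on the left are upper triangular, so only the product of diagonal entries remains, and
    that of R can be cancelled.\<close>
  have Bs_diag: "Bs $$ (i, i) = \<theta>s i" if i: "i < n" for i
  proof -
    have "R * Bs = dmat n \<theta>s * R"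
      unfolding Bs_eq using Rc R'c cancelR(2)[OF mult_carrier_mat[OF dmat_closed Rc]] by simp
    then have "(R * Bs) $$ (i, i) = \<theta>s i * R $$ (i, i)" using Rc i by (simp del: index_mult_mat(1))
    moreover have "(R * Bs) $$ (i, i) = (\<Sum>l<n. R $$ (i, l) * Bs $$ (l, i))"
      using Rc Bsc i by (intro index_mult_mat_sum)
    moreover have "\<dots> = (\<Sum>l<n. if l = i then R $$ (i, i) * Bs $$ (i, i) else 0)"
    proof (intro sum.cong refl)
      fix l assume l: "l \<in> {..<n}"
      show "R $$ (i, l) * Bs $$ (l, i) = (if l = i then R $$ (i, i) * Bs $$ (i, i) else 0)"
      proof (rule ccontr)
        assume "\<not> ?thesis"
        then have "l \<noteq> i" "R $$ (i, l) \<noteq> 0" "Bs $$ (l, i) \<noteq> 0" by (auto split: if_splits)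
        then have "d - l \<le> d - i" "d - i \<le> d - l" using Rtri Bs_tri l i by (simp_all add: tri_def)
        then have "d - l = d - i" by (rule le_antisym)
        then show False using r l i \<open>l \<noteq> i\<close> by (auto simp: inj_on_def)
      qed
    qed
    ultimately show ?thesis using Rnz[OF i] i by simp
  qed
  \<comment> \<open>\<open>G' * P\<close> diagonalizes the lower triangular L, whose diagonal
    entries are distinct, so it and its inverse preserve the flag of \<open>id\<close>. Conjugating
    the tridiagonal S by it gives \<open>Bs\<close>.\<close>
  have Bs_hess: "hess n id Bs"
  proof -
    define S where "S = P' * As * P"
    have "inv_pair n (G' * P) (P' * G)" using inv_pair_mult[OF inv_pair_sym[OF G] P(1)] .
    moreover have "tri n id L" by (auto simp: tri_def L_def)
    moreover have diagL: "dmat n (\<lambda>i. L $$ (i, i)) = dmat n \<theta>" by (rule eq_matI) (auto simp: L_def)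
    moreover have "inj_on (\<lambda>i. L $$ (i, i)) {..<n}"
      using P(4) by (auto simp: inj_on_def L_def n_def)
    moreover have "L * (G' * P) = G' * P * dmat n (\<lambda>i. L $$ (i, i))"
    proof -
      have "L * (G' * P) = G' * (A * (G * (G' * P)))" unfolding GL[symmetric] using Gc Pc c by simp
      also have "\<dots> = G' * (A * P)" using cancelG(2)[OF Pc(1)] by simp
      finally show ?thesis unfolding diagL P(2) using Gc Pc by simp
    qed
    ultimately have f: "filt n id (G' * P)" "filt n id (P' * G)"
      using tri_diagonalizer(3,4)[of n id L "G' * P" "P' * G"] by (simp_all add: inj_on_id)
    have "hess n id S"
      unfolding hess_def
    proof (intro conjI allI impI)
      show "S \<in> carrier_mat n n" using Pc c by (simp add: S_def)
      fix i j assume ij: "i < n" "j < n" "S $$ (i, j) \<noteq> 0"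
      have "\<not> \<bar>int i - int j\<bar> > 1" using P(3) ij by (auto simp: tridiag_def S_def n_def)
      then show "id j \<le> id i + 1" by auto
    qed
    then have "hess n id (G' * P * S * (P' * G))" by (rule hess_conj[OF f])
    moreover have "G' * P * S * (P' * G) = Bs"
    proof -
      have "G' * P * S * (P' * G) = G' * (P * (P' * (As * (P * (P' * G)))))"
        using Gc Pc c by (simp add: S_def)
      also have "\<dots> = G' * (As * G)" using Gc c cancelP(2)[of "As * G" n] cancelP(2)[OF Gc(1)] by simp
      finally show ?thesis using Gc c by (simp add: Bs_def)
    qed
    ultimately show ?thesis by simp
  qed
  let ?f = "\<lambda>X. G' * X * G"
  have f_iso: "k_algebra_isomorphism ?A ?A ?f" using G unfolding n_def by (rule conj_iso)
  interpret k_algebra_isomorphism ?A ?A ?f by (rule f_iso)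
  let ?\<Phi> = "map_sys d ?f \<Psi>"
  have elts: "elt ?\<Phi> = L" "dual_elt ?\<Phi> = Bs" using GL by (simp_all add: A_def As_def Bs_def)
  have "lower_bidiagonal L" by (auto simp: lower_bidiagonal_def L_def split: if_splits)
  moreover have "upper_bidiagonal Bs"
    unfolding upper_bidiagonal_def lower_bidiagonal_def
  proof (intro allI impI)
    fix i j assume "i < dim_row (transpose_mat Bs)" "j < dim_col (transpose_mat Bs)" "transpose_mat Bs $$ (i, j) \<noteq> 0"
    then have "j < n" "i < n" "Bs $$ (j, i) \<noteq> 0" using Bsc by auto
    then have "i \<le> j + 1" "d - i \<le> d - j" using Bs_hess Bs_tri by (auto simp: hess_def tri_def)
    then show "i = j \<or> i = j + 1" using \<open>i < n\<close> \<open>j < n\<close> by (auto simp: n_def)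
  qed
  moreover have "\<forall>i\<in>{1..d}. L $$ (i, i - 1) = 1" by (auto simp: L_def n_def)
  moreover have "\<theta> i = L $$ (i, i)" "\<theta>s i = Bs $$ (i, i)" if "i \<le> d" for i
    using that Bs_diag by (simp_all add: L_def n_def)
  moreover have "leonard_system ?A d ?\<Phi>" by (rule leonard_system_map[OF \<Psi> ambient_algebra_mat])
  ultimately have "LB_UB_system d ?\<Phi>"
    using eigenvalue_sequence_map[OF leonard_system_sys_in[OF \<Psi>]]
    unfolding LB_UB_system_def elts \<theta>_def \<theta>s_def by metis
  then show thesis using f_iso by (rule that[rotated])
qed

section \<open>Parameter arrays and canonical forms\<close>

text \<open>Serves \<open>V\<close> over \<open>\<A>\<close> as well as \<open>W\<close> over the
  matrix algebra (with \<open>h = id\<close>), so these two modules are compared only through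
  columns.\<close>

lemma parameter_array_col_module:
  fixes h :: "'a::field mat \<Rightarrow> 'b"
  assumes "k_algebra_isomorphism (mat_algebra d) \<A> h" "irreducible_left_module \<A> V"
    and "leonard_system (mat_algebra d) d \<Psi>"
  shows "parameter_array \<A> V d (map_sys d h \<Psi>) = parameter_array (mat_algebra d) (col_module d) d \<Psi>"
proof -
  obtain \<psi> where "module_isomorphism (mat_algebra d) \<A> h (col_module d) V \<psi>"
    using exists_module_isomorphism[OF assms(1,2)] by blast
  then show ?thesis using assms(3) by (rule module_isomorphism.parameter_array_map)
qed

lemma parameter_array_LB_UB:
  assumes "LB_UB_system d \<Psi>"
  shows "pL d (parameter_array (mat_algebra d) (col_module d) d \<Psi>) = elt \<Psi>"
    and "pU d (parameter_array (mat_algebra d) (col_module d) d \<Psi>) = dual_elt \<Psi>"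
proof -
  have L: "leonard_system (mat_algebra d) d \<Psi>" using assms by (simp only: LB_UB_system_def)
  note c = leonard_system_mat[OF L]
  have lb: "lower_bidiagonal (elt \<Psi>)" "upper_bidiagonal (dual_elt \<Psi>)"
    and s: "\<forall>i\<in>{1..d}. elt \<Psi> $$ (i, i - 1) = 1"
    and ev: "\<And>i. i \<le> d \<Longrightarrow> eigenvalue_sequence (mat_algebra d) d \<Psi> i = elt \<Psi> $$ (i, i)"
      "\<And>i. i \<le> d \<Longrightarrow> dual_eigenvalue_sequence (mat_algebra d) d \<Psi> i = dual_elt \<Psi> $$ (i, i)"
    using assms unfolding LB_UB_system_def by blast+
  show "pL d (parameter_array (mat_algebra d) (col_module d) d \<Psi>) = elt \<Psi>"
  proof (rule eq_matI)
    fix i j assume "i < dim_row (elt \<Psi>)" "j < dim_col (elt \<Psi>)"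
    then have ij: "i < d + 1" "j < d + 1" using c by auto
    have "elt \<Psi> $$ (i, j) = 0" if "i \<noteq> j" "i \<noteq> j + 1"
      using lb(1) ij c that by (auto simp: lower_bidiagonal_def)
    moreover have "elt \<Psi> $$ (i, j) = 1" if "i = j + 1" using bspec[OF s, of i] ij that by simp
    ultimately show "pL d (parameter_array (mat_algebra d) (col_module d) d \<Psi>) $$ (i, j) = elt \<Psi> $$ (i, j)"
      using ij ev(1)[of i] unfolding pL_def parameter_array_def param_array.simps by auto
  qed (use c in \<open>auto simp: pL_def\<close>)
  show "pU d (parameter_array (mat_algebra d) (col_module d) d \<Psi>) = dual_elt \<Psi>"
  proof (rule eq_matI)
    fix i j assume "i < dim_row (dual_elt \<Psi>)" "j < dim_col (dual_elt \<Psi>)"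
    then have ij: "i < d + 1" "j < d + 1" using c by auto
    have "dual_elt \<Psi> $$ (i, j) = 0" if "i \<noteq> j" "j \<noteq> i + 1"
      using lb(2) ij c that by (auto simp: lower_bidiagonal_def upper_bidiagonal_def)
    moreover have "first_split_sequence (mat_algebra d) (col_module d) d \<Psi> j = dual_elt \<Psi> $$ (i, j)"
      if "j = i + 1"
      using first_split_sequence_LB_UB[OF assms, of j] ij that by simp
    ultimately show "pU d (parameter_array (mat_algebra d) (col_module d) d \<Psi>) $$ (i, j) = dual_elt \<Psi> $$ (i, j)"
      using ij ev(2)[of i] unfolding pU_def parameter_array_def param_array.simps by auto
  qed (use c in \<open>auto simp: pU_def\<close>)
qed

lemma leonard_system_LB_UB_iso:
  fixes \<A> :: "('a::field, 'b) module"
  assumes \<Phi>: "leonard_system \<A> d \<Phi>"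
  obtains f where "k_algebra_isomorphism \<A> (mat_algebra d) f" "LB_UB_system d (map_sys d f \<Phi>)"
proof -
  obtain g where "g \<in> k_algebra_iso \<A> (mat_algebra d)"
    using \<Phi> by (auto simp: leonard_system_def ambient_algebra_def)
  then interpret g: k_algebra_isomorphism \<A> "mat_algebra d" g
    using leonard_system_k_algebra[OF \<Phi>] k_algebra_mat by unfold_locales blast+
  have "leonard_system (mat_algebra d) d (map_sys d g \<Phi>)"
    using \<Phi> ambient_algebra_mat by (rule g.leonard_system_map)
  then obtain f where f: "k_algebra_isomorphism (mat_algebra d) (mat_algebra d) f"
    "LB_UB_system d (map_sys d f (map_sys d g \<Phi>))" by (rule exists_LB_UB_conjugate)
  interpret f: k_algebra_isomorphism "mat_algebra d" "mat_algebra d" f by (rule f(1))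
  have "k_algebra_isomorphism \<A> (mat_algebra d) (f \<circ> g)"
    using g.dom k_algebra_mat k_algebra_iso_comp[OF g.iso f.iso] by unfold_locales blast+
  moreover have "map_sys d f (map_sys d g \<Phi>) = map_sys d (f \<circ> g) \<Phi>"
    by (auto simp: map_sys_def fun_eq_iff)
  ultimately show thesis using f(2) by (intro that[of "f \<circ> g"]) simp_all
qed

section \<open>From canonical forms back to Leonard systems\<close>

lemma LB_UB_canonical_of_system:
  assumes \<Psi>: "LB_UB_system d \<Psi>"
  shows "LB_UB_canonical d (elt \<Psi>) (dual_elt \<Psi>)"
  using \<Psi> unfolding LB_UB_system_def LB_UB_canonical_def leonard_pair_def leonard_system_def by blast

text \<open>An explicit candidate for the system that \<open>designated_system\<close> describes by
  \<open>THE\<close>.\<close>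

definition canonical_system :: "nat \<Rightarrow> 'a::field mat \<Rightarrow> 'a mat \<Rightarrow> 'a mat leonard_sys" where
  "canonical_system d B Bs = \<lparr>elt = B, dual_elt = Bs,
     idem = (\<lambda>i\<in>{0..d}. primitive_idempotent (mat_algebra d) d B (B $$ (i, i))),
     dual_idem = (\<lambda>i\<in>{0..d}. primitive_idempotent (mat_algebra d) d Bs (Bs $$ (i, i)))\<rparr>"

text \<open>\<open>B\<close> is triangular and \<open>Bs\<close> Hessenberg for the rank
  \<open>id\<close>; for the reversed rank the roles are exchanged. Hence
  \<open>idempotent_sequence_diagonal\<close> applies to the pair in both orders.\<close>

lemma LB_UB_system_canonical:
  fixes B Bs :: "'a::field mat"
  assumes can: "LB_UB_canonical d B Bs"
  shows "LB_UB_system d (canonical_system d B Bs)"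
proof -
  let ?A = "mat_algebra d :: ('a, 'a mat) module"
  have mf: "multiplicity_free ?A d B" "multiplicity_free ?A d Bs"
    and bi: "lower_bidiagonal B" "upper_bidiagonal Bs"
    using can unfolding LB_UB_canonical_def leonard_pair_def by blast+
  obtain F Fs where F: "idempotent_sequence ?A d B Bs F" "idempotent_sequence ?A d Bs B Fs"
    using can unfolding LB_UB_canonical_def leonard_pair_def by blast
  have c: "B \<in> carrier_mat (d + 1) (d + 1)" "Bs \<in> carrier_mat (d + 1) (d + 1)"
    using mf by (simp_all add: multiplicity_free_def module_mat_simps)
  note t = bidiagonal_tri_hess(1,2)[OF c(1) bi(1)] bidiagonal_tri_hess(3,4)[OF c(2) bi(2)]
  have seq: "idempotent_sequence ?A d B Bs (idem (canonical_system d B Bs))"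
    "idempotent_sequence ?A d Bs B (dual_idem (canonical_system d B Bs))"
    using idempotent_sequence_diagonal[OF mf(1) t(1,4) rank_id F(1)]
      idempotent_sequence_diagonal[OF mf(2) t(3,2) rank_rev F(2)]
    by (simp_all add: canonical_system_def)
  have "leonard_system ?A d (canonical_system d B Bs)"
    using mf seq ambient_algebra_mat unfolding leonard_system_def
    by (simp add: canonical_system_def)
  moreover have "B $$ (i, i) \<in> eigenvalues ?A d B" "Bs $$ (i, i) \<in> eigenvalues ?A d Bs" if "i \<le> d" for i
    using that tri_eigenvalues(1)[OF mf(1) t(1) rank_inj[OF rank_id]]
      tri_eigenvalues(1)[OF mf(2) t(3) rank_inj[OF rank_rev]] by auto
  then have "eigenvalue_sequence ?A d (canonical_system d B Bs) i = B $$ (i, i)"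
    "dual_eigenvalue_sequence ?A d (canonical_system d B Bs) i = Bs $$ (i, i)" if "i \<le> d" for i
    using that eigenvalue_of_primitive_idempotent[OF mf(1) F(1)] eigenvalue_of_primitive_idempotent[OF mf(2) F(2)]
    by (simp_all add: eigenvalue_sequence_def dual_eigenvalue_sequence_def canonical_system_def)
  ultimately show ?thesis
    using can unfolding LB_UB_system_def LB_UB_canonical_def by (simp add: canonical_system_def)
qed

lemma designated_system_eq:
  fixes B Bs :: "'a::field mat"
  assumes can: "LB_UB_canonical d B Bs"
  shows "designated_system d B Bs = canonical_system d B Bs"
proof -
  let ?A = "mat_algebra d :: ('a, 'a mat) module" and ?\<Psi> = "canonical_system d B Bs"
  have S: "LB_UB_system d ?\<Psi>" using can by (rule LB_UB_system_canonical)
  have elts: "elt ?\<Psi> = B" "dual_elt ?\<Psi> = Bs" by (simp_all add: canonical_system_def)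
  have L: "leonard_system ?A d ?\<Psi>" and ev: "\<And>i. i \<le> d \<Longrightarrow> eigenvalue_sequence ?A d ?\<Psi> i = B $$ (i, i)"
    "\<And>i. i \<le> d \<Longrightarrow> dual_eigenvalue_sequence ?A d ?\<Psi> i = Bs $$ (i, i)"
    using S unfolding LB_UB_system_def elts by blast+
  have seq: "eigenvalue_sequence ?A d ?\<Psi> = (\<lambda>i\<in>{0..d}. B $$ (i, i))"
    "dual_eigenvalue_sequence ?A d ?\<Psi> = (\<lambda>i\<in>{0..d}. Bs $$ (i, i))"
  proof (rule_tac [!] extensionalityI[of _ "{0..d}"])
    show "eigenvalue_sequence ?A d ?\<Psi> \<in> extensional {0..d}"
      "dual_eigenvalue_sequence ?A d ?\<Psi> \<in> extensional {0..d}"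
      unfolding eigenvalue_sequence_def dual_eigenvalue_sequence_def by simp_all
  qed (simp_all only: ev atLeastAtMost_iff restrict_apply' restrict_extensional)
  show ?thesis
    unfolding designated_system_def
  proof (rule the_equality)
    show "associated ?A d B Bs ?\<Psi> \<and> eigenvalue_sequence ?A d ?\<Psi> = (\<lambda>i\<in>{0..d}. B $$ (i, i)) \<and>
        dual_eigenvalue_sequence ?A d ?\<Psi> = (\<lambda>i\<in>{0..d}. Bs $$ (i, i))"
      using L elts seq by (simp only: associated_def simp_thms)
  next
    fix \<Phi> assume \<Phi>: "associated ?A d B Bs \<Phi> \<and> eigenvalue_sequence ?A d \<Phi> = (\<lambda>i\<in>{0..d}. B $$ (i, i)) \<and>
        dual_eigenvalue_sequence ?A d \<Phi> = (\<lambda>i\<in>{0..d}. Bs $$ (i, i))"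
    then show "\<Phi> = ?\<Psi>"
      using L elts ev by (intro leonard_system_eqI[of ?A d]) (auto simp: associated_def)
  qed
qed

text \<open>The diagonals of the two matrices already give both eigenvalue sequences, and these
  determine a system with given pair.\<close>

lemma parameter_array_eqI:
  assumes "associated \<A> d A As \<Phi>" "associated \<A> d A As \<Phi>'"
    and "pL d (parameter_array \<A> V d \<Phi>) = pL d (parameter_array \<A> V d \<Phi>')"
    and "pU d (parameter_array \<A> V d \<Phi>) = pU d (parameter_array \<A> V d \<Phi>')"
  shows "\<Phi> = \<Phi>'"
proof -
  have "eigenvalue_sequence \<A> d \<Phi> i = eigenvalue_sequence \<A> d \<Phi>' i"
    "dual_eigenvalue_sequence \<A> d \<Phi> i = dual_eigenvalue_sequence \<A> d \<Phi>' i" if "i \<le> d" for i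
    using arg_cong[OF assms(3), of "\<lambda>M. M $$ (i, i)"] arg_cong[OF assms(4), of "\<lambda>M. M $$ (i, i)"] that
    by (simp_all add: pL_def pU_def parameter_array_def)
  then show ?thesis using assms(1,2) by (intro leonard_system_eqI[of \<A> d]) (auto simp: associated_def)
qed

text \<open>Counting eigenvalues: isomorphisms preserve them, and multiplicity-freeness makes their
  number d + 1 on one side and n + 1 on the other.\<close>

lemma canonical_form_diameter:
  assumes lp: "leonard_pair \<A> d A As" and can: "LB_UB_canonical n B Bs"
    and iso: "leonard_pair_iso \<A> A As (mat_algebra n) B Bs"
  shows "n = d"
proof -
  have amb: "ambient_algebra \<A> d" and A: "A \<in> carrier \<A>" "card (eigenvalues \<A> d A) = d + 1"
    using lp by (simp_all only: leonard_pair_def multiplicity_free_def)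
  obtain f where f: "f \<in> k_algebra_iso \<A> (mat_algebra n)" "f A = B"
    using iso by (auto simp: leonard_pair_iso_def)
  interpret f: k_algebra_isomorphism \<A> "mat_algebra n" f
    using f amb k_algebra_mat unfolding ambient_algebra_def by unfold_locales blast+
  obtain g where g: "g \<in> k_algebra_iso \<A> (mat_algebra d)"
    using amb by (auto simp: ambient_algebra_def)
  interpret g: k_algebra_isomorphism \<A> "mat_algebra d" g
    using g amb k_algebra_mat unfolding ambient_algebra_def by unfold_locales blast+
  interpret h: k_algebra_isomorphism "mat_algebra n" \<A> "inv_into (carrier \<A>) f" by (rule f.inverse)
  have B: "B \<in> carrier_mat (n + 1) (n + 1)" and gA: "g A \<in> carrier_mat (d + 1) (d + 1)"
    using f.hom_closed[OF A(1)] g.hom_closed[OF A(1)] f(2) by (simp_all add: module_mat_simps)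
  have "(g \<circ> inv_into (carrier \<A>) f) B = g A" using f.inv_into_simps(2)[OF A(1)] f(2) by auto
  then have eq: "eigenvalue (g A) t \<longleftrightarrow> eigenvalue B t" for t
    using eigenvalue_mat_algebra_iso[OF k_algebra_iso_comp[OF h.iso g] B] by simp
  have "eigenvalues (mat_algebra d) d (g A) = eigenvalues (mat_algebra n) n B"
    unfolding eigenvalues_mat[OF B] eigenvalues_mat[OF gA] eq ..
  moreover have "eigenvalues (mat_algebra d) d (g A) = eigenvalues \<A> d A" by (rule g.eigenvalues_map[OF A(1)])
  moreover have "card (eigenvalues (mat_algebra n) n B) = n + 1"
    using can by (simp only: LB_UB_canonical_def leonard_pair_def multiplicity_free_def)
  ultimately show ?thesis using A(2) by simp
qed

lemma map_sys_id:
  assumes "leonard_system \<A> d \<Phi>"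
  shows "map_sys d id \<Phi> = \<Phi>"
  using assms by (auto simp: map_sys_def leonard_system_def idempotent_sequence_def extensional_def fun_eq_iff
      intro!: leonard_sys.equality)

text \<open>This is surjectivity, with an explicit preimage: the canonical system of (B, Bs), pulled
  back to \<open>\<A>\<close> along the isomorphism, has a parameter array that can be read off in
  the column module.\<close>

lemma canonical_form_parameter_array:
  fixes \<A> :: "('a::field, 'b) module" and V :: "('b, 'v) module"
  assumes lp: "leonard_pair \<A> d A As" and V: "irreducible_left_module \<A> V"
    and BBs: "(B, Bs) \<in> LB_UB_canonical_forms \<A> A As"
  defines "p \<equiv> parameter_array (mat_algebra d) (col_module d) d (canonical_system d B Bs)"
  shows "LB_UB_canonical d B Bs" "p \<in> parameter_arrays \<A> V d A As" "pL d p = B" "pU d p = Bs"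
proof -
  let ?A = "mat_algebra d :: ('a, 'a mat) module" and ?\<Psi> = "canonical_system d B Bs"
  obtain n where n: "LB_UB_canonical n B Bs" "leonard_pair_iso \<A> A As (mat_algebra n) B Bs"
    using BBs by (auto simp: LB_UB_canonical_forms_def)
  with canonical_form_diameter[OF lp n]
  show can: "LB_UB_canonical d B Bs" by simp
  have "leonard_pair_iso \<A> A As ?A B Bs" using n canonical_form_diameter[OF lp n] by simp
  then obtain f where f: "f \<in> k_algebra_iso \<A> ?A" "f A = B" "f As = Bs"
    unfolding leonard_pair_iso_def by blast
  have amb: "ambient_algebra \<A> d" and A: "A \<in> carrier \<A>" "As \<in> carrier \<A>"
    using lp by (simp_all only: leonard_pair_def multiplicity_free_def)
  interpret f: k_algebra_isomorphism \<A> ?A f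
    using f amb k_algebra_mat unfolding ambient_algebra_def by unfold_locales blast+
  interpret h: k_algebra_isomorphism ?A \<A> "inv_into (carrier \<A>) f" by (rule f.inverse)
  have S: "LB_UB_system d ?\<Psi>" using can by (rule LB_UB_system_canonical)
  then have L: "leonard_system ?A d ?\<Psi>" by (simp only: LB_UB_system_def)
  have elts: "elt ?\<Psi> = B" "dual_elt ?\<Psi> = Bs" by (simp_all add: canonical_system_def)
  let ?\<Phi> = "map_sys d (inv_into (carrier \<A>) f) ?\<Psi>"
  have "associated \<A> d A As ?\<Phi>"
    using h.leonard_system_map[OF L amb] f.inv_into_simps(2)[OF A(1)] f.inv_into_simps(2)[OF A(2)] f(2,3)
    by (simp add: associated_def elts)
  moreover have "p = parameter_array \<A> V d ?\<Phi>"
    unfolding p_def by (rule parameter_array_col_module[OF f.inverse V L, symmetric])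
  ultimately show "p \<in> parameter_arrays \<A> V d A As" by (auto simp: parameter_arrays_def)
  show "pL d p = B" "pU d p = Bs" using parameter_array_LB_UB[OF S] unfolding p_def elts by blast+
qed

theorem theorem15p8:
  fixes \<A> :: "('a::field, 'b) module" and A As :: 'b and d :: nat
    and V :: "('b, 'v) module" and W :: "('a mat, 'w) module"
  assumes "leonard_pair \<A> d A As"
    and "irreducible_left_module \<A> V"
    and "irreducible_left_module (mat_algebra d) W"
  shows "bij_betw (\<lambda>p. (pL d p, pU d p))
           (parameter_arrays \<A> V d A As) (LB_UB_canonical_forms \<A> A As) \<and>
         (\<forall>(B, Bs) \<in> LB_UB_canonical_forms \<A> A As.
            the_inv_into (parameter_arrays \<A> V d A As) (\<lambda>p. (pL d p, pU d p)) (B, Bs)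
            = designated_parameter_array W d B Bs)"
proof -
  let ?A = "mat_algebra d :: ('a, 'a mat) module"
  let ?F = "\<lambda>p. (pL d p, pU d p)"
  let ?P = "parameter_arrays \<A> V d A As" and ?C = "LB_UB_canonical_forms \<A> A As"
  have inj: "inj_on ?F ?P"
    by (rule inj_onI) (auto simp: parameter_arrays_def dest: parameter_array_eqI)
  have into: "?F p \<in> ?C" if "p \<in> ?P" for p
  proof -
    from that obtain \<Phi> where \<Phi>: "leonard_system \<A> d \<Phi>" "elt \<Phi> = A" "dual_elt \<Phi> = As"
      and p: "p = parameter_array \<A> V d \<Phi>"
      by (auto simp: parameter_arrays_def associated_def)
    obtain f where f: "k_algebra_isomorphism \<A> ?A f" "LB_UB_system d (map_sys d f \<Phi>)"
      by (rule leonard_system_LB_UB_iso[OF \<Phi>(1)])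
    interpret f: k_algebra_isomorphism \<A> ?A f by (rule f(1))
    have "leonard_system ?A d (map_sys d f \<Phi>)" using f(2) by (simp only: LB_UB_system_def)
    \<comment> \<open>\<open>V\<close> is a module over \<open>\<A>\<close>, so the comparison with
      columns runs along the inverse of \<open>f\<close>, and mapping back returns
      \<open>\<Phi>\<close> itself.\<close>
    from parameter_array_col_module[OF f.inverse assms(2) this]
    have "p = parameter_array ?A (col_module d) d (map_sys d f \<Phi>)"
      by (simp only: p f.map_sys_inverse[OF \<Phi>(1)])
    then have "pL d p = f A" "pU d p = f As"
      using parameter_array_LB_UB[OF f(2)] \<Phi>(2,3) by simp_all
    moreover have "LB_UB_canonical d (f A) (f As)"
      using LB_UB_canonical_of_system[OF f(2)] \<Phi>(2,3) by simp
    moreover have "leonard_pair_iso \<A> A As ?A (f A) (f As)"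
      using f.iso unfolding leonard_pair_iso_def by blast
    ultimately show ?thesis unfolding LB_UB_canonical_forms_def by auto
  qed
  note form = canonical_form_parameter_array[OF assms(1,2)]
  have "?F ` ?P = ?C"
  proof (intro equalityI subsetI)
    fix c assume c: "c \<in> ?C"
    obtain B Bs where [simp]: "c = (B, Bs)" by (cases c)
    show "c \<in> ?F ` ?P" using form(2-4)[of B Bs] c by (intro rev_image_eqI) auto
  qed (use into in auto)
  moreover have "the_inv_into ?P ?F (B, Bs) = designated_parameter_array W d B Bs" if c: "(B, Bs) \<in> ?C" for B Bs
  proof (rule the_inv_into_f_eq[OF inj])
    have can: "LB_UB_canonical d B Bs" using c by (rule form(1))
    have L: "leonard_system ?A d (canonical_system d B Bs)"
      using LB_UB_system_canonical[OF can] by (simp only: LB_UB_system_def)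
    have "k_algebra_isomorphism ?A ?A id"
      using k_algebra_mat id_k_algebra_iso by unfold_locales blast+
    from parameter_array_col_module[OF this assms(3) L]
    have eq: "designated_parameter_array W d B Bs = parameter_array ?A (col_module d) d (canonical_system d B Bs)"
      by (simp only: designated_parameter_array_def designated_system_eq[OF can] map_sys_id[OF L])
    show "?F (designated_parameter_array W d B Bs) = (B, Bs)" "designated_parameter_array W d B Bs \<in> ?P"
      unfolding eq using form(2-4)[OF c] by simp_all
  qed
  ultimately show ?thesis using inj by (auto simp: bij_betw_def)
qed

end
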